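(* Let $X$ be a separable real Banach space with the Radon-Nikodym Property, and let $G$ be a countable bounded group of isomorphisms on $X$ which contains $-\mathrm{Id}$ and such that some point $x_0\in X$ separates $G$ and has discrete orbit $Gx_0$. Then $X$ admits an equivalent norm for which $G$ is equal to the group of isometries on $X$.
   Context: An isomorphism on $X$ is a bounded linear bijection of $X$ onto itself; a group of isomorphisms (under composition) is bounded if $\sup_{g\in G}\|g\|<\infty$. The group of isometries on $X$ for a given norm is the group of all surjective linear isometries of $X$ onto itself for that norm. Countable means finite or countably infinite. A point $x_0$ separates $G$ if $gx_0\neq hx_0$ whenever $g\neq h$ in $G$ (equivalently $gx_0\neq x_0$ for all $g\in G$, $g\neq \mathrm{Id}$). The orbit $Gx_0=\{gx_0: g\in G\}$ is discrete if it is a discrete set in the norm topology. *)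

theory Defs
  imports "HOL-Analysis.Analysis"
begin

section \<open>The Radon-Nikodym Property\<close>

definition vector_measure :: "'m measure \<Rightarrow> ('m set \<Rightarrow> 'a::real_normed_vector) \<Rightarrow> bool" where
  "vector_measure M F \<longleftrightarrow>
     (\<forall>A :: nat \<Rightarrow> 'm set. range A \<subseteq> sets M \<longrightarrow> disjoint_family A \<longrightarrow>
        (\<lambda>i. F (A i)) sums F (\<Union>i. A i))"

definition has_bounded_variation_on_sets ::
    "'m measure \<Rightarrow> ('m set \<Rightarrow> 'a::real_normed_vector) \<Rightarrow> bool" where
  "has_bounded_variation_on_sets M F \<longleftrightarrow>
     bdd_above {\<Sum>E\<in>P. norm (F E) | P. finite P \<and> P \<subseteq> sets M \<and> partition_on (space M) P}"

text \<open>For a countably additive \<open>F\<close> and a finite measure \<open>M\<close>, vanishing on null sets is the same as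
  \<open>F E \<longlongrightarrow> 0\<close> for \<open>emeasure M E \<longlongrightarrow> 0\<close>.\<close>

definition vector_absolutely_continuous ::
    "'m measure \<Rightarrow> ('m set \<Rightarrow> 'a::real_normed_vector) \<Rightarrow> bool" where
  "vector_absolutely_continuous M F \<longleftrightarrow> (\<forall>E \<in> null_sets M. F E = 0)"

text \<open>The property is a statement about all finite measure spaces. A formula cannot quantify over
  the type of points, so \<open>M\<close> ranges over the finite measure spaces (with any sigma-algebra) whose
  points are reals. Nothing is lost: Lebesgue measure on \<open>[0, 1]\<close> is among them, and it is
  well known that a Banach space has the property as soon as it has it for that measure.
  The sort \<open>second_countable_topology\<close>, which for metric spaces means separability, is demanded by
  the library's Bochner integral.\<close>

definition radon_nikodym_property ::
    "'a::{banach, second_countable_topology} itself \<Rightarrow> bool" where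
  "radon_nikodym_property _ \<longleftrightarrow>
     (\<forall>(M :: real measure) (F :: real set \<Rightarrow> 'a).
        finite_measure M \<longrightarrow> vector_measure M F \<longrightarrow> has_bounded_variation_on_sets M F \<longrightarrow>
        vector_absolutely_continuous M F \<longrightarrow>
        (\<exists>g. integrable M g \<and> (\<forall>E \<in> sets M. F E = (LINT x:E|M. g x))))"

section \<open>Groups of isomorphisms\<close>

definition isomorphism :: "('a::real_normed_vector \<Rightarrow> 'a) \<Rightarrow> bool" where
  "isomorphism g \<longleftrightarrow> bounded_linear g \<and> bij g"

definition isomorphism_group :: "('a::real_normed_vector \<Rightarrow> 'a) set \<Rightarrow> bool" where
  "isomorphism_group G \<longleftrightarrow>
     (\<forall>g\<in>G. isomorphism g) \<and> id \<in> G \<and> (\<forall>g\<in>G. \<forall>h\<in>G. g \<circ> h \<in> G) \<and> (\<forall>g\<in>G. inv g \<in> G)"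

definition bounded_isomorphism_group :: "('a::real_normed_vector \<Rightarrow> 'a) set \<Rightarrow> bool" where
  "bounded_isomorphism_group G \<longleftrightarrow> isomorphism_group G \<and> bdd_above (onorm ` G)"

definition orbit_of :: "('a \<Rightarrow> 'a) set \<Rightarrow> 'a \<Rightarrow> 'a set" where
  "orbit_of G x = {g x | g. g \<in> G}"

definition separates :: "'a \<Rightarrow> ('a \<Rightarrow> 'a) set \<Rightarrow> bool" where
  "separates x G \<longleftrightarrow> (\<forall>g\<in>G. \<forall>h\<in>G. g \<noteq> h \<longrightarrow> g x \<noteq> h x)"

section \<open>Equivalent norms and their isometries\<close>

definition is_norm :: "('a::real_vector \<Rightarrow> real) \<Rightarrow> bool" where
  "is_norm N \<longleftrightarrow>
     (\<forall>x. 0 \<le> N x) \<and> (\<forall>x. N x = 0 \<longleftrightarrow> x = 0) \<and>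
     (\<forall>c x. N (c *\<^sub>R x) = \<bar>c\<bar> * N x) \<and> (\<forall>x y. N (x + y) \<le> N x + N y)"

definition equivalent_norm :: "('a::real_normed_vector \<Rightarrow> real) \<Rightarrow> bool" where
  "equivalent_norm N \<longleftrightarrow>
     is_norm N \<and> (\<exists>a>0. \<exists>b>0. \<forall>x. a * norm x \<le> N x \<and> N x \<le> b * norm x)"

definition isometry_group :: "('a::real_vector \<Rightarrow> real) \<Rightarrow> ('a \<Rightarrow> 'a) set" where
  "isometry_group N = {T. linear T \<and> surj T \<and> (\<forall>x. N (T x) = N x)}"

end

theory Submission
  imports Defs "HOL-Probability.Conditional_Expectation"
begin

text \<open>
  Why the theorem holds. The unit ball of the new norm is the closed convex hull \<open>K\<close> of a
  \<open>G\<close>-invariant set \<open>S\<close>, so \<open>G\<close> acts by isometries, and the points of \<open>S\<close> are placed so that an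
  isometry has no freedom beyond \<open>G\<close>.

  The Radon-Nikodym property enters once, through the dentability of the orbit. If \<open>x0\<close> were in the
  closed convex hull of the other points of its orbit, then by homogeneity every orbit point would be
  nearly an average of other orbit points, all at a distance bounded below, with one and the same
  number of points in all these averages. Iterating this gives a tree of approximate averages on
  \<open>[0, 1)\<close>, that is, a bounded approximate martingale all of whose increments have norm bounded
  below. Its integrals over each measurable set converge, to a vector measure whose density would
  have to be almost constant on some cell and on a subcell of it, although the martingale jumps
  between them (\<open>RNP_no_separated_averaging_tree\<close>). Hence some functional \<open>f\<close> satisfies \<open>f x0 = 1\<close> and
  \<open>f (g x0) \<le> 1 - \<eta>\<close> for all other \<open>g\<close> in \<open>G\<close> (\<open>RNP_orbit_exposing_functional\<close>).

  Given \<open>f\<close>, the set \<open>S\<close> is the union of the \<open>G\<close>-translates of two small sets. The first is a maximal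
  separated subset \<open>U\<close> of a small ball around \<open>x0\<close>; together with its image under \<open>-Id\<close> it gives \<open>K\<close> an
  interior point. The second is a cluster \<open>Z\<close> close to the point \<open>2 x0\<close>, which lies beyond \<open>U\<close> as
  measured by \<open>f\<close>: it consists of \<open>2 x0\<close> and of points \<open>z n\<close> converging to it on a strictly convex
  surface. Every point of \<open>Z\<close> is strongly exposed in \<open>K\<close>, by \<open>f\<close> or by a tangent of the surface, and a
  strongly exposed point of \<open>K\<close> must belong to the closed set \<open>S\<close>
  (\<open>strongly_exposed_closed_convex_hull\<close>, \<open>strongly_exposed_in_closure\<close>). An isometry preserves strong
  exposedness and changes distances by a bounded factor, so it maps \<open>Z\<close> to points of \<open>S\<close> that are
  much closer to each other than points of \<open>S\<close> ever are outside the translates of \<open>Z\<close>: it maps \<open>Z\<close>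
  into a single translate \<open>g Z\<close> (\<open>isometry_maps_cluster\<close>). Composing with the inverse of \<open>g\<close>, it
  remains to see that an isometry mapping \<open>Z\<close> into itself is the identity. It fixes the only
  accumulation point \<open>2 x0\<close>, and then each \<open>z n\<close>, because the distances from \<open>z n\<close> to \<open>2 x0\<close> are of
  different orders of magnitude for different \<open>n\<close>. The directions of the \<open>z n\<close> are dense in the unit
  sphere of the kernel of \<open>f\<close>, so the fixed points span a dense subspace (\<open>isometry_fixing_cluster\<close>).
  If that kernel is zero, then \<open>G\<close> consists of \<open>Id\<close> and \<open>-Id\<close> and the original norm will do.
\<close>

section \<open>Separation of convex sets by functionals\<close>

definition sublinear :: "('a::real_vector \<Rightarrow> real) \<Rightarrow> bool" where
  "sublinear p \<longleftrightarrow> (\<forall>x y. p (x + y) \<le> p x + p y) \<and> (\<forall>t x. 0 \<le> t \<longrightarrow> p (t *\<^sub>R x) = t * p x)"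

lemma sublinear_add: "sublinear p \<Longrightarrow> p (x + y) \<le> p x + p y"
  and sublinear_scale: "sublinear p \<Longrightarrow> 0 \<le> t \<Longrightarrow> p (t *\<^sub>R x) = t * p x"
  by (auto simp: sublinear_def)

lemma sublinear_zero: "sublinear p \<Longrightarrow> p 0 = 0"
  using sublinear_scale[of p 0 0] by simp

lemma sublinear_neg: "sublinear p \<Longrightarrow> - p (- x) \<le> p x"
  using sublinear_add[of p x "- x"] sublinear_zero[of p] by simp

lemma sublinearI:
  assumes "\<And>x y. p (x + y) \<le> p x + p y" and "\<And>t x. 0 < t \<Longrightarrow> p (t *\<^sub>R x) \<le> t * p x" and "p 0 = 0"
  shows "sublinear p"
  unfolding sublinear_def
proof (intro conjI allI impI)
  show "p (x + y) \<le> p x + p y" for x y by (rule assms)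
  fix t :: real and x assume "0 \<le> t"
  show "p (t *\<^sub>R x) = t * p x"
  proof (cases "t = 0")
    case True then show ?thesis using assms(3) by simp
  next
    case False
    then have t: "0 < t" using \<open>0 \<le> t\<close> by simp
    have "p x = p (inverse t *\<^sub>R (t *\<^sub>R x))" using t by simp
    also have "\<dots> \<le> inverse t * p (t *\<^sub>R x)" using t by (intro assms(2)) simp
    finally have "t * p x \<le> p (t *\<^sub>R x)" using t by (simp add: field_simps)
    then show ?thesis using assms(2)[OF t, of x] by simp
  qed
qed

text \<open>
  The pointwise infimum of a chain of sublinear functions is again subadditive because two members
  of the chain have a common lower bound in it. This provides the lower bounds for Zorn's lemma.
\<close>

lemma sublinear_chain_Inf:
  assumes ne: "C \<noteq> {}" and sub: "\<And>q. q \<in> C \<Longrightarrow> sublinear q"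
    and dir: "\<And>q q'. q \<in> C \<Longrightarrow> q' \<in> C \<Longrightarrow> (\<forall>x. q x \<le> q' x) \<or> (\<forall>x. q' x \<le> q x)"
    and low: "\<And>q x. q \<in> C \<Longrightarrow> l x \<le> q x"
  shows "sublinear (\<lambda>x. INF q\<in>C. q x)"
proof -
  have bdd: "bdd_below ((\<lambda>q. q x) ` C)" for x
    using low by (auto intro!: bdd_belowI2)
  have le: "(INF q\<in>C. q x) \<le> q x" if "q \<in> C" for q x
    using that bdd by (rule cINF_lower[rotated])
  show ?thesis
  proof (rule sublinearI)
    fix x y
    have A: "(INF q\<in>C. q (x + y)) \<le> q x + q' y" if q: "q \<in> C" and q': "q' \<in> C" for q q'
    proof -
      obtain r where r: "r \<in> C" "\<forall>x. r x \<le> q x" "\<forall>x. r x \<le> q' x"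
        using dir[OF q q'] q q' by (metis order_refl)
      have "(INF q\<in>C. q (x + y)) \<le> r (x + y)" using le r(1) by blast
      also have "\<dots> \<le> r x + r y" using sublinear_add sub r(1) by blast
      also have "\<dots> \<le> q x + q' y" using r by (intro add_mono) auto
      finally show ?thesis .
    qed
    have B: "(INF q\<in>C. q (x + y)) - q x \<le> (INF q\<in>C. q y)" if q: "q \<in> C" for q
    proof (rule cINF_greatest[OF ne])
      fix q' assume "q' \<in> C"
      from A[OF q this] show "(INF q\<in>C. q (x + y)) - q x \<le> q' y" by linarith
    qed
    have "(INF q\<in>C. q (x + y)) - (INF q\<in>C. q y) \<le> (INF q\<in>C. q x)"
    proof (rule cINF_greatest[OF ne])
      fix q assume "q \<in> C"
      from B[OF this] show "(INF q\<in>C. q (x + y)) - (INF q\<in>C. q y) \<le> q x" by linarith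
    qed
    then show "(INF q\<in>C. q (x + y)) \<le> (INF q\<in>C. q x) + (INF q\<in>C. q y)" by simp
  next
    fix t :: real and x assume t: "0 < t"
    have "(INF q\<in>C. q (t *\<^sub>R x)) / t \<le> q x" if "q \<in> C" for q
      using le[OF that, of "t *\<^sub>R x"] sublinear_scale[OF sub[OF that], of t x] t
      by (simp add: field_simps)
    then have "(INF q\<in>C. q (t *\<^sub>R x)) / t \<le> (INF q\<in>C. q x)"
      using ne by (intro cINF_greatest) auto
    then show "(INF q\<in>C. q (t *\<^sub>R x)) \<le> t * (INF q\<in>C. q x)" using t by (simp add: field_simps)
  next
    have "(\<lambda>q. q 0) ` C = {0::real}" using ne sub sublinear_zero by (auto simp: image_iff)
    then show "(INF q\<in>C. q 0) = (0::real)" by simp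
  qed
qed

text \<open>
  Lowering \<open>q\<close> in the direction \<open>y\<close> as far as sublinearity permits: \<open>r\<close> is sublinear, below \<open>q\<close>,
  and satisfies \<open>r (- y) \<le> - q y\<close>. A minimal \<open>q\<close> therefore agrees with \<open>r\<close> and is odd.
\<close>

lemma sublinear_shift:
  fixes q :: "'a::real_vector \<Rightarrow> real" and y :: 'a
  assumes q: "sublinear q"
  defines "r \<equiv> \<lambda>x. INF t\<in>{0..}. q (x + t *\<^sub>R y) - t * q y"
  shows "sublinear r" "r x \<le> q x" "r (- y) \<le> - q y"
proof -
  have low: "- q (- x) \<le> q (x + t *\<^sub>R y) - t * q y" if "0 \<le> t" for x t
    using sublinear_add[OF q, of "x + t *\<^sub>R y" "- x"] sublinear_scale[OF q that, of y] by simp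
  have le: "r x \<le> q (x + t *\<^sub>R y) - t * q y" if "0 \<le> t" for x t
    unfolding r_def by (rule cINF_lower) (use that low in \<open>auto intro!: bdd_belowI2\<close>)
  have ge: "c \<le> r x" if "\<And>t. 0 \<le> t \<Longrightarrow> c \<le> q (x + t *\<^sub>R y) - t * q y" for c x
    unfolding r_def by (rule cINF_greatest) (use that in auto)
  show rq: "r x \<le> q x" for x using le[of 0 x] by simp
  show "r (- y) \<le> - q y" using le[of 1 "- y"] sublinear_zero[OF q] by simp
  show "sublinear r"
  proof (rule sublinearI)
    fix x x'
    have A: "r (x + x') \<le> (q (x + t *\<^sub>R y) - t * q y) + (q (x' + s *\<^sub>R y) - s * q y)"
      if "0 \<le> t" "0 \<le> s" for s t
      using le[of "t + s" "x + x'"] that sublinear_add[OF q, of "x + t *\<^sub>R y" "x' + s *\<^sub>R y"]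
      by (simp add: algebra_simps)
    have B: "r (x + x') - (q (x + t *\<^sub>R y) - t * q y) \<le> r x'" if t: "0 \<le> t" for t
    proof (rule ge)
      fix s :: real assume "0 \<le> s"
      from A[OF t this] show "r (x + x') - (q (x + t *\<^sub>R y) - t * q y) \<le> q (x' + s *\<^sub>R y) - s * q y"
        by linarith
    qed
    have "r (x + x') - r x' \<le> r x"
    proof (rule ge)
      fix t :: real assume "0 \<le> t"
      from B[OF this] show "r (x + x') - r x' \<le> q (x + t *\<^sub>R y) - t * q y" by linarith
    qed
    then show "r (x + x') \<le> r x + r x'" by simp
  next
    fix t :: real and x assume t: "0 < t"
    have "r (t *\<^sub>R x) / t \<le> q (x + s *\<^sub>R y) - s * q y" if "0 \<le> s" for s
      using le[of "t * s" "t *\<^sub>R x"] sublinear_scale[OF q, of t "x + s *\<^sub>R y"] t that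
      by (simp add: field_simps scaleR_add_right)
    then have "r (t *\<^sub>R x) / t \<le> r x" by (rule ge)
    then show "r (t *\<^sub>R x) \<le> t * r x" using t by (simp add: field_simps)
  next
    show "r 0 = 0"
      using rq[of 0] ge[of 0 0] sublinear_zero[OF q] sublinear_scale[OF q, of _ y] by force
  qed
qed

text \<open>
  The Hahn-Banach theorem in the form needed here: by Zorn's lemma there is a minimal sublinear
  function below \<open>p\<close>, and minimality makes it odd, hence linear.
\<close>

theorem sublinear_dominates_linear:
  assumes "sublinear p"
  shows "\<exists>f. linear f \<and> (\<forall>x. f x \<le> p x)"
proof -
  define A where "A = {q. sublinear q \<and> (\<forall>x. q x \<le> p x)}"
  define P where "P q q' \<longleftrightarrow> (\<forall>x. q' x \<le> (q x :: real))" for q q' :: "'a \<Rightarrow> real"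
  have low: "- p (- x) \<le> q x" if "q \<in> A" for q x
    using that sublinear_neg[of q x] unfolding A_def
    by (smt (verit, best) mem_Collect_eq)
  have "\<exists>m\<in>A. \<forall>a\<in>A. P m a \<longrightarrow> a = m"
  proof (rule predicate_Zorn)
    show "partial_order_on A (relation_of P A)"
      by (rule partial_order_on_relation_ofI) (auto simp: P_def intro: order_trans antisym intro!: ext)
    fix C assume C: "C \<in> Chains (relation_of P A)"
    then have CA: "C \<subseteq> A" and dir: "\<And>q q'. q \<in> C \<Longrightarrow> q' \<in> C \<Longrightarrow> P q q' \<or> P q' q"
      unfolding Chains_def relation_of_def by auto
    show "\<exists>u\<in>A. \<forall>a\<in>C. P a u"
    proof (cases "C = {}")
      case True
      then show ?thesis using assms by (auto simp: A_def)
    next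
      case False
      define u where "u = (\<lambda>x. INF q\<in>C. q x)"
      have "sublinear u" unfolding u_def
      proof (rule sublinear_chain_Inf[where l = "\<lambda>x. - p (- x)"])
        show "C \<noteq> {}" by fact
        show "sublinear q" if "q \<in> C" for q using that CA by (auto simp: A_def)
        show "(\<forall>x. q x \<le> q' x) \<or> (\<forall>x. q' x \<le> q x)" if "q \<in> C" "q' \<in> C" for q q'
          using dir[OF that] by (auto simp: P_def)
        show "- p (- x) \<le> q x" if "q \<in> C" for q x using that CA low by blast
      qed
      moreover have uq: "u x \<le> q x" if "q \<in> C" for q x
        unfolding u_def by (rule cINF_lower[OF _ that]) (use low CA in \<open>auto intro!: bdd_belowI2[where m = "- p (- x)"]\<close>)
      moreover have "u x \<le> p x" for x
        using False uq CA unfolding A_def by (smt (verit) all_not_in_conv mem_Collect_eq subsetD)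
      ultimately show ?thesis by (auto simp: A_def P_def)
    qed
  qed
  then obtain m where m: "m \<in> A" and min: "\<And>a. a \<in> A \<Longrightarrow> (\<And>x. a x \<le> m x) \<Longrightarrow> a = m"
    unfolding P_def by blast
  have sm: "sublinear m" and mp: "\<And>x. m x \<le> p x" using m by (auto simp: A_def)
  have neg: "m (- y) = - m y" for y
  proof -
    define r where "r = (\<lambda>x. INF t\<in>{0..}. m (x + t *\<^sub>R y) - t * m y)"
    have r: "sublinear r" "\<And>x. r x \<le> m x" "r (- y) \<le> - m y"
      unfolding r_def by (rule sublinear_shift[OF sm])+
    have "r \<in> A" using r(1,2) mp unfolding A_def by (blast intro: order_trans)
    then have "r = m" using r(2) by (intro min)
    then show ?thesis using r(3) sublinear_neg[OF sm, of "- y"] by simp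
  qed
  have add: "m (x + y) = m x + m y" for x y
    using sublinear_add[OF sm, of x y] sublinear_add[OF sm, of "x + y" "- y"] neg[of y] by simp
  have scale: "m (t *\<^sub>R x) = t * m x" for t x
  proof (cases "0 \<le> t")
    case True then show ?thesis using sublinear_scale[OF sm] by blast
  next
    case False
    then have "m ((- t) *\<^sub>R x) = (- t) * m x" by (intro sublinear_scale[OF sm]) simp
    then show ?thesis using neg[of "t *\<^sub>R x"] by simp
  qed
  have "linear m" using add scale by (intro linearI) auto
  then show ?thesis using mp by blast
qed

text \<open>
  The function \<open>p v = inf (norm (v + t a) - t d)\<close>, the infimum being over \<open>t \<ge> 0\<close> and \<open>a \<in> A\<close>, is
  sublinear because \<open>A\<close> is convex, finite because \<open>A\<close> has distance at least \<open>d\<close> from \<open>0\<close>, below the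
  norm (take \<open>t = 0\<close>) and at most \<open>- d\<close> at \<open>- a\<close> (take \<open>t = 1\<close>). Any linear function below it does
  what is required.
\<close>

lemma convex_set_separation:
  fixes A :: "'a::real_normed_vector set"
  assumes cv: "convex A" and ne: "A \<noteq> {}" and d: "0 \<le> d" and far: "\<And>a. a \<in> A \<Longrightarrow> d \<le> norm a"
  shows "\<exists>f. bounded_linear f \<and> (\<forall>v. \<bar>f v\<bar> \<le> norm v) \<and> (\<forall>a\<in>A. d \<le> f a)"
proof -
  define I where "I = {0::real..} \<times> A"
  define p where "p v = (INF (t, a)\<in>I. norm (v + t *\<^sub>R a) - t * d)" for v
  have low: "- norm v \<le> norm (v + t *\<^sub>R a) - t * d" if "0 \<le> t" "a \<in> A" for v t a
  proof -
    have "t * d \<le> norm (t *\<^sub>R a)" using that far[of a] by (simp add: mult_left_mono)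
    also have "\<dots> \<le> norm (v + t *\<^sub>R a) + norm v" using norm_triangle_ineq4[of "v + t *\<^sub>R a" v] by simp
    finally show ?thesis by simp
  qed
  have le: "p v \<le> norm (v + t *\<^sub>R a) - t * d" if "0 \<le> t" "a \<in> A" for v t a
  proof -
    have "p v \<le> (case (t, a) of (t, a) \<Rightarrow> norm (v + t *\<^sub>R a) - t * d)" unfolding p_def
      by (rule cINF_lower) (use that low in \<open>auto simp: I_def intro!: bdd_belowI2[where m = "- norm v"]\<close>)
    then show ?thesis by simp
  qed
  have ge: "c \<le> p v" if "\<And>t a. 0 \<le> t \<Longrightarrow> a \<in> A \<Longrightarrow> c \<le> norm (v + t *\<^sub>R a) - t * d" for c v
    unfolding p_def by (rule cINF_greatest) (use that ne in \<open>auto simp: I_def\<close>)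
  obtain a0 where a0: "a0 \<in> A" using ne by blast
  have pn: "p v \<le> norm v" for v using le[of 0 a0 v] a0 by simp
  have "sublinear p"
  proof (rule sublinearI)
    fix x y
    have A: "p (x + y) \<le> (norm (x + t *\<^sub>R a) - t * d) + (norm (y + s *\<^sub>R b) - s * d)"
      if "0 \<le> t" "a \<in> A" "0 \<le> s" "b \<in> A" for s t a b
    proof -
      have tr: "norm (x + y + (t *\<^sub>R a + s *\<^sub>R b)) \<le> norm (x + t *\<^sub>R a) + norm (y + s *\<^sub>R b)"
        using norm_triangle_ineq[of "x + t *\<^sub>R a" "y + s *\<^sub>R b"] by (simp add: algebra_simps)
      show ?thesis
      proof (cases "t + s = 0")
        case True
        then have "t = 0" "s = 0" using that by auto
        then show ?thesis using pn[of "x + y"] norm_triangle_ineq[of x y] by simp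
      next
        case False
        then have ts: "0 < t + s" using that by simp
        define c where "c = (t / (t + s)) *\<^sub>R a + (s / (t + s)) *\<^sub>R b"
        have "c \<in> A" unfolding c_def using that ts
          by (intro convexD[OF cv]) (auto simp: field_simps add_divide_distrib[symmetric])
        moreover have "(t + s) *\<^sub>R c = t *\<^sub>R a + s *\<^sub>R b"
          unfolding c_def using ts by (simp add: scaleR_add_right)
        ultimately show ?thesis using le[of "t + s" c "x + y"] ts tr by (simp add: algebra_simps)
      qed
    qed
    have B: "p (x + y) - (norm (x + t *\<^sub>R a) - t * d) \<le> p y" if t: "0 \<le> t" "a \<in> A" for t a
    proof (rule ge)
      fix s :: real and b assume "0 \<le> s" "b \<in> A"
      from A[OF t this] show "p (x + y) - (norm (x + t *\<^sub>R a) - t * d) \<le> norm (y + s *\<^sub>R b) - s * d"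
        by linarith
    qed
    have "p (x + y) - p y \<le> p x"
    proof (rule ge)
      fix t :: real and a assume "0 \<le> t" "a \<in> A"
      from B[OF this] show "p (x + y) - p y \<le> norm (x + t *\<^sub>R a) - t * d" by linarith
    qed
    then show "p (x + y) \<le> p x + p y" by simp
  next
    fix t :: real and x assume t: "0 < t"
    have "p (t *\<^sub>R x) / t \<le> norm (x + s *\<^sub>R a) - s * d" if "0 \<le> s" "a \<in> A" for s a
    proof -
      have "norm (t *\<^sub>R x + (t * s) *\<^sub>R a) = t * norm (x + s *\<^sub>R a)"
        using t by (metis abs_of_pos norm_scaleR scaleR_add_right scaleR_scaleR)
      then show ?thesis using le[of "t * s" a "t *\<^sub>R x"] t that by (simp add: field_simps)
    qed
    then have "p (t *\<^sub>R x) / t \<le> p x" by (rule ge)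
    then show "p (t *\<^sub>R x) \<le> t * p x" using t by (simp add: field_simps)
  next
    show "p 0 = 0" using pn[of 0] ge[of 0 0] low[of _ _ 0] by force
  qed
  then obtain f where f: "linear f" "\<And>x. f x \<le> p x" using sublinear_dominates_linear by blast
  have "f v \<le> norm v" for v using f(2) pn by (rule order_trans)
  from this[of "- _"] this have abs: "\<bar>f v\<bar> \<le> norm v" for v
    using linear_neg[OF f(1)] by (metis abs_leI norm_minus_cancel)
  have "bounded_linear f"
    by (rule bounded_linear_intro[where K = 1]) (use abs f(1) in \<open>auto simp: linear_add linear_scale\<close>)
  moreover have "d \<le> f a" if "a \<in> A" for a
    using f(2)[of "- a"] le[of 1 a "- a"] that linear_neg[OF f(1), of a] by simp
  ultimately show ?thesis using abs by blast
qed

lemma point_closed_convex_separation: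
  fixes C :: "'a::real_normed_vector set"
  assumes "convex C" "closed C" "C \<noteq> {}" "x \<notin> C"
  shows "\<exists>f d. bounded_linear f \<and> (\<forall>v. \<bar>f v\<bar> \<le> norm v) \<and> 0 < d \<and> (\<forall>c\<in>C. f c + d \<le> f x)"
proof -
  obtain d where d: "0 < d" "\<And>c. c \<in> C \<Longrightarrow> d \<le> dist x c"
  proof -
    have "open (- C)" "x \<in> - C" using assms(2,4) by auto
    then obtain d where d: "0 < d" "ball x d \<subseteq> - C" using open_contains_ball by blast
    have "d \<le> dist x c" if "c \<in> C" for c using d(2) that by (force simp: subset_iff)
    with d(1) show ?thesis using that by blast
  qed
  have "convex ((\<lambda>c. x - c) ` C)"
    using convex_translation[OF convex_negations[OF assms(1)], of x] by (simp add: image_image)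
  moreover have "d \<le> norm a" if "a \<in> (\<lambda>c. x - c) ` C" for a
    using that d(2) by (auto simp: dist_norm)
  ultimately have "\<exists>f. bounded_linear f \<and> (\<forall>v. \<bar>f v\<bar> \<le> norm v) \<and> (\<forall>a\<in>(\<lambda>c. x - c) ` C. d \<le> f a)"
    using d(1) assms(3) by (intro convex_set_separation) auto
  then obtain f where f: "bounded_linear f" "\<And>v. \<bar>f v\<bar> \<le> norm v" "\<And>c. c \<in> C \<Longrightarrow> d \<le> f (x - c)"
    by blast
  then show ?thesis using d(1) linear_diff[OF bounded_linear.linear[OF f(1)]]
    by (intro exI[of _ f] exI[of _ d]) (auto simp: algebra_simps)
qed

lemma norming_functional:
  fixes x :: "'a::real_normed_vector"
  shows "\<exists>f. bounded_linear f \<and> (\<forall>v. \<bar>f v\<bar> \<le> norm v) \<and> f x = norm x"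
proof -
  obtain f where f: "bounded_linear f" "\<And>v. \<bar>f v\<bar> \<le> norm v" "norm x \<le> f x"
    using convex_set_separation[of "{x}" "norm x"] by auto
  have "f x = norm x" using f(3) f(2)[of x] abs_ge_self[of "f x"] by linarith
  then show ?thesis using f by blast
qed

section \<open>The Minkowski gauge of a symmetric convex body\<close>

definition minkowski_gauge :: "'a::real_vector set \<Rightarrow> 'a \<Rightarrow> real" where
  "minkowski_gauge K x = Inf {t. 0 < t \<and> (1 / t) *\<^sub>R x \<in> K}"

locale symmetric_convex_body =
  fixes K :: "'a::real_normed_vector set" and r R :: real
  assumes convex_K: "convex K" and closed_K: "closed K" and symmetric_K: "\<And>x. x \<in> K \<Longrightarrow> - x \<in> K"
    and r_pos: "0 < r" and inner: "cball 0 r \<subseteq> K" and outer: "K \<subseteq> cball 0 R"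
begin

lemma zero_in_K: "0 \<in> K"
  using inner r_pos by (simp add: subset_iff)

lemma shrink: "x \<in> K \<Longrightarrow> 0 \<le> c \<Longrightarrow> c \<le> 1 \<Longrightarrow> c *\<^sub>R x \<in> K"
  using convexD_alt[OF convex_K zero_in_K, of x c] by simp

lemma gauge_bdd: "bdd_below {t. 0 < t \<and> (1 / t) *\<^sub>R x \<in> K}"
  by (rule bdd_belowI[of _ 0]) auto

lemma gauge_le: "0 < t \<Longrightarrow> (1 / t) *\<^sub>R x \<in> K \<Longrightarrow> minkowski_gauge K x \<le> t"
  unfolding minkowski_gauge_def by (rule cInf_lower[OF _ gauge_bdd]) simp

lemma R_nonneg: "0 \<le> R"
proof -
  have "(0::'a) \<in> cball 0 R" using outer zero_in_K by blast
  then show ?thesis by simp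
qed

lemma gauge_ne: assumes "0 < e" shows "norm x / r + e \<in> {t. 0 < t \<and> (1 / t) *\<^sub>R x \<in> K}"
proof -
  have t: "0 < norm x / r + e" using assms r_pos by (simp add: add_nonneg_pos)
  have "norm x \<le> r * (norm x / r + e)" using assms r_pos by (simp add: distrib_left)
  then have "norm ((1 / (norm x / r + e)) *\<^sub>R x) \<le> r" using t by (simp add: pos_divide_le_eq)
  then have "(1 / (norm x / r + e)) *\<^sub>R x \<in> cball 0 r" by simp
  then show ?thesis using t inner by blast
qed

lemma gauge_le_norm: "minkowski_gauge K x \<le> norm x / r"
proof (rule field_le_epsilon)
  fix e :: real assume e: "0 < e"
  show "minkowski_gauge K x \<le> norm x / r + e" using gauge_ne[OF e, of x] gauge_le by blast
qed

lemma gauge_less_imp: assumes "minkowski_gauge K x < t" shows "0 < t" "(1 / t) *\<^sub>R x \<in> K"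
proof -
  have "{t. 0 < t \<and> (1 / t) *\<^sub>R x \<in> K} \<noteq> {}"
    using gauge_ne[of 1 x] by (metis empty_iff zero_less_one)
  from cInf_lessD[OF this assms[unfolded minkowski_gauge_def]]
  obtain s where s: "s < t" "0 < s" "(1 / s) *\<^sub>R x \<in> K" by auto
  then show "0 < t" by simp
  have "s / t * (1 / s) = 1 / t" using s by simp
  then show "(1 / t) *\<^sub>R x \<in> K" using shrink[OF s(3), of "s / t"] s(1,2) by (metis scaleR_scaleR
      divide_le_eq_1_pos divide_nonneg_pos less_imp_le less_trans)
qed

lemma gauge_nonneg: "0 \<le> minkowski_gauge K x"
  using gauge_less_imp(1)[of x 0] by (meson less_irrefl not_le)

lemma norm_le_gauge: "norm x \<le> R * minkowski_gauge K x"
proof -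
  have *: "norm x \<le> R * t" if "minkowski_gauge K x < t" for t
  proof -
    note T = gauge_less_imp[OF that]
    then have "(1 / t) *\<^sub>R x \<in> cball 0 R" using outer by blast
    then show ?thesis using T(1) by (simp add: pos_divide_le_eq)
  qed
  have "norm x \<le> R * minkowski_gauge K x + e" if "0 < e" for e
  proof -
    have "norm x \<le> R * (minkowski_gauge K x + e / (R + 1))"
      using that R_nonneg by (intro *) (simp add: add_nonneg_pos)
    also have "\<dots> \<le> R * minkowski_gauge K x + e"
      using that R_nonneg by (simp add: field_simps)
    finally show ?thesis .
  qed
  then show ?thesis by (rule field_le_epsilon)
qed

lemma gauge_zero: "minkowski_gauge K 0 = 0"
  using gauge_le_norm[of 0] gauge_nonneg[of 0] by simp

lemma gauge_scale_le: assumes "0 < c" shows "minkowski_gauge K (c *\<^sub>R x) \<le> c * minkowski_gauge K x"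
proof -
  have "minkowski_gauge K (c *\<^sub>R x) / c \<le> minkowski_gauge K x"
  proof (rule dense_ge)
    fix t assume t: "minkowski_gauge K x < t"
    have "(1 / (c * t)) *\<^sub>R c *\<^sub>R x \<in> K" using gauge_less_imp[OF t] assms by simp
    then have "minkowski_gauge K (c *\<^sub>R x) \<le> c * t" using gauge_less_imp(1)[OF t] assms by (intro gauge_le) simp_all
    then show "minkowski_gauge K (c *\<^sub>R x) / c \<le> t" using assms by (simp add: field_simps)
  qed
  then show ?thesis using assms by (simp add: field_simps)
qed

lemma gauge_uminus: "minkowski_gauge K (- x) = minkowski_gauge K x"
proof -
  have "(1 / t) *\<^sub>R (- x) \<in> K \<longleftrightarrow> (1 / t) *\<^sub>R x \<in> K" for t
    using symmetric_K[of "(1 / t) *\<^sub>R x"] symmetric_K[of "(1 / t) *\<^sub>R (- x)"] by auto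
  then show ?thesis by (simp add: minkowski_gauge_def)
qed

lemma gauge_scale: "minkowski_gauge K (c *\<^sub>R x) = \<bar>c\<bar> * minkowski_gauge K x"
proof -
  have pos: "minkowski_gauge K (c *\<^sub>R x) = c * minkowski_gauge K x" if c: "0 < c" for c
    using gauge_scale_le[OF c, of x] gauge_scale_le[of "1 / c" "c *\<^sub>R x"] c by (simp add: field_simps)
  consider "c = 0" | "0 < c" | "c < 0" by linarith
  then show ?thesis
  proof cases
    case 3
    then have "minkowski_gauge K ((- c) *\<^sub>R x) = (- c) * minkowski_gauge K x" by (intro pos) simp
    then show ?thesis using 3 gauge_uminus[of "c *\<^sub>R x"] by simp
  qed (use pos gauge_zero in auto)
qed

lemma gauge_triangle: "minkowski_gauge K (x + y) \<le> minkowski_gauge K x + minkowski_gauge K y"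
proof -
  \<comment> \<open>\<open>(x + y) / (t + s)\<close> is a convex combination of \<open>x / t\<close> and \<open>y / s\<close>.\<close>
  have *: "minkowski_gauge K (x + y) \<le> t + s" if t: "minkowski_gauge K x < t" and s: "minkowski_gauge K y < s" for t s
  proof -
    note T = gauge_less_imp[OF t] and S = gauge_less_imp[OF s]
    have "(t / (t + s)) *\<^sub>R (1 / t) *\<^sub>R x + (s / (t + s)) *\<^sub>R (1 / s) *\<^sub>R y \<in> K"
      using T S by (intro convexD[OF convex_K]) (auto simp: add_divide_distrib[symmetric])
    then have "(1 / (t + s)) *\<^sub>R (x + y) \<in> K" using T S by (simp add: scaleR_add_right)
    then show ?thesis using T S by (intro gauge_le) simp_all
  qed
  have **: "minkowski_gauge K (x + y) - t \<le> minkowski_gauge K y" if "minkowski_gauge K x < t" for t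
  proof (rule dense_ge)
    fix s assume "minkowski_gauge K y < s"
    from *[OF that this] show "minkowski_gauge K (x + y) - t \<le> s" by linarith
  qed
  have "minkowski_gauge K (x + y) - minkowski_gauge K y \<le> minkowski_gauge K x"
  proof (rule dense_ge)
    fix t assume "minkowski_gauge K x < t"
    from **[OF this] show "minkowski_gauge K (x + y) - minkowski_gauge K y \<le> t" by linarith
  qed
  then show ?thesis by simp
qed

lemma gauge_le_one_iff: "minkowski_gauge K x \<le> 1 \<longleftrightarrow> x \<in> K"
proof
  assume "x \<in> K" then show "minkowski_gauge K x \<le> 1" using gauge_le[of 1 x] by simp
next
  assume le: "minkowski_gauge K x \<le> 1"
  have "(1 / (1 + inverse (Suc n))) *\<^sub>R x \<in> K" for n :: nat
  proof -
    have "0 < inverse (real (Suc n))" by simp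
    with le have "minkowski_gauge K x < 1 + inverse (Suc n)" by linarith
    from gauge_less_imp(2)[OF this] show ?thesis .
  qed
  moreover have "(\<lambda>n. (1 / (1 + inverse (real (Suc n)))) *\<^sub>R x) \<longlonglongrightarrow> (1 / (1 + 0)) *\<^sub>R x"
    by (intro tendsto_intros LIMSEQ_inverse_real_of_nat) auto
  ultimately show "x \<in> K" using closed_sequentially[OF closed_K] by force
qed

lemma equivalent_norm_gauge: "equivalent_norm (minkowski_gauge K)"
proof -
  have zero: "minkowski_gauge K x = 0 \<longleftrightarrow> x = 0" for x
    using norm_le_gauge[of x] gauge_zero by auto
  have "inverse (R + 1) * norm x \<le> minkowski_gauge K x" for x
    using norm_le_gauge[of x] R_nonneg gauge_nonneg[of x] by (simp add: field_simps)
  moreover have "minkowski_gauge K x \<le> inverse r * norm x" for x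
    using gauge_le_norm[of x] by (simp add: field_simps)
  moreover have "0 < inverse (R + 1)" "0 < inverse r" using R_nonneg r_pos by auto
  ultimately show ?thesis unfolding equivalent_norm_def is_norm_def
    by (intro conjI allI gauge_nonneg zero gauge_scale gauge_triangle exI[of _ "inverse (R + 1)"]
        exI[of _ "inverse r"])
qed

lemma gauge_invariant:
  assumes "linear g" "g ` K \<subseteq> K" "linear h" "h ` K \<subseteq> K" "\<And>x. h (g x) = x"
  shows "minkowski_gauge K (g x) = minkowski_gauge K x"
proof -
  have "(1 / t) *\<^sub>R g x \<in> K \<longleftrightarrow> (1 / t) *\<^sub>R x \<in> K" for t
  proof -
    have "g ((1 / t) *\<^sub>R x) = (1 / t) *\<^sub>R g x" "h ((1 / t) *\<^sub>R g x) = (1 / t) *\<^sub>R x"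
      using assms(5) by (simp_all add: linear_scale[OF assms(1)] linear_scale[OF assms(3)])
    then show ?thesis using assms(2,4) by (metis image_subset_iff)
  qed
  then show ?thesis by (simp add: minkowski_gauge_def)
qed

end

section \<open>Strongly exposed points\<close>

definition strongly_exposed :: "'a::real_normed_vector set \<Rightarrow> ('a \<Rightarrow> real) \<Rightarrow> 'a \<Rightarrow> bool" where
  "strongly_exposed S f p \<longleftrightarrow> p \<in> S \<and> (\<forall>e>0. \<exists>a>0. \<forall>s\<in>S. f p - a < f s \<longrightarrow> norm (s - p) < e)"

text \<open>
  The definition does not mention that \<open>f\<close> is maximal at \<open>p\<close>: a point with a larger value would lie
  in every slice, hence coincide with \<open>p\<close>.
\<close>

lemma strongly_exposed_max:
  assumes "strongly_exposed S f p" "s \<in> S"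
  shows "f s \<le> f p"
proof (rule ccontr)
  assume less: "\<not> f s \<le> f p"
  have "norm (s - p) < e" if e: "0 < e" for e
  proof -
    obtain a where "0 < a" "\<forall>s\<in>S. f p - a < f s \<longrightarrow> norm (s - p) < e"
      using assms(1) e unfolding strongly_exposed_def by blast
    then show ?thesis using less assms(2) by force
  qed
  from this[of "norm (s - p)"] show False using less by auto
qed

lemma convex_norm_plus_linear:
  fixes f :: "'a::real_normed_vector \<Rightarrow> real"
  assumes f: "linear f"
  shows "convex {y. norm (y - p) + c * f y \<le> d}"
proof (rule convexI)
  fix x y and u v :: real
  assume xy: "x \<in> {y. norm (y - p) + c * f y \<le> d}" "y \<in> {y. norm (y - p) + c * f y \<le> d}"
    and uv: "0 \<le> u" "0 \<le> v" "u + v = 1"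
  have "u *\<^sub>R x + v *\<^sub>R y - p = u *\<^sub>R (x - p) + v *\<^sub>R (y - p)"
    using uv(3) by (simp add: algebra_simps) (metis scaleR_add_left scaleR_one)
  then have "norm (u *\<^sub>R x + v *\<^sub>R y - p) \<le> u * norm (x - p) + v * norm (y - p)"
    using norm_triangle_ineq[of "u *\<^sub>R (x - p)" "v *\<^sub>R (y - p)"] uv by simp
  moreover have "f (u *\<^sub>R x + v *\<^sub>R y) = u * f x + v * f y"
    using f by (simp add: linear_add linear_scale)
  moreover have "u * (norm (x - p) + c * f x) + v * (norm (y - p) + c * f y) \<le> u * d + v * d"
    using xy uv by (intro add_mono mult_left_mono) auto
  moreover have "u * d + v * d = d" using uv(3) by (metis distrib_right mult_1)
  ultimately show "u *\<^sub>R x + v *\<^sub>R y \<in> {y. norm (y - p) + c * f y \<le> d}"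
    by (simp add: algebra_simps)
qed

lemma subset_closed_convex_hull: "S \<subseteq> closure (convex hull S)"
  by (rule order_trans[OF hull_subset closure_subset])

text \<open>
  Exposedness can be tested on a generating set. The idea is to find a closed convex set that
  contains \<open>S\<close> and on which the distance to \<open>p\<close> is controlled by the deficit \<open>f p - f y\<close>. A
  sublevel set of the convex function \<open>norm (y - p) + c * f y\<close> has this property once \<open>c\<close> is large.
\<close>

lemma strongly_exposed_closed_convex_hull:
  assumes f: "bounded_linear f" and bdd: "S \<subseteq> cball 0 R" and ex: "strongly_exposed S f p"
  shows "strongly_exposed (closure (convex hull S)) f p"
  unfolding strongly_exposed_def
proof (intro conjI allI impI)
  have pS: "p \<in> S" using ex by (simp add: strongly_exposed_def)
  then show "p \<in> closure (convex hull S)" using subset_closed_convex_hull by blast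
  fix e :: real assume e: "0 < e"
  obtain a where a: "0 < a" "\<And>s. s \<in> S \<Longrightarrow> f p - a < f s \<Longrightarrow> norm (s - p) < e / 2"
    using ex e unfolding strongly_exposed_def by (meson half_gt_zero)
  \<comment> \<open>A deficit of at least \<open>a\<close> then outweighs every distance in \<open>S\<close>, as \<open>c * a\<close> exceeds the diameter.\<close>
  define c where "c = (2 * \<bar>R\<bar> + 1) / a"
  have c: "0 < c" using a by (simp add: c_def add_nonneg_pos)
  define H where "H = {y. norm (y - p) + c * f y \<le> e / 2 + c * f p}"
  have "closed H" unfolding H_def
    by (intro closed_Collect_le continuous_intros bounded_linear.continuous_on[OF f])
  moreover have "convex H" unfolding H_def
    by (rule convex_norm_plus_linear[OF bounded_linear.linear[OF f]])
  moreover have "S \<subseteq> H"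
  proof
    fix s assume s: "s \<in> S"
    have sp: "f s \<le> f p" using strongly_exposed_max[OF ex s] .
    show "s \<in> H"
    proof (cases "f p - a < f s")
      case True
      have "c * f s \<le> c * f p" using sp c by simp
      then show ?thesis using a(2)[OF s True] by (simp add: H_def)
    next
      case False
      have "norm s \<le> R" "norm p \<le> R" using s pS bdd by auto
      then have "norm (s - p) \<le> 2 * \<bar>R\<bar> + 1" using norm_triangle_ineq4[of s p] by linarith
      also have "\<dots> = c * a" using a by (simp add: c_def)
      also have "\<dots> \<le> c * (f p - f s)" using False c by (intro mult_left_mono) auto
      finally show ?thesis using e by (simp add: H_def algebra_simps)
    qed
  qed
  ultimately have sub: "closure (convex hull S) \<subseteq> H"
    by (intro closure_minimal hull_minimal)
  show "\<exists>a>0. \<forall>s\<in>closure (convex hull S). f p - a < f s \<longrightarrow> norm (s - p) < e"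
  proof (intro exI[of _ "e / (2 * c)"] conjI ballI impI)
    show "0 < e / (2 * c)" using e c by simp
    fix y assume y: "y \<in> closure (convex hull S)" and fy: "f p - e / (2 * c) < f y"
    have "norm (y - p) \<le> e / 2 + c * (f p - f y)"
      using y sub by (auto simp: H_def algebra_simps)
    also have "c * (f p - f y) < c * (e / (2 * c))" using fy c by (intro mult_strict_left_mono) auto
    also have "c * (e / (2 * c)) = e / 2" using c by simp
    finally show "norm (y - p) < e" by simp
  qed
qed

text \<open>
  If \<open>S\<close> missed a ball around \<open>p\<close>, then \<open>S\<close>, and with it its closed convex hull, would be contained
  in a closed half-space that does not contain \<open>p\<close>.
\<close>

lemma strongly_exposed_in_closure:
  assumes f: "bounded_linear f" and ex: "strongly_exposed (closure (convex hull S)) f p"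
  shows "p \<in> closure S"
  unfolding closure_approachable
proof (intro allI impI, rule ccontr)
  fix e :: real assume e: "0 < e" and no: "\<not> (\<exists>y\<in>S. dist y p < e)"
  obtain a where a: "0 < a" "\<And>s. s \<in> closure (convex hull S) \<Longrightarrow> f p - a < f s \<Longrightarrow> norm (s - p) < e"
    using ex e unfolding strongly_exposed_def by blast
  have "S \<subseteq> {y. f y \<le> f p - a}"
  proof
    fix s assume s: "s \<in> S"
    then have "s \<in> closure (convex hull S)" using subset_closed_convex_hull by blast
    with a(2)[of s] no s show "s \<in> {y. f y \<le> f p - a}" by (force simp: dist_norm)
  qed
  moreover have "closed {y. f y \<le> f p - a}"
    by (intro closed_Collect_le continuous_intros bounded_linear.continuous_on[OF f])
  moreover have "convex {y. f y \<le> f p - a}"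
    using bounded_linear.linear[OF f]
    by (intro convexI) (simp add: linear_add linear_scale convex_bound_le)
  ultimately have "closure (convex hull S) \<subseteq> {y. f y \<le> f p - a}"
    by (intro closure_minimal hull_minimal)
  moreover have "p \<in> closure (convex hull S)" using ex by (simp add: strongly_exposed_def)
  ultimately show False using a(1) by auto
qed

lemma strongly_exposed_image:
  assumes ex: "strongly_exposed K f p" and TK: "T ` K \<subseteq> K" and UK: "U ` K \<subseteq> K"
    and inv: "\<And>x. U (T x) = x" "\<And>x. T (U x) = x" and T: "bounded_linear T"
  shows "strongly_exposed K (\<lambda>x. f (U x)) (T p)"
  unfolding strongly_exposed_def
proof (intro conjI allI impI)
  show "T p \<in> K" using ex TK by (auto simp: strongly_exposed_def)
  fix e :: real assume e: "0 < e"
  obtain B where B: "0 < B" "\<And>x. norm (T x) \<le> norm x * B" using bounded_linear.pos_bounded[OF T] by blast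
  have "0 < e / B" using e B by simp
  then obtain a where a: "0 < a" "\<And>s. s \<in> K \<Longrightarrow> f p - a < f s \<Longrightarrow> norm (s - p) < e / B"
    using ex unfolding strongly_exposed_def by meson
  show "\<exists>a>0. \<forall>s\<in>K. f (U (T p)) - a < f (U s) \<longrightarrow> norm (s - T p) < e"
  proof (intro exI[of _ a] conjI ballI impI)
    fix s assume s: "s \<in> K" "f (U (T p)) - a < f (U s)"
    have "norm (U s - p) < e / B" using s UK by (intro a(2)) (auto simp: inv)
    moreover have "norm (T (U s - p)) \<le> norm (U s - p) * B" by (rule B)
    moreover have "T (U s - p) = s - T p"
      using linear_diff[OF bounded_linear.linear[OF T], of "U s" p] inv by simp
    ultimately show "norm (s - T p) < e" using B(1) by (simp add: pos_less_divide_eq)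
  qed (rule a)
qed

text \<open>
  On a compact part of \<open>S\<close> a strict maximum of \<open>f\<close> is automatically a strong one; on the rest of
  \<open>S\<close> the values are required to stay below the maximum by a fixed amount.
\<close>

lemma strongly_exposed_compact_part:
  fixes f :: "'a::real_normed_vector \<Rightarrow> real"
  assumes Z: "compact Z" "Z \<subseteq> S" "p \<in> Z" and f: "continuous_on UNIV f"
    and peak: "\<And>z. z \<in> Z \<Longrightarrow> z \<noteq> p \<Longrightarrow> f z < f p"
    and b: "0 < b" "\<And>s. s \<in> S \<Longrightarrow> s \<notin> Z \<Longrightarrow> f s \<le> f p - b"
  shows "strongly_exposed S f p"
  unfolding strongly_exposed_def
proof (intro conjI allI impI)
  show "p \<in> S" using Z by blast
  fix e :: real assume e: "0 < e"
  have comp: "compact (Z - ball p e)" using Z(1) by (intro compact_diff) auto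
  have "\<exists>a>0. \<forall>z\<in>Z - ball p e. f z \<le> f p - a"
  proof (cases "Z - ball p e = {}")
    case True then show ?thesis by (metis empty_iff zero_less_one)
  next
    case False
    obtain m where m: "m \<in> Z - ball p e" "\<And>z. z \<in> Z - ball p e \<Longrightarrow> f z \<le> f m"
      using continuous_attains_sup[OF comp False continuous_on_subset[OF f]] by auto
    then have "f m < f p" using e by (intro peak) auto
    then show ?thesis using m by (intro exI[of _ "f p - f m"]) auto
  qed
  then obtain a where a: "0 < a" "\<And>z. z \<in> Z \<Longrightarrow> z \<notin> ball p e \<Longrightarrow> f z \<le> f p - a" by auto
  show "\<exists>a>0. \<forall>s\<in>S. f p - a < f s \<longrightarrow> norm (s - p) < e"
  proof (intro exI[of _ "min a b"] conjI ballI impI)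
    show "0 < min a b" using a b by simp
    fix s assume s: "s \<in> S" "f p - min a b < f s"
    show "norm (s - p) < e"
    proof (rule ccontr)
      assume "\<not> norm (s - p) < e"
      then have "s \<notin> ball p e" by (simp add: dist_norm norm_minus_commute)
      then show False using s a(2)[of s] b(2)[of s] by (cases "s \<in> Z") auto
    qed
  qed
qed

context symmetric_convex_body
begin

text \<open>
  Isometries of the gauge are bi-Lipschitz for the original norm, with the ratio of the radii as
  constant. All that is used below about their size is contained in these two estimates.
\<close>

lemma isometry_bound:
  assumes "T \<in> isometry_group (minkowski_gauge K)"
  shows "norm (T x) \<le> R / r * norm x" "norm x \<le> R / r * norm (T x)"
proof -
  have N: "minkowski_gauge K (T x) = minkowski_gauge K x" using assms by (simp add: isometry_group_def)
  have *: "norm y \<le> R / r * norm z" if "minkowski_gauge K y = minkowski_gauge K z" for y z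
  proof -
    have "norm y \<le> R * minkowski_gauge K z" using norm_le_gauge[of y] that by simp
    also have "\<dots> \<le> R * (norm z / r)" using R_nonneg by (intro mult_left_mono gauge_le_norm)
    finally show ?thesis by simp
  qed
  show "norm (T x) \<le> R / r * norm x" "norm x \<le> R / r * norm (T x)"
    using *[OF N] *[OF N[symmetric]] .
qed

lemma isometry_bounded_linear:
  assumes T: "T \<in> isometry_group (minkowski_gauge K)"
  shows "bounded_linear T"
proof -
  have l: "linear T" using T by (simp add: isometry_group_def)
  show ?thesis
    using isometry_bound(1)[OF T] l
    by (intro bounded_linear_intro[where K = "R / r"]) (auto simp: linear_add linear_scale mult.commute)
qed

lemma isometry_inj:
  assumes T: "T \<in> isometry_group (minkowski_gauge K)"
  shows "inj T"
proof -
  have l: "linear T" using T by (simp add: isometry_group_def)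
  have "x = 0" if "T x = 0" for x using isometry_bound(2)[OF T, of x] that by simp
  then show ?thesis using l by (simp add: linear_injective_0)
qed

lemma isometry_maps_body:
  assumes T: "T \<in> isometry_group (minkowski_gauge K)"
  shows "T ` K \<subseteq> K"
  using T by (auto simp: isometry_group_def gauge_le_one_iff[symmetric])

lemma isometry_inv:
  assumes T: "T \<in> isometry_group (minkowski_gauge K)"
  shows "inv T \<in> isometry_group (minkowski_gauge K)" "inv T (T x) = x" "T (inv T x) = x"
proof -
  have l: "linear T" "surj T" "\<And>x. minkowski_gauge K (T x) = minkowski_gauge K x"
    using T by (auto simp: isometry_group_def)
  note i = isometry_inj[OF T]
  have 1: "inv T (T x) = x" and 2: "T (inv T x) = x" for x
    using i l(2) by (simp_all add: surj_f_inv_f)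
  then show "inv T (T x) = x" "T (inv T x) = x" by auto
  have "linear (inv T)"
  proof (rule linearI)
    fix x y and c :: real
    have "T (inv T (x + y)) = T (inv T x + inv T y)" by (simp add: 2 linear_add[OF l(1)])
    then show "inv T (x + y) = inv T x + inv T y" by (rule injD[OF i])
    have "T (inv T (c *\<^sub>R x)) = T (c *\<^sub>R inv T x)" by (simp add: 2 linear_scale[OF l(1)])
    then show "inv T (c *\<^sub>R x) = c *\<^sub>R inv T x" by (rule injD[OF i])
  qed
  moreover have "surj (inv T)" using 1 by (metis surjI)
  moreover have "minkowski_gauge K (inv T x) = minkowski_gauge K x" for x using l(3)[of "inv T x"] 2 by simp
  ultimately show "inv T \<in> isometry_group (minkowski_gauge K)" by (simp add: isometry_group_def)
qed

lemma isometry_strongly_exposed: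
  assumes T: "T \<in> isometry_group (minkowski_gauge K)" and f: "bounded_linear f" and p: "strongly_exposed K f p"
  shows "\<exists>f'. bounded_linear f' \<and> strongly_exposed K f' (T p)"
proof -
  have "strongly_exposed K (\<lambda>x. f (inv T x)) (T p)"
    by (rule strongly_exposed_image[OF p isometry_maps_body[OF T] isometry_maps_body[OF isometry_inv(1)[OF T]]
          isometry_inv(2,3)[OF T] isometry_bounded_linear[OF T]])
  moreover have "bounded_linear (\<lambda>x. f (inv T x))"
    by (rule bounded_linear_compose[OF f isometry_bounded_linear[OF isometry_inv(1)[OF T]]])
  ultimately show ?thesis by blast
qed

end

section \<open>Averages in closed convex hulls\<close>

lemma sum_list_concat_replicate:
  fixes xs :: "'a::real_vector list"
  shows "sum_list (concat (replicate a xs)) = real a *\<^sub>R sum_list xs"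
  by (induction a) (auto simp: algebra_simps)

lemma length_concat_replicate: "length (concat (replicate a xs)) = a * length xs"
  by (induction a) auto

text \<open>
  Convex combinations with arbitrary weights are approximated by plain averages, in which points may
  be repeated. The set \<open>Q\<close> of points that are limits of averages contains \<open>B\<close>; it is convex because
  two averages can be mixed with any rational weights by concatenating copies of their lists.
\<close>

lemma closed_convex_hull_approx_average:
  fixes B :: "'a::real_normed_vector set"
  assumes x: "x \<in> closure (convex hull B)" and e: "0 < e"
  shows "\<exists>k>0. \<exists>b. (\<forall>i<k. b i \<in> B) \<and> norm (x - (1 / real k) *\<^sub>R (\<Sum>i<k. b i)) < e"
proof -
  define avg where "avg xs = (1 / real (length xs)) *\<^sub>R sum_list xs" for xs :: "'a list"
  define Q where "Q = {x. \<forall>e>0. \<exists>xs. xs \<noteq> [] \<and> set xs \<subseteq> B \<and> norm (x - avg xs) < e}"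
  have QD: "\<exists>xs. xs \<noteq> [] \<and> set xs \<subseteq> B \<and> norm (x - avg xs) < e" if "x \<in> Q" "0 < e" for x e
    using that unfolding Q_def by blast
  have "convex Q"
  proof (rule convexI)
    fix x y and u v :: real
    assume x: "x \<in> Q" and y: "y \<in> Q" and uv: "0 \<le> u" "0 \<le> v" "u + v = 1"
    show "u *\<^sub>R x + v *\<^sub>R y \<in> Q" unfolding Q_def
    proof (intro CollectI allI impI)
      fix e :: real assume e: "0 < e"
      then have e2: "0 < e / 2" by simp
      obtain xs where xs: "xs \<noteq> []" "set xs \<subseteq> B" "norm (x - avg xs) < e / 2"
        using QD[OF x e2] by blast
      obtain ys where ys: "ys \<noteq> []" "set ys \<subseteq> B" "norm (y - avg ys) < e / 2"
        using QD[OF y e2] by blast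
      define D where "D = norm (avg xs - avg ys)"
      obtain N where N: "2 * (D + 1) / e < real N" using reals_Archimedean2 by blast
      have "0 < 2 * (D + 1) / e" using e by (simp add: D_def add_nonneg_pos)
      then have N0: "0 < real N" using N by linarith
      define p where "p = nat \<lfloor>u * real N\<rfloor>"
      have p1: "real p \<le> u * real N" and p2: "u * real N < real p + 1"
        using uv N0 unfolding p_def by (simp_all add: of_nat_nat)
      have "u * real N \<le> real N" using uv N0 by (simp add: mult_left_le_one_le)
      then have pN: "p \<le> N" using p1 by linarith
      have "u - p / N = (u * N - p) / N" using N0 by (simp add: field_simps)
      moreover have "\<bar>u * N - p\<bar> \<le> 1" using p1 p2 by linarith
      ultimately have "\<bar>u - p / N\<bar> \<le> 1 / N" using N0 by (simp add: divide_right_mono)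
      then have "\<bar>u - p / N\<bar> * D \<le> 1 / N * D" by (intro mult_right_mono) (simp_all add: D_def)
      also have "\<dots> < e / 2" using N N0 e by (simp add: field_simps)
      finally have close: "\<bar>u - p / N\<bar> * D < e / 2" .
      \<comment> \<open>The multiplicities compensate for the lengths, so that the two averages get weights \<open>p\<close> and \<open>N - p\<close>.\<close>
      define zs where "zs = concat (replicate (p * length ys) xs) @ concat (replicate ((N - p) * length xs) ys)"
      have len: "length zs = N * (length xs * length ys)"
      proof -
        have "length zs = p * (length xs * length ys) + (N - p) * (length xs * length ys)"
          by (simp add: zs_def length_concat_replicate mult_ac)
        also have "\<dots> = N * (length xs * length ys)" using pN by (metis distrib_right le_add_diff_inverse)
        finally show ?thesis .
      qed
      have xy: "0 < real (length xs)" "0 < real (length ys)" using xs(1) ys(1) by simp_all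
      let ?k = "real (length xs)" and ?l = "real (length ys)"
      have "avg zs = (1 / (N * (?k * ?l)) * (p * ?l)) *\<^sub>R sum_list xs
          + (1 / (N * (?k * ?l)) * ((real N - p) * ?k)) *\<^sub>R sum_list ys"
        unfolding avg_def len using pN
        by (simp add: zs_def sum_list_concat_replicate scaleR_add_right of_nat_diff)
      moreover have "1 / (N * (?k * ?l)) * (p * ?l) = p / N * (1 / ?k)"
        "1 / (N * (?k * ?l)) * ((real N - p) * ?k) = (1 - p / N) * (1 / ?l)"
        using xy N0 by (simp_all add: field_simps)
      ultimately have az: "avg zs = (p / N) *\<^sub>R avg xs + (1 - p / N) *\<^sub>R avg ys"
        by (simp only: avg_def scaleR_scaleR)
      have v: "v = 1 - u" using uv by simp
      have "u *\<^sub>R x + v *\<^sub>R y - avg zs = u *\<^sub>R (x - avg xs) + v *\<^sub>R (y - avg ys) + (u - p / N) *\<^sub>R (avg xs - avg ys)"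
        unfolding az v by (simp add: algebra_simps)
      also have "norm \<dots> \<le> u * norm (x - avg xs) + v * norm (y - avg ys) + \<bar>u - p / N\<bar> * D"
        unfolding D_def using uv
        by (intro order_trans[OF norm_triangle_ineq] add_mono order_trans[OF norm_triangle_ineq]) simp_all
      also have "\<dots> < u * (e / 2) + v * (e / 2) + e / 2"
        using xs(3) ys(3) uv close by (intro add_le_less_mono add_mono mult_left_mono) simp_all
      also have "\<dots> = (u + v) * (e / 2) + e / 2" by (simp only: distrib_right)
      also have "\<dots> = e" unfolding uv(3) by simp
      finally have "norm (u *\<^sub>R x + v *\<^sub>R y - avg zs) < e" .
      moreover have "zs \<noteq> []" using len xy N0 by auto
      moreover have "set zs \<subseteq> B" using xs(2) ys(2) by (auto simp: zs_def)
      ultimately show "\<exists>xs. xs \<noteq> [] \<and> set xs \<subseteq> B \<and> norm (u *\<^sub>R x + v *\<^sub>R y - avg xs) < e" by blast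
    qed
  qed
  moreover have "B \<subseteq> Q"
  proof
    fix x assume "x \<in> B"
    then have "[x] \<noteq> [] \<and> set [x] \<subseteq> B \<and> norm (x - avg [x]) < e" if "0 < e" for e
      using that by (simp add: avg_def)
    then show "x \<in> Q" unfolding Q_def by blast
  qed
  ultimately have sub: "convex hull B \<subseteq> Q" by (intro hull_minimal)
  obtain y where y: "y \<in> convex hull B" "dist y x < e / 2"
    using x e unfolding closure_approachable by (meson half_gt_zero)
  obtain xs where xs: "xs \<noteq> []" "set xs \<subseteq> B" "norm (y - avg xs) < e / 2"
    using QD[OF subsetD[OF sub y(1)], of "e / 2"] e by auto
  have "norm (x - avg xs) < e"
    using y(2) xs(3) norm_triangle_ineq[of "x - y" "y - avg xs"] by (simp add: dist_norm norm_minus_commute)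
  moreover have "avg xs = (1 / real (length xs)) *\<^sub>R (\<Sum>i<length xs. xs ! i)"
    unfolding avg_def by (simp add: sum_list_sum_nth atLeast0LessThan)
  moreover have "\<forall>i<length xs. xs ! i \<in> B" using xs(2) by (auto simp: subset_iff)
  ultimately show ?thesis using xs(1)
    by (intro exI[of _ "length xs"] conjI exI[of _ "(!) xs"]) auto
qed

section \<open>Trees of approximate averages and the Radon-Nikodym property\<close>

text \<open>
  A bounded set \<open>A\<close> in which each point is, up to \<open>(1/2)^n\<close>, the average of \<open>k n\<close> points of \<open>A\<close>.
  Since \<open>k n\<close> does not depend on the point, the \<open>n\<close>-th level of the resulting tree can be indexed by
  the \<open>q n = k 0 * ... * k (n - 1)\<close> subintervals of \<open>[0, 1)\<close> of equal length, and the children of the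
  interval with index \<open>j\<close> are those with indices \<open>j * k n + i\<close> for \<open>i < k n\<close>. The step function with
  the value \<open>v n j\<close> on the \<open>j\<close>-th interval is the \<open>n\<close>-th term of an approximate martingale.
\<close>

locale averaging_tree =
  fixes A :: "'a::{banach, second_countable_topology} set" and R :: real
    and k :: "nat \<Rightarrow> nat" and b :: "nat \<Rightarrow> 'a \<Rightarrow> nat \<Rightarrow> 'a" and root :: 'a
  assumes A_bound: "a \<in> A \<Longrightarrow> norm a \<le> R" and root_A: "root \<in> A"
    and k_pos: "0 < k n"
    and child_A: "a \<in> A \<Longrightarrow> i < k n \<Longrightarrow> b n a i \<in> A"
    and child_avg: "a \<in> A \<Longrightarrow> norm (a - (1 / real (k n)) *\<^sub>R (\<Sum>i<k n. b n a i)) \<le> (1 / 2) ^ n"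
begin

primrec q :: "nat \<Rightarrow> nat" where
  "q 0 = 1"
| "q (Suc n) = q n * k n"

primrec v :: "nat \<Rightarrow> nat \<Rightarrow> 'a" where
  "v 0 j = root"
| "v (Suc n) j = b n (v n (j div k n)) (j mod k n)"

definition index :: "nat \<Rightarrow> real \<Rightarrow> nat" where
  "index n x = nat \<lfloor>x * real (q n)\<rfloor>"

text \<open>
  Describing sets of level \<open>n\<close> by sets of indices makes Boolean operations on them, and the passage
  to a finer level, operations on index sets. The sigma-algebra of \<open>M\<close> is the one that these sets
  generate.
\<close>

definition level_set :: "nat \<Rightarrow> nat set \<Rightarrow> real set" where
  "level_set n J = {x \<in> {0..<1}. index n x \<in> J}"

definition level_sets :: "real set set" where
  "level_sets = {level_set n J | n J. True}"

definition M :: "real measure" where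
  "M = restr_to_subalg (restrict_space lborel {0..<1}) (sigma {0..<1} level_sets)"

lemma q_pos: "0 < q n"
  by (induction n) (use k_pos in auto)

lemma R_nonneg: "0 \<le> R"
  using A_bound[OF root_A] norm_ge_zero[of root] by linarith

lemma v_A: "v n j \<in> A"
  by (induction n arbitrary: j) (use root_A child_A k_pos in auto)

lemma index_less: "x \<in> {0..<1} \<Longrightarrow> index n x < q n"
  unfolding index_def using q_pos[of n] by (simp add: nat_less_iff floor_less_iff)

lemma index_Suc: "x \<in> {0..<1} \<Longrightarrow> index (Suc n) x div k n = index n x"
proof -
  assume x: "x \<in> {0..<1}"
  have "x * real (q n) = x * real (q (Suc n)) / real_of_int (int (k n))" using k_pos[of n] by simp
  then have "\<lfloor>x * real (q n)\<rfloor> = \<lfloor>x * real (q (Suc n))\<rfloor> div int (k n)"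
    by (metis floor_divide_real_eq_div of_nat_0_le_iff)
  then show ?thesis using x by (simp add: index_def nat_div_distrib)
qed

lemma level_set_Suc: "level_set n J = level_set (Suc n) {m. m div k n \<in> J}"
  unfolding level_set_def using index_Suc by auto

lemma level_set_upcast: "n \<le> m \<Longrightarrow> \<exists>J'. level_set n J = level_set m J'"
proof (induction m rule: dec_induct)
  case (step m) then show ?case using level_set_Suc by metis
qed auto

lemma level_set_Un: "level_set n J \<union> level_set n J' = level_set n (J \<union> J')"
  and level_set_Compl: "{0..<1} - level_set n J = level_set n (- J)"
  and level_set_empty: "level_set n {} = {}"
  by (auto simp: level_set_def)

lemma cell_eq: "j < q n \<Longrightarrow> level_set n {j} = {real j / q n ..< real (Suc j) / q n}"
proof -
  assume j: "j < q n"
  have q: "0 < real (q n)" using q_pos by simp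
  have "x \<in> level_set n {j} \<longleftrightarrow> x \<in> {real j / q n ..< real (Suc j) / q n}" for x
  proof
    assume "x \<in> level_set n {j}"
    then have x: "0 \<le> x" "nat \<lfloor>x * real (q n)\<rfloor> = j" by (auto simp: level_set_def index_def)
    have "0 \<le> \<lfloor>x * real (q n)\<rfloor>" using x(1) by simp
    then have "\<lfloor>x * real (q n)\<rfloor> = int j" using x(2) by linarith
    then show "x \<in> {real j / q n ..< real (Suc j) / q n}" using q
      by (simp add: floor_eq_iff field_simps)
  next
    assume x: "x \<in> {real j / q n ..< real (Suc j) / q n}"
    then have "\<lfloor>x * real (q n)\<rfloor> = int j" using q by (simp add: floor_eq_iff field_simps)
    moreover have "0 \<le> real j / q n" by simp
    then have "0 \<le> x" using x by (meson atLeastLessThan_iff order_trans)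
    moreover have "real (Suc j) / q n \<le> 1" using j q by simp
    then have "x < 1" using x by (meson atLeastLessThan_iff less_le_trans)
    ultimately show "x \<in> level_set n {j}" by (simp add: level_set_def index_def)
  qed
  then show ?thesis by blast
qed

lemma level_set_cells: "level_set n J = (\<Union>j\<in>J \<inter> {..<q n}. level_set n {j})"
  unfolding level_set_def using index_less by auto

lemma level_set_borel: "level_set n J \<in> sets borel"
proof -
  have "(\<Union>j\<in>J \<inter> {..<q n}. level_set n {j}) \<in> sets borel"
    by (intro sets.finite_UN) (auto simp: cell_eq)
  then show ?thesis by (simp add: level_set_cells[of n J])
qed

lemma subalgebra_levels: "subalgebra (restrict_space lborel {0..<1}) (sigma {0..<1} level_sets)"
proof -
  have *: "level_sets \<subseteq> sets (restrict_space lborel {0..<1::real})"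
  proof
    fix E assume "E \<in> level_sets"
    then obtain n J where E: "E = level_set n J" by (auto simp: level_sets_def)
    have "level_set n J \<subseteq> {0..<1}" by (auto simp: level_set_def)
    then show "E \<in> sets (restrict_space lborel {0..<1::real})"
      using level_set_borel[of n J] by (simp add: E sets_restrict_space_iff)
  qed
  have "level_sets \<subseteq> Pow {0..<1}" by (auto simp: level_sets_def level_set_def)
  then have "sets (sigma {0..<1} level_sets) = sigma_sets {0..<1} level_sets"
    by (rule sets_measure_of)
  also have "\<dots> \<subseteq> sets (restrict_space lborel {0..<1::real})"
    using sets.sigma_sets_subset[OF *] by (simp add: space_restrict_space)
  finally show ?thesis
    unfolding subalgebra_def by (simp add: space_restrict_space space_measure_of_conv)
qed

lemma space_M: "space M = {0..<1}"
  by (simp add: M_def space_restr_to_subalg space_restrict_space)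

lemma sets_M: "sets M = sigma_sets {0..<1} level_sets"
proof -
  have "level_sets \<subseteq> Pow {0..<1}" by (auto simp: level_sets_def level_set_def)
  then show ?thesis
    unfolding M_def by (simp add: sets_restr_to_subalg[OF subalgebra_levels] sets_measure_of)
qed

lemma level_set_sets: "level_set n J \<in> sets M"
  unfolding sets_M level_sets_def by blast

lemma emeasure_M: "E \<in> sets M \<Longrightarrow> emeasure M E = emeasure lborel E"
proof -
  assume E: "E \<in> sets M"
  then have E': "E \<in> sets (sigma {0..<1} level_sets)"
    unfolding M_def sets_restr_to_subalg[OF subalgebra_levels] .
  have "E \<subseteq> {0..<1}" using sets.sets_into_space[OF E] by (simp add: space_M)
  then show ?thesis
    unfolding M_def by (simp add: emeasure_restr_to_subalg[OF subalgebra_levels E'] emeasure_restrict_space)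
qed

sublocale M: finite_measure M
proof
  have "space M \<in> sets M" by simp
  from emeasure_M[OF this] show "emeasure M (space M) \<noteq> \<infinity>" by (simp add: space_M)
qed

abbreviation \<mu> where "\<mu> \<equiv> measure M"

abbreviation cell where "cell n j \<equiv> level_set n {j}"

lemma measure_cell: "j < q n \<Longrightarrow> \<mu> (cell n j) = 1 / q n"
proof -
  assume j: "j < q n"
  have le: "real j / q n \<le> real (Suc j) / q n" by (intro divide_right_mono) auto
  have "\<mu> (cell n j) = measure lborel (cell n j)"
    by (simp add: measure_def emeasure_M[OF level_set_sets])
  also have "\<dots> = real (Suc j) / q n - real j / q n" using le by (simp add: cell_eq[OF j])
  also have "\<dots> = 1 / q n" by (simp add: diff_divide_distrib[symmetric])
  finally show ?thesis .
qed

lemma measure_sum_cells: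
  assumes E: "E \<in> sets M"
  shows "\<mu> E = (\<Sum>j<q n. \<mu> (E \<inter> cell n j))"
proof -
  have sub: "E \<subseteq> {0..<1}" using sets.sets_into_space[OF E] by (simp add: space_M)
  have "E = (\<Union>j\<in>{..<q n}. E \<inter> cell n j)"
    using sub index_less by (auto simp: level_set_def)
  then have "\<mu> E = \<mu> (\<Union>j\<in>{..<q n}. E \<inter> cell n j)" by simp
  also have "\<dots> = (\<Sum>j<q n. \<mu> (E \<inter> cell n j))"
  proof (rule M.finite_measure_finite_Union)
    show "(\<lambda>j. E \<inter> cell n j) ` {..<q n} \<subseteq> sets M" using E level_set_sets by blast
    show "disjoint_family_on (\<lambda>j. E \<inter> cell n j) {..<q n}"
      by (auto simp: disjoint_family_on_def level_set_def)
  qed simp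
  finally show ?thesis .
qed

lemma level_set_Int_cell: "level_set n J \<inter> cell n j = (if j \<in> J then cell n j else {})"
  by (auto simp: level_set_def)

lemma measure_level_set: "\<mu> (level_set n J) = (\<Sum>j<q n. of_bool (j \<in> J) / q n)"
proof -
  have "\<mu> (level_set n J) = (\<Sum>j<q n. \<mu> (level_set n J \<inter> cell n j))"
    by (rule measure_sum_cells[OF level_set_sets])
  also have "\<dots> = (\<Sum>j<q n. of_bool (j \<in> J) / q n)"
    by (rule sum.cong) (simp_all add: level_set_Int_cell measure_cell)
  finally show ?thesis .
qed

text \<open>
  The integral of the \<open>n\<close>-th step function over \<open>E\<close>.
\<close>

definition \<Phi> :: "nat \<Rightarrow> real set \<Rightarrow> 'a" where
  "\<Phi> n E = (\<Sum>j<q n. \<mu> (E \<inter> cell n j) *\<^sub>R v n j)"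

lemma \<Phi>_level_set: "\<Phi> n (level_set n J) = (\<Sum>j<q n. (of_bool (j \<in> J) / q n) *\<^sub>R v n j)"
  unfolding \<Phi>_def by (auto simp: level_set_Int_cell measure_cell intro!: sum.cong)

lemma \<Phi>_Suc_level_set:
  "\<Phi> (Suc n) (level_set n J) =
     (\<Sum>j<q n. (of_bool (j \<in> J) / q n) *\<^sub>R (1 / k n) *\<^sub>R (\<Sum>i<k n. b n (v n j) i))"
proof -
  define f where "f m = (of_bool (m div k n \<in> J) / (q n * k n)) *\<^sub>R b n (v n (m div k n)) (m mod k n)" for m
  have "\<Phi> (Suc n) (level_set n J) = (\<Sum>m<q n * k n. f m)"
    unfolding level_set_Suc[of n J] \<Phi>_level_set by (simp add: f_def)
  also have "\<dots> = (\<Sum>j<q n. \<Sum>m\<in>{j * k n..<j * k n + k n}. f m)"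
    by (simp add: sum.nat_group)
  also have "\<dots> = (\<Sum>j<q n. \<Sum>i<k n. f (j * k n + i))"
  proof (rule sum.cong)
    fix j
    show "(\<Sum>m\<in>{j * k n..<j * k n + k n}. f m) = (\<Sum>i<k n. f (j * k n + i))"
      by (rule sum.reindex_bij_witness[of _ "\<lambda>i. j * k n + i" "\<lambda>m. m - j * k n"]) auto
  qed simp
  also have "\<dots> = (\<Sum>j<q n. (of_bool (j \<in> J) / q n) *\<^sub>R (1 / k n) *\<^sub>R (\<Sum>i<k n. b n (v n j) i))"
  proof (rule sum.cong)
    fix j
    show "(\<Sum>i<k n. f (j * k n + i)) = (of_bool (j \<in> J) / q n) *\<^sub>R (1 / k n) *\<^sub>R (\<Sum>i<k n. b n (v n j) i)"
      unfolding scaleR_scaleR scaleR_sum_right by (rule sum.cong) (simp_all add: f_def)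
  qed simp
  finally show ?thesis .
qed

text \<open>
  For sets \<open>E\<close> of level \<open>n\<close> the passage to the next step function replaces each value by an average
  within \<open>(1/2)^n\<close> of it.
\<close>

lemma \<Phi>_step: "norm (\<Phi> (Suc n) (level_set n J) - \<Phi> n (level_set n J)) \<le> (1 / 2) ^ n * \<mu> (level_set n J)"
proof -
  have eq: "\<Phi> (Suc n) (level_set n J) - \<Phi> n (level_set n J) =
    (\<Sum>j<q n. (of_bool (j \<in> J) / q n) *\<^sub>R ((1 / k n) *\<^sub>R (\<Sum>i<k n. b n (v n j) i) - v n j))"
    unfolding \<Phi>_Suc_level_set \<Phi>_level_set by (simp add: sum_subtractf[symmetric] scaleR_diff_right)
  have "norm (\<Phi> (Suc n) (level_set n J) - \<Phi> n (level_set n J)) \<le> (\<Sum>j<q n. of_bool (j \<in> J) / q n * (1 / 2) ^ n)"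
    unfolding eq
  proof (intro sum_norm_le)
    fix j
    have "norm ((1 / k n) *\<^sub>R (\<Sum>i<k n. b n (v n j) i) - v n j) \<le> (1 / 2) ^ n"
      using child_avg[OF v_A] by (simp add: norm_minus_commute)
    then show "norm ((of_bool (j \<in> J) / q n) *\<^sub>R ((1 / k n) *\<^sub>R (\<Sum>i<k n. b n (v n j) i) - v n j))
        \<le> of_bool (j \<in> J) / q n * (1 / 2) ^ n"
      by (simp add: divide_right_mono)
  qed
  also have "\<dots> = \<mu> (level_set n J) * (1 / 2) ^ n"
    unfolding measure_level_set by (rule sum_distrib_right[symmetric])
  also have "\<dots> = (1 / 2) ^ n * \<mu> (level_set n J)" by (rule mult.commute)
  finally show ?thesis .
qed

lemma \<Phi>_tail:
  assumes "n \<le> m"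
  shows "norm (\<Phi> m (level_set n J) - \<Phi> n (level_set n J)) \<le> (2 * (1 / 2) ^ n - 2 * (1 / 2) ^ m) * \<mu> (level_set n J)"
  using assms
proof (induction m rule: dec_induct)
  case (step m)
  obtain J' where J': "level_set n J = level_set m J'" using level_set_upcast step by blast
  have "norm (\<Phi> (Suc m) (level_set n J) - \<Phi> n (level_set n J)) \<le>
      norm (\<Phi> (Suc m) (level_set n J) - \<Phi> m (level_set n J)) + norm (\<Phi> m (level_set n J) - \<Phi> n (level_set n J))"
    using norm_triangle_ineq[of "\<Phi> (Suc m) (level_set n J) - \<Phi> m (level_set n J)"
        "\<Phi> m (level_set n J) - \<Phi> n (level_set n J)"] by simp
  also have "\<dots> \<le> (1 / 2) ^ m * \<mu> (level_set n J) + (2 * (1 / 2) ^ n - 2 * (1 / 2) ^ m) * \<mu> (level_set n J)"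
    using \<Phi>_step[of m J'] step.IH by (simp add: J')
  also have "\<dots> = (2 * (1 / 2) ^ n - 2 * (1 / 2) ^ Suc m) * \<mu> (level_set n J)"
    by (simp add: algebra_simps)
  finally show ?case .
qed simp

lemma measure_diff_le:
  assumes "E \<in> sets M" "E' \<in> sets M"
  shows "\<bar>\<mu> E - \<mu> E'\<bar> \<le> \<mu> (sym_diff E E')"
proof -
  have *: "\<mu> E \<le> \<mu> E' + \<mu> (sym_diff E E')" if "E \<in> sets M" "E' \<in> sets M" for E E'
  proof -
    have "\<mu> E \<le> \<mu> (E' \<union> sym_diff E E')" using that by (intro M.finite_measure_mono) auto
    also have "\<dots> \<le> \<mu> E' + \<mu> (sym_diff E E')" using that by (intro measure_Un_le) auto
    finally show ?thesis .
  qed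
  have "sym_diff E' E = sym_diff E E'" by blast
  then show ?thesis using *[OF assms] *[OF assms(2,1)] by simp
qed

lemma \<Phi>_diff:
  assumes E: "E \<in> sets M" "E' \<in> sets M"
  shows "norm (\<Phi> n E - \<Phi> n E') \<le> R * \<mu> (sym_diff E E')"
proof -
  have eq: "\<Phi> n E - \<Phi> n E' = (\<Sum>j<q n. (\<mu> (E \<inter> cell n j) - \<mu> (E' \<inter> cell n j)) *\<^sub>R v n j)"
    by (simp add: \<Phi>_def sum_subtractf[symmetric] scaleR_diff_left)
  have "norm (\<Phi> n E - \<Phi> n E') \<le> (\<Sum>j<q n. \<mu> (sym_diff E E' \<inter> cell n j) * R)"
    unfolding eq
  proof (intro sum_norm_le)
    fix j
    have "\<bar>\<mu> (E \<inter> cell n j) - \<mu> (E' \<inter> cell n j)\<bar> \<le> \<mu> (sym_diff (E \<inter> cell n j) (E' \<inter> cell n j))"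
      using E level_set_sets by (intro measure_diff_le) auto
    also have "sym_diff (E \<inter> cell n j) (E' \<inter> cell n j) = sym_diff E E' \<inter> cell n j" by blast
    finally show "norm ((\<mu> (E \<inter> cell n j) - \<mu> (E' \<inter> cell n j)) *\<^sub>R v n j) \<le> \<mu> (sym_diff E E' \<inter> cell n j) * R"
      using A_bound[OF v_A] by (simp add: mult_mono)
  qed
  also have "\<dots> = (\<Sum>j<q n. \<mu> (sym_diff E E' \<inter> cell n j)) * R"
    by (rule sum_distrib_right[symmetric])
  also have "\<dots> = \<mu> (sym_diff E E') * R"
    using measure_sum_cells[of "sym_diff E E'" n] E by simp
  also have "\<dots> = R * \<mu> (sym_diff E E')" by (rule mult.commute)
  finally show ?thesis .
qed

text \<open>
  The sets that can be approximated in measure by sets of finite level form a sigma-algebra, so every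
  measurable set is approximable.
\<close>

definition approximable :: "real set \<Rightarrow> bool" where
  "approximable E \<longleftrightarrow> E \<in> sets M \<and> (\<forall>e>0. \<exists>n J. \<mu> (sym_diff E (level_set n J)) < e)"

lemma approximable_Un:
  assumes "approximable E" "approximable E'"
  shows "approximable (E \<union> E')"
  unfolding approximable_def
proof (intro conjI allI impI)
  have EE: "E \<in> sets M" "E' \<in> sets M" using assms by (auto simp: approximable_def)
  then show "E \<union> E' \<in> sets M" by blast
  fix e :: real assume e: "0 < e"
  obtain n J where J: "\<mu> (sym_diff E (level_set n J)) < e / 2"
    using assms(1) e unfolding approximable_def by (meson half_gt_zero)
  obtain n' J' where J': "\<mu> (sym_diff E' (level_set n' J')) < e / 2"
    using assms(2) e unfolding approximable_def by (meson half_gt_zero)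
  obtain K where K: "level_set n J = level_set (max n n') K" using level_set_upcast max.cobounded1 by blast
  obtain K' where K': "level_set n' J' = level_set (max n n') K'" using level_set_upcast max.cobounded2 by blast
  have "\<mu> (sym_diff (E \<union> E') (level_set (max n n') (K \<union> K')))
      \<le> \<mu> (sym_diff E (level_set n J) \<union> sym_diff E' (level_set n' J'))"
    using EE level_set_sets unfolding K K' level_set_Un[symmetric]
    by (intro M.finite_measure_mono) auto
  also have "\<dots> \<le> \<mu> (sym_diff E (level_set n J)) + \<mu> (sym_diff E' (level_set n' J'))"
    using EE level_set_sets by (intro measure_Un_le) auto
  also have "\<dots> < e" using J J' by simp
  finally show "\<exists>n J. \<mu> (sym_diff (E \<union> E') (level_set n J)) < e" by blast
qed

lemma measure_UN_tail:
  assumes E: "range E \<subseteq> sets M"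
  shows "(\<lambda>N. \<mu> ((\<Union>i. E i) - (\<Union>i<N. E i))) \<longlonglongrightarrow> 0"
proof -
  have Ei: "E i \<in> sets M" for i using E by blast
  have "(\<lambda>N. \<mu> (\<Union>i<N. E i)) \<longlonglongrightarrow> \<mu> (\<Union>N. \<Union>i<N. E i)"
    by (rule M.finite_Lim_measure_incseq) (use Ei in \<open>force simp: incseq_def\<close>)+
  moreover have "(\<Union>N. \<Union>i<N. E i) = (\<Union>i. E i)" by blast
  ultimately have "(\<lambda>N. \<mu> (\<Union>i. E i) - \<mu> (\<Union>i<N. E i)) \<longlonglongrightarrow> \<mu> (\<Union>i. E i) - \<mu> (\<Union>i. E i)"
    by (intro tendsto_intros) simp
  moreover have "\<mu> ((\<Union>i. E i) - (\<Union>i<N. E i)) = \<mu> (\<Union>i. E i) - \<mu> (\<Union>i<N. E i)" for N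
    using Ei by (intro M.finite_measure_Diff) auto
  ultimately show ?thesis by simp
qed

lemma approximable:
  assumes "E \<in> sets M"
  shows "approximable E"
  using assms unfolding sets_M
proof (induction rule: sigma_sets.induct)
  case (Basic E)
  then obtain n J where "E = level_set n J" by (auto simp: level_sets_def)
  then show ?case using level_set_sets unfolding approximable_def by (metis Diff_cancel Un_empty_left measure_empty)
next
  case Empty
  have "\<mu> (sym_diff {} (level_set 0 {})) = 0" by (simp add: level_set_empty)
  then show ?case unfolding approximable_def by (metis sets.empty_sets)
next
  case (Compl E)
  have sub: "E \<subseteq> {0..<1}" using sets.sets_into_space[of E M] Compl by (simp add: space_M approximable_def)
  have "sym_diff ({0..<1} - E) (level_set n (- J)) = sym_diff E (level_set n J)" for n J
    unfolding level_set_Compl[symmetric] using sub by (auto simp: level_set_def)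
  then show ?case using Compl.IH unfolding approximable_def by (metis sets.compl_sets space_M)
next
  case (Union E)
  then have Ei: "E i \<in> sets M" for i by (auto simp: approximable_def)
  have fin: "approximable (\<Union>i<N. E i)" for N
  proof (induction N)
    case 0
    have "\<mu> (sym_diff {} (level_set 0 {})) = 0" by (simp add: level_set_empty)
    then show ?case unfolding approximable_def by (simp, metis)
  next
    case (Suc N)
    have "(\<Union>i<Suc N. E i) = (\<Union>i<N. E i) \<union> E N" by (auto simp: less_Suc_eq)
    then show ?case using approximable_Un[OF Suc Union.IH[of N]] by simp
  qed
  show ?case unfolding approximable_def
  proof (intro conjI allI impI)
    show UE: "(\<Union>i. E i) \<in> sets M" using Ei by blast
    fix e :: real assume e: "0 < e"
    have "\<forall>\<^sub>F N in sequentially. \<mu> ((\<Union>i. E i) - (\<Union>i<N. E i)) < e / 2"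
      using measure_UN_tail[of E] Ei e by (intro order_tendstoD(2)[where y = 0]) auto
    then obtain N where N: "\<mu> ((\<Union>i. E i) - (\<Union>i<N. E i)) < e / 2"
      by (meson eventually_sequentially order_refl)
    obtain n J where J: "\<mu> (sym_diff (\<Union>i<N. E i) (level_set n J)) < e / 2"
      using fin[of N] e unfolding approximable_def by (meson half_gt_zero)
    have "\<mu> (sym_diff (\<Union>i. E i) (level_set n J))
        \<le> \<mu> (((\<Union>i. E i) - (\<Union>i<N. E i)) \<union> sym_diff (\<Union>i<N. E i) (level_set n J))"
      using Ei level_set_sets by (intro M.finite_measure_mono) auto
    also have "\<dots> \<le> \<mu> ((\<Union>i. E i) - (\<Union>i<N. E i)) + \<mu> (sym_diff (\<Union>i<N. E i) (level_set n J))"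
      using Ei level_set_sets by (intro measure_Un_le) auto
    also have "\<dots> < e" using N J by simp
    finally show "\<exists>n J. \<mu> (sym_diff (\<Union>i. E i) (level_set n J)) < e" by blast
  qed
qed

text \<open>
  On sets of finite level the integrals form a Cauchy sequence with geometric rate; the general case
  follows since \<open>\<Phi> n\<close> is Lipschitz in measure with constant \<open>R\<close>, uniformly in \<open>n\<close>.
\<close>

lemma \<Phi>_convergent:
  assumes E: "E \<in> sets M"
  shows "convergent (\<lambda>n. \<Phi> n E)"
proof (rule Cauchy_convergent, rule CauchyI')
  fix e :: real assume e: "0 < e"
  have "0 < e / (4 * (R + 1))" using e R_nonneg by simp
  then obtain n J where J: "\<mu> (sym_diff E (level_set n J)) < e / (4 * (R + 1))"
    using approximable[OF E] unfolding approximable_def by meson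
  define L where "L = level_set n J"
  have "R * \<mu> (sym_diff E L) \<le> (R + 1) * \<mu> (sym_diff E L)" by (simp add: mult_right_mono)
  also have "\<dots> < e / 4" using J R_nonneg by (simp add: L_def field_simps)
  finally have near: "norm (\<Phi> m E - \<Phi> m L) < e / 4" for m
    using \<Phi>_diff[of E L m] E level_set_sets by (simp add: L_def)
  have "(\<lambda>m. (1 / 2) ^ m * (2 * \<mu> L)) \<longlonglongrightarrow> 0 * (2 * \<mu> L)"
    by (intro tendsto_intros LIMSEQ_power_zero) simp
  then have "\<forall>\<^sub>F m in sequentially. (1 / 2) ^ m * (2 * \<mu> L) < e / 4"
    using e by (intro order_tendstoD(2)[where y = 0]) auto
  then obtain m0 where "\<And>m. m0 \<le> m \<Longrightarrow> (1 / 2) ^ m * (2 * \<mu> L) < e / 4"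
    by (auto simp: eventually_sequentially)
  then have m0: "2 * (1 / 2) ^ m * \<mu> L < e / 4" if "m0 \<le> m" for m
    using that by (simp add: mult_ac)
  show "\<exists>N. \<forall>m\<ge>N. \<forall>n>m. dist (\<Phi> m E) (\<Phi> n E) < e"
  proof (intro exI[of _ "max n m0"] allI impI)
    fix m m' assume m: "max n m0 \<le> m" "m < m'"
    obtain J' where L': "L = level_set m J'" using level_set_upcast m unfolding L_def by (metis max.bounded_iff)
    have "norm (\<Phi> m' L - \<Phi> m L) \<le> (2 * (1 / 2) ^ m - 2 * (1 / 2) ^ m') * \<mu> L"
      using \<Phi>_tail[of m m' J'] m by (simp add: L')
    also have "\<dots> \<le> 2 * (1 / 2) ^ m * \<mu> L" by (intro mult_right_mono) auto
    also have "\<dots> < e / 4" using m m0 by simp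
    finally have fin: "norm (\<Phi> m' L - \<Phi> m L) < e / 4" .
    have eq: "\<Phi> m E - \<Phi> m' E = (\<Phi> m E - \<Phi> m L) - (\<Phi> m' L - \<Phi> m L) - (\<Phi> m' E - \<Phi> m' L)"
      by simp
    show "dist (\<Phi> m E) (\<Phi> m' E) < e"
      using e fin near[of m] near[of m'] norm_triangle_ineq4[of "(\<Phi> m E - \<Phi> m L) - (\<Phi> m' L - \<Phi> m L)" "\<Phi> m' E - \<Phi> m' L"]
        norm_triangle_ineq4[of "\<Phi> m E - \<Phi> m L" "\<Phi> m' L - \<Phi> m L"] unfolding dist_norm eq by linarith
  qed
qed

text \<open>
  The vector measure that the tree defines. The estimate \<open>norm (F E) \<le> R * \<mu> E\<close> in \<open>F_bound\<close> yields
  countable additivity, bounded variation and absolute continuity.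
\<close>

definition F :: "real set \<Rightarrow> 'a" where
  "F E = lim (\<lambda>n. \<Phi> n E)"

lemma \<Phi>_tendsto: "E \<in> sets M \<Longrightarrow> (\<lambda>n. \<Phi> n E) \<longlonglongrightarrow> F E"
  unfolding F_def by (rule convergent_LIMSEQ_iff[THEN iffD1, OF \<Phi>_convergent])

lemma F_bound: assumes E: "E \<in> sets M" shows "norm (F E) \<le> R * \<mu> E"
proof -
  have "norm (\<Phi> n E) \<le> R * \<mu> E" for n
    using \<Phi>_diff[OF E, of "{}" n] by (simp add: \<Phi>_def)
  then show ?thesis using \<Phi>_tendsto[OF E] by (intro Lim_norm_ubound[of sequentially]) auto
qed

lemma F_Un:
  assumes E: "E \<in> sets M" "E' \<in> sets M" "E \<inter> E' = {}"
  shows "F (E \<union> E') = F E + F E'"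
proof -
  have "\<Phi> n (E \<union> E') = \<Phi> n E + \<Phi> n E'" for n
  proof -
    have "\<mu> ((E \<union> E') \<inter> cell n j) = \<mu> (E \<inter> cell n j) + \<mu> (E' \<inter> cell n j)" for j
      unfolding Int_Un_distrib2 using E level_set_sets
      by (intro M.finite_measure_Union) auto
    then show ?thesis by (simp add: \<Phi>_def scaleR_add_left sum.distrib)
  qed
  moreover have "(\<lambda>n. \<Phi> n E + \<Phi> n E') \<longlonglongrightarrow> F E + F E'"
    using E by (intro tendsto_add \<Phi>_tendsto)
  ultimately show ?thesis using \<Phi>_tendsto[of "E \<union> E'"] E
    by (simp add: LIMSEQ_unique)
qed

lemma F_empty: "F {} = 0"
  using F_bound[of "{}"] by simp

lemma F_vector_measure: "vector_measure M F"
  unfolding vector_measure_def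
proof (intro allI impI)
  fix E :: "nat \<Rightarrow> real set" assume E: "range E \<subseteq> sets M" and disj: "disjoint_family E"
  have Ei: "E i \<in> sets M" for i using E by blast
  have partial: "(\<Sum>i<N. F (E i)) = F (\<Union>i<N. E i)" for N
  proof (induction N)
    case (Suc N)
    have "(\<Union>i<N. E i) \<inter> E N = {}"
    proof -
      have "E i \<inter> E N = {}" if "i < N" for i
        using that by (intro disjoint_family_onD[OF disj]) auto
      then show ?thesis by blast
    qed
    then have "F ((\<Union>i<N. E i) \<union> E N) = F (\<Union>i<N. E i) + F (E N)"
      using Ei by (intro F_Un) auto
    moreover have "(\<Union>i<Suc N. E i) = (\<Union>i<N. E i) \<union> E N" by (auto simp: less_Suc_eq)
    ultimately show ?case using Suc by simp
  qed (simp add: F_empty)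
  have diff: "F (\<Union>i. E i) - F (\<Union>i<N. E i) = F ((\<Union>i. E i) - (\<Union>i<N. E i))" for N
  proof -
    have "(\<Union>i<N. E i) \<union> ((\<Union>i. E i) - (\<Union>i<N. E i)) = (\<Union>i. E i)" by blast
    moreover have "F ((\<Union>i<N. E i) \<union> ((\<Union>i. E i) - (\<Union>i<N. E i)))
        = F (\<Union>i<N. E i) + F ((\<Union>i. E i) - (\<Union>i<N. E i))"
      using Ei by (intro F_Un) auto
    ultimately show ?thesis by simp
  qed
  have "(\<lambda>N. F (\<Union>i. E i) - F (\<Union>i<N. E i)) \<longlonglongrightarrow> 0"
  proof (rule Lim_null_comparison)
    show "\<forall>\<^sub>F N in sequentially. norm (F (\<Union>i. E i) - F (\<Union>i<N. E i)) \<le> R * \<mu> ((\<Union>i. E i) - (\<Union>i<N. E i))"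
      unfolding diff using Ei by (intro always_eventually allI F_bound) auto
    show "(\<lambda>N. R * \<mu> ((\<Union>i. E i) - (\<Union>i<N. E i))) \<longlonglongrightarrow> 0"
      using tendsto_mult_left[OF measure_UN_tail[OF E], of R] by simp
  qed
  then have "(\<lambda>N. F (\<Union>i. E i) - (F (\<Union>i. E i) - F (\<Union>i<N. E i))) \<longlonglongrightarrow> F (\<Union>i. E i) - 0"
    by (intro tendsto_diff tendsto_const)
  then show "(\<lambda>i. F (E i)) sums F (\<Union>i. E i)" unfolding sums_def partial by simp
qed

lemma F_bounded_variation: "has_bounded_variation_on_sets M F"
  unfolding has_bounded_variation_on_sets_def
proof (rule bdd_aboveI)
  fix s assume "s \<in> {\<Sum>E\<in>P. norm (F E) | P. finite P \<and> P \<subseteq> sets M \<and> partition_on (space M) P}"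
  then obtain P where s: "s = (\<Sum>E\<in>P. norm (F E))" and P: "finite P" "P \<subseteq> sets M" "partition_on (space M) P"
    by blast
  have "s \<le> (\<Sum>E\<in>P. R * \<mu> E)" unfolding s using P by (intro sum_mono F_bound) auto
  also have "\<dots> = R * (\<Sum>E\<in>P. \<mu> E)" by (simp add: sum_distrib_left)
  also have "(\<Sum>E\<in>P. \<mu> E) = \<mu> (\<Union>E\<in>P. E)"
    using P partition_onD2[OF P(3)]
    by (intro M.finite_measure_finite_Union[symmetric]) (auto simp: disjoint_family_on_def disjoint_def)
  also have "(\<Union>E\<in>P. E) = space M" using partition_onD1[OF P(3)] by simp
  finally show "s \<le> R * \<mu> (space M)" .
qed

lemma F_absolutely_continuous: "vector_absolutely_continuous M F"
  unfolding vector_absolutely_continuous_def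
proof
  fix E assume "E \<in> null_sets M"
  then have "E \<in> sets M" "\<mu> E = 0" by (auto simp: null_sets_def measure_def)
  then show "F E = 0" using F_bound[of E] by simp
qed

lemma F_cell:
  assumes "j < q n"
  shows "norm (F (cell n j) - \<mu> (cell n j) *\<^sub>R v n j) \<le> 2 * (1 / 2) ^ n * \<mu> (cell n j)"
proof -
  have "\<Phi> n (cell n j) = (\<Sum>i<q n. if i = j then (1 / q n) *\<^sub>R v n j else 0)"
    unfolding \<Phi>_level_set by (intro sum.cong) auto
  then have \<Phi>: "\<Phi> n (cell n j) = \<mu> (cell n j) *\<^sub>R v n j"
    using assms by (simp add: measure_cell)
  have "norm (\<Phi> m (cell n j) - \<Phi> n (cell n j)) \<le> 2 * (1 / 2) ^ n * \<mu> (cell n j)" if "n \<le> m" for m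
    by (rule order_trans[OF \<Phi>_tail[OF that]]) (intro mult_right_mono, auto)
  then have "\<forall>\<^sub>F m in sequentially. norm (\<Phi> m (cell n j) - \<Phi> n (cell n j)) \<le> 2 * (1 / 2) ^ n * \<mu> (cell n j)"
    by (auto simp: eventually_sequentially)
  moreover have "(\<lambda>m. \<Phi> m (cell n j) - \<Phi> n (cell n j)) \<longlonglongrightarrow> F (cell n j) - \<Phi> n (cell n j)"
    by (intro tendsto_intros \<Phi>_tendsto level_set_sets)
  ultimately have "norm (F (cell n j) - \<Phi> n (cell n j)) \<le> 2 * (1 / 2) ^ n * \<mu> (cell n j)"
    by (intro Lim_norm_ubound[of sequentially]) auto
  then show ?thesis by (simp add: \<Phi>)
qed

lemma F_near_constant:
  assumes g: "integrable M g" "\<And>E. E \<in> sets M \<Longrightarrow> F E = (LINT x:E|M. g x)"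
    and S: "S \<in> sets M" and near: "\<And>x. x \<in> S \<Longrightarrow> norm (g x - y) \<le> e"
  shows "norm (F S - \<mu> S *\<^sub>R y) \<le> e * \<mu> S"
proof -
  have hb: "has_bochner_integral M (\<lambda>x. indicator S x *\<^sub>R c) (\<mu> S *\<^sub>R c)" for c :: "'c::{banach, second_countable_topology}"
    using S by (intro has_bochner_integral_indicator) (auto simp: M.emeasure_finite top.not_eq_extremum[symmetric])
  have int: "integrable M (\<lambda>x. indicator S x *\<^sub>R g x)"
    using S g(1) by (intro integrable_mult_indicator)
  have inty: "integrable M (\<lambda>x. indicator S x *\<^sub>R y)" "integral\<^sup>L M (\<lambda>x. indicator S x *\<^sub>R y) = \<mu> S *\<^sub>R y"
    using hb by (auto simp: has_bochner_integral_iff)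
  have inte: "integrable M (\<lambda>x. indicator S x *\<^sub>R e)" "integral\<^sup>L M (\<lambda>x. indicator S x *\<^sub>R e) = e * \<mu> S"
    using hb[of e] by (auto simp only: has_bochner_integral_iff real_scaleR_def mult.commute[of e])
  have "F S - \<mu> S *\<^sub>R y = integral\<^sup>L M (\<lambda>x. indicator S x *\<^sub>R g x - indicator S x *\<^sub>R y)"
    using g(2)[OF S] int inty by (simp add: set_lebesgue_integral_def)
  then have "norm (F S - \<mu> S *\<^sub>R y) \<le> integral\<^sup>L M (\<lambda>x. norm (indicator S x *\<^sub>R g x - indicator S x *\<^sub>R y))"
    by simp
  also have "\<dots> \<le> integral\<^sup>L M (\<lambda>x. indicator S x *\<^sub>R e)"
  proof (rule integral_mono)
    show "integrable M (\<lambda>x. norm (indicator S x *\<^sub>R g x - indicator S x *\<^sub>R y))"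
      using int inty by (intro integrable_norm Bochner_Integration.integrable_diff)
    show "norm (indicator S x *\<^sub>R g x - indicator S x *\<^sub>R y) \<le> indicator S x *\<^sub>R e" for x
      using near by (auto simp: indicator_def)
  qed (rule inte)
  finally show ?thesis unfolding inte(2) .
qed

text \<open>
  Otherwise the part outside \<open>E\<close> would be too large in each cell, and the sum over the cells would make it
  too large in the whole level set.
\<close>

lemma dense_cell:
  assumes E: "E \<in> sets M" and L: "0 < \<mu> (level_set n J)"
    and le: "\<mu> (level_set n J - E) \<le> t * \<mu> (level_set n J)"
  shows "\<exists>j\<in>J. j < q n \<and> \<mu> (cell n j - E) \<le> t * \<mu> (cell n j)"
proof (rule ccontr)
  assume no: "\<not> (\<exists>j\<in>J. j < q n \<and> \<mu> (cell n j - E) \<le> t * \<mu> (cell n j))"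
  define I where "I = J \<inter> {..<q n}"
  have fin: "finite I" by (simp add: I_def)
  have L_eq: "level_set n J = (\<Union>j\<in>I. cell n j)" unfolding I_def by (rule level_set_cells)
  then have ne: "I \<noteq> {}" using L by auto
  have 1: "\<mu> (\<Union>j\<in>I. cell n j) = (\<Sum>j\<in>I. \<mu> (cell n j))"
  proof (rule M.finite_measure_finite_Union[OF fin])
    show "(\<lambda>j. cell n j) ` I \<subseteq> sets M" using level_set_sets by blast
    show "disjoint_family_on (\<lambda>j. cell n j) I"
      by (auto simp: disjoint_family_on_def level_set_def)
  qed
  have 2: "\<mu> (\<Union>j\<in>I. cell n j - E) = (\<Sum>j\<in>I. \<mu> (cell n j - E))"
  proof (rule M.finite_measure_finite_Union[OF fin])
    show "(\<lambda>j. cell n j - E) ` I \<subseteq> sets M" using level_set_sets E by blast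
    show "disjoint_family_on (\<lambda>j. cell n j - E) I"
      by (auto simp: disjoint_family_on_def level_set_def)
  qed
  have "(\<Sum>j\<in>I. t * \<mu> (cell n j)) < (\<Sum>j\<in>I. \<mu> (cell n j - E))"
    using no by (intro sum_strict_mono fin ne) (auto simp: I_def not_le)
  then have "t * \<mu> (level_set n J) < \<mu> (\<Union>j\<in>I. cell n j - E)"
    unfolding L_eq 1 2 by (simp add: sum_distrib_left)
  also have "(\<Union>j\<in>I. cell n j - E) = level_set n J - E" unfolding L_eq by blast
  finally show False using le by simp
qed

text \<open>
  On a cell mostly contained in a set where the density is close to \<open>y\<close>, the mean of \<open>F\<close> is close to
  \<open>y\<close>; but that mean is close to the vertex attached to the cell.
\<close>

lemma vertex_near_density_value:
  assumes g: "integrable M g" "\<And>E. E \<in> sets M \<Longrightarrow> F E = (LINT x:E|M. g x)"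
    and E: "E \<in> sets M" and e: "0 \<le> e" and near: "\<And>x. x \<in> E \<Longrightarrow> norm (g x - y) \<le> e"
    and j: "j < q n" and dense: "\<mu> (cell n j - E) \<le> t * \<mu> (cell n j)"
  shows "norm (v n j - y) \<le> 2 * (1 / 2) ^ n + e + (R + norm y) * t"
proof -
  let ?C = "cell n j"
  have C: "?C \<in> sets M" by (rule level_set_sets)
  have m: "0 < \<mu> ?C" using measure_cell[OF j] q_pos by simp
  have split: "F ?C = F (?C \<inter> E) + F (?C - E)"
  proof -
    have "F ((?C \<inter> E) \<union> (?C - E)) = F (?C \<inter> E) + F (?C - E)"
      using C E by (intro F_Un) auto
    moreover have "(?C \<inter> E) \<union> (?C - E) = ?C" by blast
    ultimately show ?thesis by simp
  qed
  have msplit: "\<mu> ?C = \<mu> (?C \<inter> E) + \<mu> (?C - E)"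
  proof -
    have "\<mu> ((?C \<inter> E) \<union> (?C - E)) = \<mu> (?C \<inter> E) + \<mu> (?C - E)"
      using C E by (intro M.finite_measure_Union) auto
    moreover have "(?C \<inter> E) \<union> (?C - E) = ?C" by blast
    ultimately show ?thesis by simp
  qed
  have n1: "norm (F (?C \<inter> E) - \<mu> (?C \<inter> E) *\<^sub>R y) \<le> e * \<mu> (?C \<inter> E)"
    using C E near by (intro F_near_constant[OF g]) auto
  have n2: "norm (F (?C - E)) \<le> R * \<mu> (?C - E)" using C E by (intro F_bound) auto
  have eq: "\<mu> ?C *\<^sub>R (v n j - y) = (F (?C \<inter> E) - \<mu> (?C \<inter> E) *\<^sub>R y) + (F (?C - E) - \<mu> (?C - E) *\<^sub>R y)
      - (F ?C - \<mu> ?C *\<^sub>R v n j)"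
    unfolding split by (simp add: msplit algebra_simps)
  have "\<mu> ?C * norm (v n j - y) = norm (\<mu> ?C *\<^sub>R (v n j - y))" by simp
  also have "\<dots> \<le> norm (F (?C \<inter> E) - \<mu> (?C \<inter> E) *\<^sub>R y) + norm (F (?C - E) - \<mu> (?C - E) *\<^sub>R y)
      + norm (F ?C - \<mu> ?C *\<^sub>R v n j)"
    unfolding eq by (intro order_trans[OF norm_triangle_ineq4] add_right_mono norm_triangle_ineq)
  also have "\<dots> \<le> e * \<mu> (?C \<inter> E) + (R + norm y) * \<mu> (?C - E) + 2 * (1 / 2) ^ n * \<mu> ?C"
    using n1 n2 F_cell[OF j] norm_triangle_ineq4[of "F (?C - E)" "\<mu> (?C - E) *\<^sub>R y"]
    by (simp add: algebra_simps)
  also have "\<dots> \<le> e * \<mu> ?C + (R + norm y) * (t * \<mu> ?C) + 2 * (1 / 2) ^ n * \<mu> ?C"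
  proof -
    have "e * \<mu> (?C \<inter> E) \<le> e * \<mu> ?C" using e by (simp add: msplit mult_left_mono)
    moreover have "(R + norm y) * \<mu> (?C - E) \<le> (R + norm y) * (t * \<mu> ?C)"
      using R_nonneg by (intro mult_left_mono dense) simp
    ultimately show ?thesis by linarith
  qed
  also have "\<dots> = \<mu> ?C * (2 * (1 / 2) ^ n + e + (R + norm y) * t)" by (simp add: algebra_simps)
  finally show ?thesis using m by simp
qed

text \<open>
  Separability gives a ball of radius \<open>d / 16\<close> around some \<open>y\<close> in which the density takes its values on a set
  of positive measure. This set almost fills some cell of a late level, and then also some child of
  that cell, so both vertices are close to \<open>y\<close>, whereas a vertex and its child have distance at least \<open>d\<close>.
\<close>

lemma no_density:
  assumes d: "0 < d" and sep: "\<And>n a i. a \<in> A \<Longrightarrow> i < k n \<Longrightarrow> d \<le> norm (b n a i - a)"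
    and g: "integrable M g" "\<And>E. E \<in> sets M \<Longrightarrow> F E = (LINT x:E|M. g x)"
  shows False
proof -
  define e where "e = d / 16"
  have e: "0 < e" using d by (simp add: e_def)
  obtain D :: "'a set" where D: "countable D" "\<And>X. open X \<Longrightarrow> X \<noteq> {} \<Longrightarrow> \<exists>d\<in>D. d \<in> X"
    using countable_dense_exists by blast
  define E where "E y = g -` ball y e \<inter> space M" for y
  have gm: "g \<in> borel_measurable M" using g(1) by simp
  have E_sets: "E y \<in> sets M" for y unfolding E_def using gm by (rule measurable_sets) simp
  have "\<exists>y\<in>D. 0 < \<mu> (E y)"
  proof (rule ccontr)
    assume "\<not> (\<exists>y\<in>D. 0 < \<mu> (E y))"
    then have "E y \<in> null_sets M" if "y \<in> D" for y
    proof -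
      have "\<mu> (E y) = 0"
        using \<open>\<not> (\<exists>y\<in>D. 0 < \<mu> (E y))\<close> that measure_nonneg[of M "E y"] by (meson antisym_conv1 not_less)
      then show ?thesis using E_sets by (simp add: null_sets_def M.emeasure_eq_measure)
    qed
    then have "(\<Union>y\<in>D. E y) \<in> null_sets M" using D(1) by (intro null_sets_UN') auto
    moreover have "(\<Union>y\<in>D. E y) = space M"
    proof -
      have "\<exists>y\<in>D. x \<in> E y" if "x \<in> space M" for x
        using D(2)[of "ball (g x) e"] e that by (auto simp: E_def dist_commute)
      then show ?thesis by (auto simp: E_def)
    qed
    ultimately have "\<mu> (space M) = 0" by (simp add: null_sets_def measure_def)
    moreover have "cell 0 0 = space M" by (auto simp: cell_eq space_M)
    ultimately show False using measure_cell[of 0 0] by simp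
  qed
  then obtain y where y: "0 < \<mu> (E y)" by blast
  \<comment> \<open>The proportion of a cell that can be neglected at the cost of an error \<open>e\<close>.\<close>
  define t where "t = min 1 (e / (R + norm y + 1))"
  have Ry: "0 \<le> R + norm y" using R_nonneg by simp
  have t: "0 < t" "t \<le> 1" using e Ry by (auto simp: t_def)
  have "(R + norm y) * t \<le> (R + norm y + 1) * (e / (R + norm y + 1))"
    using Ry t by (intro mult_mono) (auto simp: t_def)
  also have "\<dots> = e" using Ry by simp
  finally have tR: "(R + norm y) * t \<le> e" .
  have near: "norm (g x - y) \<le> e" if "x \<in> E y" for x
    using that by (simp add: E_def dist_norm norm_minus_commute)
  have "0 < t * \<mu> (E y) / 2" using t y by simp
  then obtain n0 J0 where J0: "\<mu> (sym_diff (E y) (level_set n0 J0)) < t * \<mu> (E y) / 2"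
    using approximable[OF E_sets[of y]] unfolding approximable_def by meson
  have "(\<lambda>n. 2 * (1 / 2) ^ n) \<longlonglongrightarrow> 2 * (0::real)"
    by (intro tendsto_intros LIMSEQ_power_zero) simp
  then have "\<forall>\<^sub>F n in sequentially. 2 * (1 / 2) ^ n < e"
    using e by (intro order_tendstoD(2)[where y = 0]) auto
  then obtain n1 where n1: "\<And>n. n1 \<le> n \<Longrightarrow> 2 * (1 / 2) ^ n < e" by (auto simp: eventually_sequentially)
  define n where "n = max n0 n1"
  obtain J where J: "level_set n0 J0 = level_set n J" using level_set_upcast[of n0 n] by (auto simp: n_def)
  define L where "L = level_set n J"
  have L: "L \<in> sets M" unfolding L_def by (rule level_set_sets)
  have sd: "\<mu> (sym_diff (E y) L) < t * \<mu> (E y) / 2" using J0 by (simp add: J L_def)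
  have "\<mu> (E y) - \<mu> L \<le> \<mu> (sym_diff (E y) L)" using measure_diff_le[OF E_sets L, of y] by linarith
  moreover have "t * \<mu> (E y) \<le> \<mu> (E y)" using t y by simp
  ultimately have Lbig: "\<mu> (E y) / 2 < \<mu> L" using sd by linarith
  have "\<mu> (L - E y) \<le> \<mu> (sym_diff (E y) L)"
    using L E_sets by (intro M.finite_measure_mono) auto
  also have "\<dots> \<le> t * \<mu> L" using sd mult_strict_left_mono[OF Lbig t(1)] by simp
  finally have "\<mu> (level_set n J - E y) \<le> t * \<mu> (level_set n J)" by (simp add: L_def)
  moreover have "0 < \<mu> (level_set n J)" using Lbig y by (simp add: L_def)
  ultimately obtain j where j: "j < q n" "\<mu> (cell n j - E y) \<le> t * \<mu> (cell n j)"
    using dense_cell[OF E_sets] by blast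
  have C: "cell n j = level_set (Suc n) {m. m div k n \<in> {j}}" by (rule level_set_Suc)
  have "0 < \<mu> (cell n j)" using measure_cell[OF j(1)] q_pos by simp
  then obtain m where m: "m div k n = j" "m < q (Suc n)" "\<mu> (cell (Suc n) m - E y) \<le> t * \<mu> (cell (Suc n) m)"
    using dense_cell[OF E_sets, of "Suc n" "{m. m div k n \<in> {j}}" y t] j(2) unfolding C by blast
  have "norm (v n j - y) \<le> 2 * (1 / 2) ^ n + e + (R + norm y) * t"
    using near e by (intro vertex_near_density_value[OF g E_sets _ _ j]) auto
  also have "\<dots> \<le> 3 * e" using n1[of n] tR by (simp add: n_def)
  finally have v1: "norm (v n j - y) \<le> 3 * e" .
  have "norm (v (Suc n) m - y) \<le> 2 * (1 / 2) ^ Suc n + e + (R + norm y) * t"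
    using near e by (intro vertex_near_density_value[OF g E_sets _ _ m(2,3)]) auto
  also have "\<dots> \<le> 3 * e" using n1[OF le_SucI, of n] tR by (simp add: n_def)
  finally have v2: "norm (v (Suc n) m - y) \<le> 3 * e" .
  have "d \<le> norm (b n (v n j) (m mod k n) - v n j)" using k_pos by (intro sep v_A) simp
  also have "b n (v n j) (m mod k n) = v (Suc n) m" using m(1) by simp
  also have "norm (v (Suc n) m - v n j) \<le> 6 * e"
    using v1 v2 norm_triangle_ineq4[of "v (Suc n) m - y" "v n j - y"] by simp
  finally show False using d by (simp add: e_def)
qed

end

text \<open>
  A form of the dentability of bounded sets in spaces with the Radon-Nikodym property. The number of
  points in the averages may depend on the accuracy but not on \<open>a\<close>, which is what makes the tree
  above one with cells of equal length.
\<close>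

theorem RNP_no_separated_averaging_tree:
  fixes A :: "'a::{banach, second_countable_topology} set"
  assumes rnp: "radon_nikodym_property TYPE('a)"
    and A: "A \<noteq> {}" "\<And>a. a \<in> A \<Longrightarrow> norm a \<le> R" and d: "0 < d"
    and avg: "\<And>e. 0 < e \<Longrightarrow> \<exists>k>0. \<forall>a\<in>A. \<exists>b. (\<forall>i<k. b i \<in> A \<and> d \<le> norm (b i - a)) \<and>
                norm (a - (1 / real k) *\<^sub>R (\<Sum>i<k. b i)) \<le> e"
  shows False
proof -
  have "\<forall>n. \<exists>k>0. \<forall>a\<in>A. \<exists>b. (\<forall>i<k. b i \<in> A \<and> d \<le> norm (b i - a)) \<and>
      norm (a - (1 / real k) *\<^sub>R (\<Sum>i<k. b i)) \<le> (1 / 2) ^ n"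
    using avg by simp
  then obtain k where k: "\<And>n. 0 < k n" "\<And>n a. a \<in> A \<Longrightarrow> \<exists>b. (\<forall>i<k n. b i \<in> A \<and> d \<le> norm (b i - a)) \<and>
      norm (a - (1 / real (k n)) *\<^sub>R (\<Sum>i<k n. b i)) \<le> (1 / 2) ^ n"
    by metis
  define b where "b n a = (SOME b. (\<forall>i<k n. b i \<in> A \<and> d \<le> norm (b i - a)) \<and>
      norm (a - (1 / real (k n)) *\<^sub>R (\<Sum>i<k n. b i)) \<le> (1 / 2) ^ n)" for n a
  have b: "(\<forall>i<k n. b n a i \<in> A \<and> d \<le> norm (b n a i - a)) \<and>
      norm (a - (1 / real (k n)) *\<^sub>R (\<Sum>i<k n. b n a i)) \<le> (1 / 2) ^ n" if "a \<in> A" for n a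
    unfolding b_def by (rule someI_ex[OF k(2)[OF that]])
  obtain root where root: "root \<in> A" using A(1) by blast
  interpret averaging_tree A R k b root
    by unfold_locales (use A(2) root k(1) b in auto)
  obtain g where "integrable M g" "\<forall>E\<in>sets M. F E = (LINT x:E|M. g x)"
    using rnp F_vector_measure F_bounded_variation F_absolutely_continuous M.finite_measure_axioms
    unfolding radon_nikodym_property_def by blast
  then show False using no_density[OF d, of g] b by blast
qed

section \<open>Orbits of bounded groups\<close>

locale bounded_group =
  fixes G :: "('a::real_normed_vector \<Rightarrow> 'a) set" and M :: real
  assumes bl: "g \<in> G \<Longrightarrow> bounded_linear g" and bij: "g \<in> G \<Longrightarrow> bij g"
    and id_G: "id \<in> G" and comp_G: "g \<in> G \<Longrightarrow> h \<in> G \<Longrightarrow> g \<circ> h \<in> G" and inv_G: "g \<in> G \<Longrightarrow> inv g \<in> G"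
    and M_ge: "1 \<le> M" and M_bound: "g \<in> G \<Longrightarrow> norm (g x) \<le> M * norm x"
begin

lemma inv_left: "g \<in> G \<Longrightarrow> inv g (g x) = x"
  using bij by (simp add: bij_is_inj)

lemma inv_right: "g \<in> G \<Longrightarrow> g (inv g x) = x"
  using bij by (simp add: bij_is_surj surj_f_inv_f)

lemma lin: "g \<in> G \<Longrightarrow> linear g"
  using bl by (rule bounded_linear.linear)

lemma M_lower: assumes "g \<in> G" shows "norm x \<le> M * norm (g x)"
  using M_bound[OF inv_G[OF assms], of "g x"] unfolding inv_left[OF assms] .

end

lemma bounded_isomorphism_group_bound:
  assumes "bounded_isomorphism_group G"
  shows "\<exists>M. bounded_group G M"
proof -
  obtain c where c: "\<And>g. g \<in> G \<Longrightarrow> onorm g \<le> c"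
    using assms unfolding bounded_isomorphism_group_def bdd_above_def by auto
  have G: "\<And>g. g \<in> G \<Longrightarrow> bounded_linear g" "\<And>g. g \<in> G \<Longrightarrow> bij g" "id \<in> G"
    "\<And>g h. g \<in> G \<Longrightarrow> h \<in> G \<Longrightarrow> g \<circ> h \<in> G" "\<And>g. g \<in> G \<Longrightarrow> inv g \<in> G"
    using assms unfolding bounded_isomorphism_group_def isomorphism_group_def isomorphism_def by auto
  have "norm (g x) \<le> max 1 c * norm x" if g: "g \<in> G" for g x
  proof -
    have "norm (g x) \<le> onorm g * norm x" by (rule onorm[OF G(1)[OF g]])
    also have "\<dots> \<le> max 1 c * norm x" using c[OF g] by (intro mult_right_mono) auto
    finally show ?thesis .
  qed
  then have "bounded_group G (max 1 c)" by (intro bounded_group.intro G) simp_all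
  then show ?thesis by blast
qed

text \<open>
  One approximation of \<open>x0\<close> by an average of other points of its orbit can be moved by the group to
  every point of the orbit, at the cost of the factor \<open>M\<close> in all distances. The discreteness of the
  orbit at \<open>x0\<close> keeps the points of these averages away from the point that they approximate.
\<close>

theorem RNP_orbit_point_isolated_from_hull:
  fixes G :: "('a::{banach, second_countable_topology} \<Rightarrow> 'a) set"
  assumes rnp: "radon_nikodym_property TYPE('a)" and "bounded_group G M"
    and sep: "separates x0 G" and disc: "discrete (orbit_of G x0)"
  shows "x0 \<notin> closure (convex hull (orbit_of G x0 - {x0}))"
proof
  interpret bounded_group G M by fact
  assume hull: "x0 \<in> closure (convex hull (orbit_of G x0 - {x0}))"
  have x0: "x0 \<in> orbit_of G x0" using id_G unfolding orbit_of_def by (metis (mono_tags, lifting) id_apply mem_Collect_eq)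
  obtain T where T: "open T" "T \<inter> orbit_of G x0 = {x0}"
    using discreteD[OF disc x0] unfolding isolated_in_def by blast
  then obtain e where e: "0 < e" "ball x0 e \<subseteq> T" using open_contains_ball by blast
  have far: "e \<le> norm (y - x0)" if "y \<in> orbit_of G x0 - {x0}" for y
  proof (rule ccontr)
    assume "\<not> e \<le> norm (y - x0)"
    then have "y \<in> ball x0 e" by (simp add: dist_norm norm_minus_commute)
    then show False using that e T by blast
  qed
  have M0: "0 < M" using M_ge by simp
  show False
  proof (rule RNP_no_separated_averaging_tree[OF rnp, of "orbit_of G x0" "M * norm x0" "e / M"])
    show "orbit_of G x0 \<noteq> {}" using x0 by blast
    show "norm a \<le> M * norm x0" if "a \<in> orbit_of G x0" for a
      using that M_bound by (auto simp: orbit_of_def)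
    show "0 < e / M" using e M0 by simp
    fix \<epsilon> :: real assume "0 < \<epsilon>"
    then have "0 < \<epsilon> / M" using M0 by simp
    then obtain k b where k: "0 < k" and b: "\<And>i. i < k \<Longrightarrow> b i \<in> orbit_of G x0 - {x0}"
      and near: "norm (x0 - (1 / real k) *\<^sub>R (\<Sum>i<k. b i)) < \<epsilon> / M"
      using closed_convex_hull_approx_average[OF hull] by metis
    show "\<exists>k>0. \<forall>a\<in>orbit_of G x0. \<exists>b. (\<forall>i<k. b i \<in> orbit_of G x0 \<and> e / M \<le> norm (b i - a)) \<and>
      norm (a - (1 / real k) *\<^sub>R (\<Sum>i<k. b i)) \<le> \<epsilon>"
    proof (intro exI[of _ k] conjI k ballI)
      fix a assume "a \<in> orbit_of G x0"
      then obtain g where g: "g \<in> G" "a = g x0" by (auto simp: orbit_of_def)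
      note lg = lin[OF g(1)]
      have 1: "g (b i) \<in> orbit_of G x0" if i: "i < k" for i
      proof -
        obtain h where "h \<in> G" "b i = h x0" using b[OF i] by (auto simp: orbit_of_def)
        then have "g (b i) = (g \<circ> h) x0" "g \<circ> h \<in> G" using comp_G[OF g(1)] by simp_all
        then show ?thesis unfolding orbit_of_def by blast
      qed
      have 2: "e / M \<le> norm (g (b i) - a)" if "i < k" for i
      proof -
        have "e \<le> M * norm (g (b i - x0))" by (rule order_trans[OF far[OF b[OF that]] M_lower[OF g(1)]])
        then show ?thesis using M0 by (simp add: g linear_diff[OF lg] pos_divide_le_eq mult.commute)
      qed
      have "a - (1 / real k) *\<^sub>R (\<Sum>i<k. g (b i)) = g (x0 - (1 / real k) *\<^sub>R (\<Sum>i<k. b i))"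
        by (simp add: g linear_diff[OF lg] linear_scale[OF lg] linear_sum[OF lg])
      also have "norm \<dots> \<le> M * norm (x0 - (1 / real k) *\<^sub>R (\<Sum>i<k. b i))" by (rule M_bound[OF g(1)])
      also have "\<dots> \<le> M * (\<epsilon> / M)" using near M0 by (intro mult_left_mono) auto
      finally have 3: "norm (a - (1 / real k) *\<^sub>R (\<Sum>i<k. g (b i))) \<le> \<epsilon>" using M0 by simp
      show "\<exists>b. (\<forall>i<k. b i \<in> orbit_of G x0 \<and> e / M \<le> norm (b i - a)) \<and>
          norm (a - (1 / real k) *\<^sub>R (\<Sum>i<k. b i)) \<le> \<epsilon>"
        using 1 2 3 by (intro exI[of _ "\<lambda>i. g (b i)"]) blast
    qed
  qed
qed

corollary RNP_orbit_exposing_functional: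
  fixes G :: "('a::{banach, second_countable_topology} \<Rightarrow> 'a) set"
  assumes rnp: "radon_nikodym_property TYPE('a)" and bg: "bounded_group G M"
    and sep: "separates x0 G" and disc: "discrete (orbit_of G x0)"
    and minus: "uminus \<in> G" and x0: "x0 \<noteq> 0"
  shows "\<exists>(f :: 'a \<Rightarrow> real) \<eta>. bounded_linear f \<and> f x0 = 1 \<and> 0 < \<eta> \<and> \<eta> \<le> 1 \<and> (\<forall>g\<in>G. g \<noteq> id \<longrightarrow> f (g x0) \<le> 1 - \<eta>)"
proof -
  interpret bounded_group G M by fact
  define C where "C = closure (convex hull (orbit_of G x0 - {x0}))"
  have C: "convex C" "closed C" "orbit_of G x0 - {x0} \<subseteq> C"
    unfolding C_def by (simp_all add: convex_closure subset_closed_convex_hull)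
  have neq: "g x0 \<noteq> x0" if "g \<in> G" "g \<noteq> id" for g
    using sep that id_G unfolding separates_def by fastforce
  have "- x0 \<noteq> x0" using x0 by (metis add.right_inverse scaleR_2 scaleR_eq_0_iff zero_neq_numeral)
  then have m: "- x0 \<in> orbit_of G x0 - {x0}"
    using minus unfolding orbit_of_def by (auto intro: exI[of _ uminus])
  have mC: "- x0 \<in> C" by (rule subsetD[OF C(3) m])
  have "\<exists>f d. bounded_linear f \<and> (\<forall>v. \<bar>f v\<bar> \<le> norm v) \<and> 0 < d \<and> (\<forall>c\<in>C. f c + d \<le> f x0)"
  proof (rule point_closed_convex_separation)
    show "C \<noteq> {}" using mC by blast
    show "x0 \<notin> C" unfolding C_def by (rule RNP_orbit_point_isolated_from_hull[OF rnp bg sep disc])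
  qed (rule C)+
  then obtain F :: "'a \<Rightarrow> real" and d where F: "bounded_linear F" "0 < d" and F_le: "\<forall>c\<in>C. F c + d \<le> F x0" by blast
  have "F (- x0) + d \<le> F x0" using F_le mC by blast
  then have pos: "0 < F x0" using F(2) linear_neg[OF bounded_linear.linear[OF F(1)], of x0] by simp
  have le: "F (g x0) + d \<le> F x0" if "g \<in> G" "g \<noteq> id" for g
  proof (rule bspec[OF F_le])
    have "g x0 \<in> orbit_of G x0 - {x0}" using neq that by (auto simp: orbit_of_def)
    then show "g x0 \<in> C" by (rule subsetD[OF C(3)])
  qed
  define f where "f v = F v / F x0" for v
  define \<eta> where "\<eta> = min 1 (d / F x0)"
  have "bounded_linear f" unfolding f_def
    by (rule bounded_linear_compose[OF bounded_linear_divide F(1)])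
  moreover have "f x0 = 1" using pos by (simp add: f_def)
  moreover have "0 < \<eta>" "\<eta> \<le> 1" using pos F(2) by (auto simp: \<eta>_def)
  moreover have "f (g x0) \<le> 1 - \<eta>" if "g \<in> G" "g \<noteq> id" for g
  proof -
    have "F (g x0) / F x0 \<le> (F x0 - d) / F x0" using le[OF that] pos by (intro divide_right_mono) auto
    also have "\<dots> = 1 - d / F x0" using pos by (simp add: diff_divide_distrib)
    finally show ?thesis by (simp add: f_def \<eta>_def)
  qed
  ultimately show ?thesis by blast
qed

section \<open>Quadratic forms, dense sequences and separated sets\<close>

text \<open>
  The form \<open>B v v = \<Sum> 2^-(n+1) (h n v)^2\<close> is a continuous inner product, in general not
  complete. It is used to define a strictly convex surface all of whose points have a tangent that
  exposes them.
\<close>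

locale norming_sequence =
  fixes h :: "nat \<Rightarrow> 'a::real_normed_vector \<Rightarrow> real"
  assumes h_bl: "bounded_linear (h n)" and h_le: "\<bar>h n v\<bar> \<le> norm v"
    and h_separating: "(\<And>n. h n v = 0) \<Longrightarrow> v = 0"
begin

definition B :: "'a \<Rightarrow> 'a \<Rightarrow> real" where
  "B v w = (\<Sum>n. (1 / 2) ^ Suc n * (h n v * h n w))"

lemma B_term_le: "norm ((1 / 2) ^ Suc n * (h n v * h n w)) \<le> (1 / 2) ^ Suc n * (norm v * norm w)"
  using h_le by (simp add: abs_mult mult_mono)

lemma B_major_sums: "(\<lambda>n. (1 / 2) ^ Suc n * (norm v * norm w)) sums (norm v * norm w)"
  using sums_mult2[OF power_half_series, of "norm v * norm w"] by simp

lemma B_summable: "summable (\<lambda>n. (1 / 2) ^ Suc n * (h n v * h n w))"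
  by (rule summable_comparison_test'[OF sums_summable[OF B_major_sums[of v w]]]) (rule B_term_le)

lemma B_sums: "(\<lambda>n. (1 / 2) ^ Suc n * (h n v * h n w)) sums B v w"
  unfolding B_def by (rule summable_sums[OF B_summable])

lemma B_le: "\<bar>B v w\<bar> \<le> norm v * norm w"
proof (rule abs_leI)
  have 1: "(1 / 2) ^ Suc n * (h n v * h n w) \<le> (1 / 2) ^ Suc n * (norm v * norm w)"
    and 2: "- ((1 / 2) ^ Suc n * (h n v * h n w)) \<le> (1 / 2) ^ Suc n * (norm v * norm w)" for n
    using B_term_le[of n v w] unfolding real_norm_def by linarith+
  show "B v w \<le> norm v * norm w" by (rule sums_le[OF 1 B_sums B_major_sums])
  show "- B v w \<le> norm v * norm w" by (rule sums_le[OF 2 sums_minus[OF B_sums] B_major_sums])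
qed

lemma B_commute: "B v w = B w v"
  unfolding B_def by (simp add: mult.commute)

lemma B_add: "B u (v + w) = B u v + B u w"
proof -
  have "(\<lambda>n. (1 / 2) ^ Suc n * (h n u * h n v) + (1 / 2) ^ Suc n * (h n u * h n w)) sums (B u v + B u w)"
    by (intro sums_add B_sums)
  moreover have "(1 / 2) ^ Suc n * (h n u * h n v) + (1 / 2) ^ Suc n * (h n u * h n w)
      = (1 / 2) ^ Suc n * (h n u * h n (v + w))" for n
    using linear_add[OF bounded_linear.linear[OF h_bl]] by (simp add: algebra_simps)
  ultimately show ?thesis using B_sums[of u "v + w"] by (simp only: sums_unique2)
qed

lemma B_scale: "B u (c *\<^sub>R v) = c * B u v"
proof -
  have "(\<lambda>n. c * ((1 / 2) ^ Suc n * (h n u * h n v))) sums (c * B u v)"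
    by (intro sums_mult B_sums)
  moreover have "c * ((1 / 2) ^ Suc n * (h n u * h n v)) = (1 / 2) ^ Suc n * (h n u * h n (c *\<^sub>R v))" for n
    using linear_scale[OF bounded_linear.linear[OF h_bl]] by (simp add: algebra_simps)
  ultimately show ?thesis using B_sums[of u "c *\<^sub>R v"] by (simp only: sums_unique2)
qed

lemma B_bounded_linear: "bounded_linear (B u)"
proof (rule bounded_linear_intro[where K = "norm u"])
  show "norm (B u v) \<le> norm v * norm u" for v using B_le[of u v] by (simp add: mult.commute)
qed (simp_all add: B_add B_scale)

lemma B_diff: "B (u - v) (u - v) = B u u - 2 * B u v + B v v"
  using linear_diff[OF bounded_linear.linear[OF B_bounded_linear]] B_commute
  by (smt (verit, best))

lemma B_pos: assumes "v \<noteq> 0" shows "0 < B v v"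
proof -
  obtain n where n: "h n v \<noteq> 0" using h_separating assms by blast
  have "0 < (\<Sum>n. (1 / 2) ^ Suc n * (h n v * h n v))"
  proof (rule suminf_pos2[OF B_summable])
    show "0 \<le> (1 / 2) ^ Suc m * (h m v * h m v)" for m by simp
    show "0 < (1 / 2) ^ Suc n * (h n v * h n v)" using n by (auto simp: zero_less_mult_iff linorder_neq_iff)
  qed
  then show ?thesis by (simp add: B_def)
qed

end

text \<open>
  Norming functionals of a dense sequence separate points: if all of them vanish at \<open>v\<close>, then a point
  \<open>d\<close> of the sequence close to \<open>v\<close> has \<open>norm d = h (d - v) \<le> norm (d - v)\<close>, which is too small.
\<close>

lemma exists_norming_sequence:
  "\<exists>h :: nat \<Rightarrow> 'a::{real_normed_vector, second_countable_topology} \<Rightarrow> real. norming_sequence h"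
proof -
  obtain D :: "'a set" where D: "countable D" "\<And>X. open X \<Longrightarrow> X \<noteq> {} \<Longrightarrow> \<exists>d\<in>D. d \<in> X"
    using countable_dense_exists by blast
  have ne: "D \<noteq> {}" using D(2)[of UNIV] by auto
  define h :: "nat \<Rightarrow> 'a \<Rightarrow> real" where "h n = (SOME f. bounded_linear f \<and> (\<forall>v. \<bar>f v\<bar> \<le> norm v) \<and>
      f (from_nat_into D n) = norm (from_nat_into D n))" for n
  have h: "bounded_linear (h n) \<and> (\<forall>v. \<bar>h n v\<bar> \<le> norm v) \<and> h n (from_nat_into D n) = norm (from_nat_into D n)" for n
    unfolding h_def by (rule someI_ex[OF norming_functional])
  have "v = 0" if v: "\<And>n. h n v = 0" for v
  proof (rule ccontr)
    assume "v \<noteq> 0"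
    then have "ball v (norm v / 2) \<noteq> {}" by simp
    then obtain d where d: "d \<in> D" "d \<in> ball v (norm v / 2)" using D(2)[OF open_ball] by blast
    obtain n where n: "d = from_nat_into D n" using from_nat_into_surj[OF D(1) d(1)] by metis
    have "norm d = h n d - h n v" using h[of n] v by (simp add: n)
    also have "\<dots> = h n (d - v)" using linear_diff[OF bounded_linear.linear] h by metis
    also have "\<dots> \<le> norm (d - v)" using h[of n] abs_ge_self order_trans by blast
    finally have "norm d \<le> norm (v - d)" by (simp add: norm_minus_commute)
    moreover have "norm (v - d) < norm v / 2" using d(2) by (simp add: dist_norm)
    moreover have "norm v \<le> norm (v - d) + norm d" using norm_triangle_ineq[of "v - d" d] by simp
    ultimately show False by linarith
  qed
  then have "norming_sequence h" using h by (intro norming_sequence.intro) blast+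
  then show ?thesis by blast
qed

lemma dense_sequence_in_unit_sphere:
  fixes f :: "'a::{real_normed_vector, second_countable_topology} \<Rightarrow> real"
  assumes f: "linear f" and v: "f v = 0" "v \<noteq> 0"
  shows "\<exists>k :: nat \<Rightarrow> 'a. (\<forall>n. norm (k n) = 1 \<and> f (k n) = 0) \<and>
    (\<forall>x. norm x = 1 \<longrightarrow> f x = 0 \<longrightarrow> (\<forall>e>0. \<exists>n. norm (x - k n) < e))"
proof -
  define S where "S = {x. norm x = 1 \<and> f x = 0}"
  obtain T where T: "countable T" "T \<subseteq> S" "S \<subseteq> closure T" using separable by blast
  have "(1 / norm v) *\<^sub>R v \<in> S" using v f by (simp add: S_def linear_scale)
  then have ne: "T \<noteq> {}" using T(3) by auto
  have "\<exists>n. norm (x - from_nat_into T n) < e" if x: "x \<in> S" and e: "0 < e" for x e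
  proof -
    have "x \<in> closure T" using T(3) x by blast
    then obtain t where t: "t \<in> T" "dist t x < e" using e unfolding closure_approachable by blast
    obtain n where "t = from_nat_into T n" using from_nat_into_surj[OF T(1) t(1)] by metis
    then show ?thesis using t(2) by (auto simp: dist_norm norm_minus_commute)
  qed
  moreover have "from_nat_into T n \<in> S" for n using from_nat_into[OF ne] T(2) by blast
  ultimately show ?thesis unfolding S_def by (intro exI[of _ "from_nat_into T"]) blast
qed

lemma maximal_separated_subset:
  fixes S :: "'a::real_normed_vector set"
  shows "\<exists>U\<subseteq>S. (\<forall>u\<in>U. \<forall>v\<in>U. u \<noteq> v \<longrightarrow> e \<le> norm (u - v)) \<and> (\<forall>x\<in>S. \<exists>u\<in>U. x = u \<or> norm (x - u) < e)"
proof -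
  define A where "A = {U. U \<subseteq> S \<and> (\<forall>u\<in>U. \<forall>v\<in>U. u \<noteq> v \<longrightarrow> e \<le> norm (u - v))}"
  have "\<exists>U\<in>A. \<forall>X\<in>A. U \<subseteq> X \<longrightarrow> X = U"
  proof (rule subset_Zorn')
    fix C assume C: "subset.chain A C"
    have "e \<le> norm (u - v)" if uv: "u \<in> \<Union>C" "v \<in> \<Union>C" "u \<noteq> v" for u v
    proof -
      obtain X Y where XY: "X \<in> C" "Y \<in> C" "u \<in> X" "v \<in> Y" using uv by blast
      then have "X \<subseteq> Y \<or> Y \<subseteq> X" "X \<in> A" "Y \<in> A" using C by (auto simp: subset_chain_def)
      then show ?thesis using XY uv(3) unfolding A_def by blast
    qed
    moreover have "\<Union>C \<subseteq> S" using C by (auto simp: subset_chain_def A_def)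
    ultimately show "\<Union>C \<in> A" unfolding A_def by blast
  qed
  then obtain U where U: "U \<in> A" and max: "\<And>X. X \<in> A \<Longrightarrow> U \<subseteq> X \<Longrightarrow> X = U" by blast
  have "\<exists>u\<in>U. x = u \<or> norm (x - u) < e" if x: "x \<in> S" for x
  proof (rule ccontr)
    assume no: "\<not> (\<exists>u\<in>U. x = u \<or> norm (x - u) < e)"
    then have "insert x U \<in> A" using U x unfolding A_def by (auto simp: norm_minus_commute not_less)
    then show False using max[of "insert x U"] no by blast
  qed
  moreover have "U \<subseteq> S" "\<forall>u\<in>U. \<forall>v\<in>U. u \<noteq> v \<longrightarrow> e \<le> norm (u - v)" using U by (simp_all add: A_def)
  ultimately show ?thesis by (intro exI[of _ U]) simp
qed

lemma compact_insert_limit_range: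
  fixes x :: "nat \<Rightarrow> 'a::topological_space"
  assumes lim: "x \<longlonglongrightarrow> l"
  shows "compact (insert l (range x))"
proof (rule compactI)
  fix C assume C: "\<forall>t\<in>C. open t" "insert l (range x) \<subseteq> \<Union>C"
  obtain V where V: "V \<in> C" "l \<in> V" using C(2) by blast
  then have "\<forall>\<^sub>F n in sequentially. x n \<in> V" using C(1) lim by (intro topological_tendstoD) auto
  then obtain N where N: "\<And>n. N \<le> n \<Longrightarrow> x n \<in> V" by (auto simp: eventually_sequentially)
  have "\<forall>n. \<exists>W\<in>C. x n \<in> W" using C(2) by blast
  then obtain W where W: "\<And>n. W n \<in> C" "\<And>n. x n \<in> W n" by metis
  have "x n \<in> \<Union>(insert V (W ` {..<N}))" for n
    using N[of n] W(2)[of n] by (cases "n < N") auto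
  then have "insert l (range x) \<subseteq> \<Union>(insert V (W ` {..<N}))" using V(2) by blast
  then show "\<exists>C'\<subseteq>C. finite C' \<and> insert l (range x) \<subseteq> \<Union>C'"
    using V(1) W(1) by (intro exI[of _ "insert V (W ` {..<N})"]) auto
qed

lemma small_positive_solution:
  assumes "\<And>c d. (c, d) \<in> set cs \<Longrightarrow> 0 \<le> c \<and> 0 < d"
  shows "\<exists>t>0. \<forall>(c, d)\<in>set cs. c * t < (d::real)"
  using assms
proof (induction cs)
  case Nil show ?case by (intro exI[of _ 1]) simp
next
  case (Cons p cs)
  obtain c d where p: "p = (c, d)" by fastforce
  have cd: "0 \<le> c" "0 < d" using Cons.prems p by auto
  obtain t where t: "0 < t" "\<And>c d. (c, d) \<in> set cs \<Longrightarrow> c * t < d" using Cons by fastforce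
  define s where "s = min t (d / (c + 1))"
  have s: "0 < s" "s \<le> t" using t cd by (auto simp: s_def)
  have "c * s \<le> c * (d / (c + 1))" using cd by (intro mult_left_mono) (auto simp: s_def)
  also have "\<dots> < d" using cd by (simp add: field_simps)
  finally have "c * s < d" .
  moreover have "c' * s < d'" if "(c', d') \<in> set cs" for c' d'
  proof -
    have "0 \<le> c'" using Cons.prems that by auto
    then have "c' * s \<le> c' * t" using s by (intro mult_left_mono)
    then show ?thesis using t(2)[OF that] by simp
  qed
  ultimately show ?case using s(1) p by (intro exI[of _ s]) auto
qed

section \<open>The body with a spike along each orbit point\<close>

text \<open>
  The body \<open>K\<close> and the choice of its parameters. The functional \<open>f\<close> separates \<open>x0\<close> from the rest of
  its orbit by \<open>\<eta>\<close>, and \<open>L\<close> and \<open>M\<close> bound \<open>f\<close> and the group. The radius \<open>\<rho>\<close> is such that \<open>f\<close>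
  deviates by at most \<open>\<eta> / 4\<close> from \<open>f (g x0)\<close> on the image under \<open>g\<close> of the ball around \<open>x0\<close>. The size \<open>\<tau>\<close> of the cluster
  around \<open>2 x0\<close> is chosen last, as \<open>R\<close> and \<open>\<rho> / 2\<close> will be the radii of balls containing \<open>K\<close> and
  contained in \<open>K\<close>, and the distortion \<open>R / (\<rho> / 2)\<close> of isometries of \<open>K\<close> must not enlarge the cluster to the
  scale \<open>\<rho> / (4 M)\<close> of the separation of \<open>U\<close> (\<open>\<tau>_sep\<close>); the last assumption lets \<open>f\<close> be tilted
  into a tangent functional at each cluster point without spoiling the estimates away from the cluster.
\<close>

locale spiked_body = bounded_group G M + norming_sequence h
  for G :: "('a::real_normed_vector \<Rightarrow> 'a) set" and M :: real and h :: "nat \<Rightarrow> 'a \<Rightarrow> real" +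
  fixes x0 :: 'a and f :: "'a \<Rightarrow> real" and L \<eta> \<rho> \<tau> R :: real and U :: "'a set" and k :: "nat \<Rightarrow> 'a"
  assumes minus_G: "uminus \<in> G"
    and f_bl: "bounded_linear f" and f_le: "\<bar>f v\<bar> \<le> L * norm v" and L_ge: "1 \<le> L"
    and f_x0: "f x0 = 1" and \<eta>_pos: "0 < \<eta>" and \<eta>_le: "\<eta> \<le> 1"
    and f_orbit: "g \<in> G \<Longrightarrow> g \<noteq> id \<Longrightarrow> f (g x0) \<le> 1 - \<eta>"
    and k_norm: "norm (k n) = 1" and k_ker: "f (k n) = 0"
    and k_dense: "norm v = 1 \<Longrightarrow> f v = 0 \<Longrightarrow> 0 < e \<Longrightarrow> \<exists>n. norm (v - k n) < e"
    and \<rho>_def: "\<rho> = \<eta> / (4 * L * M)"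
    and R_def: "R = M * (2 * norm x0 + 2)"
    and U_sub: "U \<subseteq> cball x0 \<rho>"
    and U_sep: "u \<in> U \<Longrightarrow> v \<in> U \<Longrightarrow> u \<noteq> v \<Longrightarrow> \<rho> / 4 \<le> norm (u - v)"
    and U_max: "x \<in> cball x0 \<rho> \<Longrightarrow> \<exists>u\<in>U. x = u \<or> norm (x - u) < \<rho> / 4"
    and \<tau>_pos: "0 < \<tau>" and \<tau>_x0: "norm x0 * \<tau> < 1 / 2" and \<tau>_small: "\<tau> < 1 / 4"
    and \<tau>_L: "2 * L * M * \<tau> < \<eta> / 8"
    and \<tau>_sep: "2 * R / (\<rho> / 2) * \<tau> < \<rho> / (4 * M)"
    and \<tau>_tilt: "2 * ((1 + L * norm x0) * R) * \<tau> < \<eta> / 8"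
begin

text \<open>
  The distances from \<open>z n\<close> to \<open>base\<close> decrease geometrically. The ratio \<open>\<theta>\<close> is a quarter of the
  inverse distortion of isometries, so an isometry fixing \<open>base\<close> cannot confuse two of these distances.
\<close>

definition \<theta> :: real where "\<theta> = (\<rho> / 2) / (4 * R)"
definition base :: 'a where "base = 2 *\<^sub>R x0"
definition w :: "nat \<Rightarrow> 'a" where "w n = (\<tau> * \<theta> ^ n) *\<^sub>R k n"
text \<open>
  The points \<open>z n\<close> lie on the paraboloid with apex \<open>2 x0\<close> over the kernel of \<open>f\<close>.
\<close>

definition z :: "nat \<Rightarrow> 'a" where "z n = base + w n - B (w n) (w n) *\<^sub>R x0"
definition Z :: "'a set" where "Z = insert base (range z)"
definition S :: "'a set" where "S = (\<Union>g\<in>G. g ` (Z \<union> U))"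
definition K :: "'a set" where "K = closure (convex hull S)"

lemma f_lin: "linear f" using f_bl by (rule bounded_linear.linear)

lemma M_pos: "0 < M" using M_ge by simp

lemma \<rho>_pos: "0 < \<rho>" and \<rho>_le: "\<rho> \<le> 1 / 4"
proof -
  have LM: "1 \<le> L * M" using mult_mono[OF L_ge M_ge] M_ge L_ge by simp
  then show "0 < \<rho>" using \<eta>_pos by (simp add: \<rho>_def mult.assoc)
  have "\<eta> / (4 * L * M) \<le> 1 / (4 * (L * M))" using \<eta>_le LM by (simp add: mult.assoc divide_right_mono)
  also have "\<dots> \<le> 1 / (4 * 1)" using LM by (intro divide_left_mono) auto
  finally show "\<rho> \<le> 1 / 4" by (simp add: \<rho>_def)
qed

lemma LM\<rho>: "L * M * \<rho> = \<eta> / 4"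
  using L_ge M_ge by (simp add: \<rho>_def)

lemma L\<rho>: "L * \<rho> \<le> \<eta> / 4"
proof -
  have "L * \<rho> \<le> L * \<rho> * M" using L_ge \<rho>_pos M_ge by (simp add: mult_left_le)
  then show ?thesis using LM\<rho> by (simp add: mult_ac)
qed

lemma R_ge: "2 \<le> R"
proof -
  have "1 * 2 \<le> M * (2 * norm x0 + 2)" using M_ge by (intro mult_mono) auto
  then show ?thesis by (simp add: R_def)
qed

lemma \<theta>_pos: "0 < \<theta>" and \<theta>_le: "\<theta> \<le> 1 / 4"
proof -
  show "0 < \<theta>" using \<rho>_pos R_ge by (simp add: \<theta>_def)
  have "\<rho> / 2 \<le> R" using \<rho>_le R_ge by simp
  then show "\<theta> \<le> 1 / 4" using R_ge by (simp add: \<theta>_def field_simps)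
qed

lemma norm_w: "norm (w n) = \<tau> * \<theta> ^ n"
  using k_norm \<tau>_pos \<theta>_pos by (simp add: w_def)

lemma norm_w_le: "norm (w n) \<le> \<tau>"
  using \<tau>_pos \<theta>_pos \<theta>_le by (simp add: norm_w power_le_one)

lemma f_w: "f (w n) = 0"
  using k_ker by (simp add: w_def linear_scale[OF f_lin])

lemma w_nonzero: "w n \<noteq> 0"
proof -
  have "0 < norm (w n)" using \<tau>_pos \<theta>_pos by (simp add: norm_w)
  then show ?thesis by auto
qed

lemma bump_le: "norm (B (w n) (w n) *\<^sub>R x0) \<le> norm (w n) / 2"
proof -
  have "\<bar>B (w n) (w n)\<bar> * norm x0 \<le> (norm (w n) * norm (w n)) * norm x0"
    by (intro mult_right_mono B_le) simp
  also have "\<dots> \<le> norm (w n) * (\<tau> * norm x0)"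
    using norm_w_le by (simp add: mult_left_mono mult_right_mono mult.assoc)
  also have "\<dots> \<le> norm (w n) * (1 / 2)"
    using \<tau>_x0 by (intro mult_left_mono) (simp_all add: mult.commute)
  finally show ?thesis by simp
qed

lemma z_dist: "norm (w n) / 2 \<le> norm (z n - base)" "norm (z n - base) \<le> 3 / 2 * norm (w n)"
proof -
  have eq: "z n - base = w n - B (w n) (w n) *\<^sub>R x0" by (simp add: z_def)
  show "norm (w n) / 2 \<le> norm (z n - base)"
    using bump_le[of n] norm_triangle_ineq2[of "w n" "B (w n) (w n) *\<^sub>R x0"] unfolding eq by linarith
  show "norm (z n - base) \<le> 3 / 2 * norm (w n)"
    using bump_le[of n] norm_triangle_ineq4[of "w n" "B (w n) (w n) *\<^sub>R x0"] unfolding eq by linarith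
qed

lemma z_neq_base: "z n \<noteq> base"
  using z_dist(1)[of n] w_nonzero[of n] by auto

lemma Z_near: "p \<in> Z \<Longrightarrow> norm (p - base) \<le> 2 * \<tau>"
proof -
  assume "p \<in> Z"
  then consider "p = base" | n where "p = z n" by (auto simp: Z_def)
  then show ?thesis
  proof cases
    case 2
    then show ?thesis using z_dist(2)[of n] norm_w_le[of n] \<tau>_pos by simp
  qed (use \<tau>_pos in simp)
qed

lemma f_base: "f base = 2" by (simp add: base_def linear_scale[OF f_lin] f_x0)

lemma f_near: "\<bar>f u - f v\<bar> \<le> L * norm (u - v)"
  using f_le[of "u - v"] by (simp add: linear_diff[OF f_lin])

lemma f_near_image: "g \<in> G \<Longrightarrow> \<bar>f (g u) - f (g v)\<bar> \<le> L * M * norm (u - v)"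
proof -
  assume g: "g \<in> G"
  have "\<bar>f (g u) - f (g v)\<bar> \<le> L * norm (g (u - v))"
    using f_near[of "g u" "g v"] by (simp add: linear_diff[OF lin[OF g]])
  also have "\<dots> \<le> L * (M * norm (u - v))" using L_ge by (intro mult_left_mono M_bound g) simp
  finally show ?thesis by (simp add: mult.assoc)
qed

lemma LM_Z: assumes "p \<in> Z" shows "L * M * norm (p - base) \<le> \<eta> / 8"
proof -
  have "L * M * norm (p - base) \<le> L * M * (2 * \<tau>)"
    using L_ge M_ge by (intro mult_left_mono Z_near assms) simp
  then show ?thesis using \<tau>_L by (simp add: mult_ac)
qed

lemma f_Z: assumes "p \<in> Z" shows "2 - \<eta> / 8 \<le> f p"
  using f_near_image[OF id_G, of p base] LM_Z[OF assms] f_base by simp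

lemma f_gZ: assumes "p \<in> Z" "g \<in> G" "g \<noteq> id" shows "f (g p) \<le> 2 - 15 / 8 * \<eta>"
proof -
  have "f (g base) = 2 * f (g x0)"
    by (simp add: base_def linear_scale[OF f_lin] linear_scale[OF lin[OF assms(2)]])
  then show ?thesis
    using f_near_image[OF assms(2), of p base] LM_Z[OF assms(1)] f_orbit[OF assms(2,3)] by simp
qed

lemma U_norm: "u \<in> U \<Longrightarrow> norm (u - x0) \<le> \<rho>"
  using U_sub by (auto simp: dist_norm norm_minus_commute)

lemma f_gU_near: assumes "u \<in> U" "g \<in> G" shows "\<bar>f (g u) - f (g x0)\<bar> \<le> \<eta> / 4"
proof -
  have "\<bar>f (g u) - f (g x0)\<bar> \<le> L * M * norm (u - x0)" by (rule f_near_image[OF assms(2)])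
  also have "\<dots> \<le> L * M * \<rho>" using L_ge M_ge by (intro mult_left_mono U_norm assms) simp
  finally show ?thesis by (simp add: LM\<rho>)
qed

lemma f_gU: assumes "u \<in> U" "g \<in> G" shows "f (g u) \<le> 1 + \<eta> / 4"
proof -
  have "f (g x0) \<le> 1"
    using f_orbit[OF assms(2)] f_x0 \<eta>_pos by (cases "g = id") auto
  then show ?thesis using f_gU_near[OF assms] by linarith
qed

lemma S_far: assumes "s \<in> S" "s \<notin> Z" shows "f s \<le> 2 - \<eta> / 2"
proof -
  obtain g p where gp: "g \<in> G" "s = g p" "p \<in> Z \<union> U" using assms(1) by (auto simp: S_def)
  show ?thesis
  proof (cases "p \<in> U")
    case True
    then show ?thesis using f_gU[OF True gp(1)] \<eta>_le by (simp add: gp(2))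
  next
    case False
    then have p: "p \<in> Z" using gp(3) by simp
    then have "g \<noteq> id" using assms(2) gp(2) by auto
    then show ?thesis using f_gZ[OF p gp(1)] \<eta>_pos by (simp add: gp(2))
  qed
qed

text \<open>
  Two distinct points of \<open>S\<close> at distance less than \<open>\<rho> / 4\<close>, one of them in \<open>Z \<union> U\<close>, both belong to \<open>Z\<close>.
  Apart from two points of \<open>U\<close>, which are separated by construction, all other
  combinations are excluded by the values of \<open>f\<close>, which are near \<open>2\<close> on \<open>Z\<close>, near \<open>1\<close> on \<open>U\<close>, at most
  about \<open>1\<close> on the translates of \<open>U\<close>, and smaller by at least \<open>\<eta> / 2\<close> on the nontrivial translates of
  \<open>U\<close> or \<open>Z\<close> than on the set itself.
\<close>

lemma close_points:
  assumes s: "s \<in> Z \<union> U" "s' \<in> Z \<union> U" and g: "g \<in> G" and ne: "g s' \<noteq> s" and near: "norm (s - g s') < \<rho> / 4"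
  shows "s \<in> Z \<and> s' \<in> Z \<and> g = id"
proof -
  have fs: "\<bar>f s - f (g s')\<bar> < \<eta> / 4"
  proof -
    have "\<bar>f s - f (g s')\<bar> \<le> L * norm (s - g s')" by (rule f_near)
    moreover have "L * norm (s - g s') \<le> L * (\<rho> / 4)" using near L_ge by (intro mult_left_mono) auto
    ultimately show ?thesis using L\<rho> \<eta>_pos by simp
  qed
  \<comment> \<open>For \<open>s \<in> U\<close> and \<open>s' \<in> Z\<close> there is no lower bound for \<open>f (g s')\<close>, but one for \<open>f s'\<close>.\<close>
  have gfs: "\<bar>f (inv g s) - f s'\<bar> < \<eta> / 4"
  proof -
    have "\<bar>f (inv g s) - f (inv g (g s'))\<bar> \<le> L * M * norm (s - g s')" by (rule f_near_image[OF inv_G[OF g]])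
    also have "\<dots> \<le> L * M * (\<rho> / 4)" using near L_ge M_ge by (intro mult_left_mono) auto
    finally show ?thesis using LM\<rho> \<eta>_pos by (simp add: inv_left[OF g])
  qed
  have inv_ne: "inv g \<noteq> id" if "g \<noteq> id" using that inv_right[OF g] by fastforce
  consider "s \<in> Z" "s' \<in> Z" | "s \<in> Z" "s' \<in> U" | "s \<in> U" "s' \<in> Z" | "s \<in> U" "s' \<in> U" using s by blast
  then show ?thesis
  proof cases
    case 1
    have "g = id"
    proof (rule ccontr)
      assume "g \<noteq> id"
      then show False using f_Z[OF 1(1)] f_gZ[OF 1(2) g] fs \<eta>_pos by simp
    qed
    then show ?thesis using 1 by simp
  next
    case 2
    then show ?thesis using f_Z[OF 2(1)] f_gU[OF 2(2) g] fs \<eta>_pos \<eta>_le by simp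
  next
    case 3
    then show ?thesis using f_Z[OF 3(2)] f_gU[OF 3(1) inv_G[OF g]] gfs \<eta>_pos \<eta>_le by simp
  next
    case 4
    show ?thesis
    proof (cases "g = id")
      case True
      then show ?thesis using U_sep[OF 4] ne near by simp
    next
      case False
      then show ?thesis
        using f_gU_near[OF 4(1) id_G] f_gU_near[OF 4(2) g] f_orbit[OF g False] f_x0 fs \<eta>_pos by simp
    qed
  qed
qed

lemma S_group: "s \<in> S \<Longrightarrow> g \<in> G \<Longrightarrow> g s \<in> S"
proof -
  assume "s \<in> S" "g \<in> G"
  then obtain h' p where "h' \<in> G" "s = h' p" "p \<in> Z \<union> U" by (auto simp: S_def)
  then have "g s = (g \<circ> h') p" "g \<circ> h' \<in> G" "p \<in> Z \<union> U" using comp_G[OF \<open>g \<in> G\<close>] by auto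
  then show ?thesis unfolding S_def by blast
qed

lemma S_cluster:
  assumes s: "s \<in> Z \<union> U" and p: "p \<in> S" and near: "norm (s - p) < \<rho> / 4" and ne: "p \<noteq> s"
  shows "s \<in> Z \<and> p \<in> Z"
proof -
  obtain g s' where g: "g \<in> G" "p = g s'" "s' \<in> Z \<union> U" using p by (auto simp: S_def)
  then have "s \<in> Z \<and> s' \<in> Z \<and> g = id" using close_points[OF s g(3) g(1)] near ne by auto
  then show ?thesis using g(2) by simp
qed

lemma ZU_sub_S: "Z \<union> U \<subseteq> S"
proof -
  have "Z \<union> U = id ` (Z \<union> U)" by simp
  then show ?thesis using id_G unfolding S_def by blast
qed

lemma z_tendsto: "z \<longlonglongrightarrow> base"
proof -
  have "(\<lambda>n. \<theta> ^ n) \<longlonglongrightarrow> 0" using \<theta>_pos \<theta>_le by (intro LIMSEQ_power_zero) simp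
  then have lim: "(\<lambda>n. 3 / 2 * (\<tau> * \<theta> ^ n)) \<longlonglongrightarrow> 0"
    using tendsto_mult_left[of "\<lambda>n. \<theta> ^ n" 0 sequentially "3 / 2 * \<tau>"] by (simp add: mult.assoc)
  have "(\<lambda>n. z n - base) \<longlonglongrightarrow> 0"
    by (rule Lim_null_comparison[OF always_eventually lim]) (use z_dist(2) norm_w in metis)
  then show ?thesis by (simp add: LIM_zero_iff)
qed

lemma compact_Z: "compact Z"
  unfolding Z_def by (rule compact_insert_limit_range[OF z_tendsto])

text \<open>
  By \<open>S_cluster\<close>, a convergent sequence in \<open>S\<close> eventually stays in a translate of the compact set
  that consists of \<open>Z\<close> and one further point of \<open>S\<close>.
\<close>

lemma closed_S: "closed S"
  unfolding closed_sequential_limits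
proof (intro allI impI)
  fix x l assume "(\<forall>n. x n \<in> S) \<and> x \<longlonglongrightarrow> l"
  then have xS: "\<And>n. x n \<in> S" and lim: "x \<longlonglongrightarrow> l" by auto
  have "0 < \<rho> / (8 * M)" using \<rho>_pos M_pos by simp
  then obtain n0 where n0: "\<And>n. n0 \<le> n \<Longrightarrow> norm (x n - l) < \<rho> / (8 * M)"
    using lim unfolding LIMSEQ_iff by blast
  obtain g s where g: "g \<in> G" "x n0 = g s" "s \<in> Z \<union> U" using xS[of n0] by (auto simp: S_def)
  have near: "inv g (x n) \<in> insert s Z" if "n0 \<le> n" for n
  proof -
    have "norm (x n0 - x n) < \<rho> / (8 * M) + \<rho> / (8 * M)"
      using n0[OF order_refl] n0[OF that] norm_triangle_ineq4[of "x n0 - l" "x n - l"] by simp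
    also have "\<dots> = \<rho> / (4 * M)" using M_pos by (simp add: field_simps)
    finally have d: "norm (x n0 - x n) < \<rho> / (4 * M)" .
    have "norm (s - inv g (x n)) = norm (inv g (x n0 - x n))"
      by (simp add: linear_diff[OF lin[OF inv_G[OF g(1)]]] g(2) inv_left[OF g(1)])
    also have "\<dots> \<le> M * norm (x n0 - x n)" by (rule M_bound[OF inv_G[OF g(1)]])
    also have "\<dots> < M * (\<rho> / (4 * M))" using d M_pos by (intro mult_strict_left_mono)
    also have "\<dots> = \<rho> / 4" using M_pos by simp
    finally show ?thesis using S_cluster[OF g(3) S_group[OF xS inv_G[OF g(1)]]] by blast
  qed
  have cl: "closed (insert s Z)" using compact_imp_closed[OF compact_Z] by (rule closed_insert)
  have lim': "(\<lambda>n. inv g (x (n + n0))) \<longlonglongrightarrow> inv g l"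
    using LIMSEQ_ignore_initial_segment[OF lim] by (rule bounded_linear.tendsto[OF bl[OF inv_G[OF g(1)]]])
  have "inv g l \<in> insert s Z" by (rule closed_sequentially[OF cl _ lim']) (rule near, simp)
  then have "inv g l \<in> S" using g(3) ZU_sub_S by blast
  from S_group[OF this g(1)] show "l \<in> S" by (simp add: inv_right[OF g(1)])
qed

lemma S_bounded: "S \<subseteq> cball 0 R"
proof
  fix s assume "s \<in> S"
  then obtain g p where g: "g \<in> G" "s = g p" "p \<in> Z \<union> U" by (auto simp: S_def)
  have "norm p \<le> 2 * norm x0 + 2"
  proof (cases "p \<in> Z")
    case True
    have "norm p \<le> norm (p - base) + norm base" using norm_triangle_ineq[of "p - base" base] by simp
    then show ?thesis using Z_near[OF True] \<tau>_small by (simp add: base_def)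
  next
    case False
    then have "norm (p - x0) \<le> \<rho>" using g(3) U_norm by blast
    moreover have "norm p \<le> norm (p - x0) + norm x0" using norm_triangle_ineq[of "p - x0" x0] by simp
    ultimately show ?thesis using \<rho>_le norm_ge_zero[of x0] by linarith
  qed
  then have "M * norm p \<le> R" using M_pos unfolding R_def by (intro mult_left_mono) auto
  then show "s \<in> cball 0 R" using M_bound[OF g(1), of p] by (simp add: g(2))
qed

text \<open>
  If a functional \<open>F\<close> separated \<open>x\<close> from \<open>K\<close>, then \<open>F x\<close> would bound \<open>F\<close> on \<open>U\<close> and on \<open>- U\<close>, hence up to an error
  of \<open>\<rho> / 4\<close> times the norm of \<open>F\<close> on the balls of radius \<open>\<rho>\<close> around \<open>x0\<close> and \<open>- x0\<close>. Adding the two estimates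
  bounds the norm of \<open>F\<close> by three quarters of itself.
\<close>

lemma ball_sub_K: "cball 0 (\<rho> / 2) \<subseteq> K"
proof
  fix x :: 'a assume "x \<in> cball 0 (\<rho> / 2)"
  then have x: "norm x \<le> \<rho> / 2" by simp
  show "x \<in> K"
  proof (rule ccontr)
    assume "x \<notin> K"
    moreover have "convex K" "closed K" by (simp_all add: K_def convex_closure)
    moreover have SK: "S \<subseteq> K" unfolding K_def by (rule subset_closed_convex_hull)
    moreover have "base \<in> S" using ZU_sub_S by (auto simp: Z_def)
    ultimately have "\<exists>F d. bounded_linear F \<and> (\<forall>v. \<bar>F v\<bar> \<le> norm v) \<and> 0 < d \<and> (\<forall>c\<in>K. F c + d \<le> F x)"
      by (intro point_closed_convex_separation) auto
    then obtain F :: "'a \<Rightarrow> real" and d where F: "bounded_linear F" "0 < d" and Fc: "\<forall>c\<in>K. F c + d \<le> F x"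
      by blast
    have lF: "linear F" by (rule bounded_linear.linear[OF F(1)])
    define N where "N = onorm F"
    have FN: "\<bar>F v\<bar> \<le> N * norm v" for v using onorm[OF F(1), of v] by (simp add: N_def)
    have N0: "0 \<le> N" unfolding N_def by (rule onorm_pos_le[OF F(1)])
    have Fx: "F x \<le> N * (\<rho> / 2)"
      using FN[of x] mult_left_mono[OF x N0] by linarith
    have near: "\<exists>u\<in>U. \<bar>F y - F u\<bar> \<le> N * (\<rho> / 4)" if y: "y \<in> cball x0 \<rho>" for y
    proof -
      obtain u where u: "u \<in> U" "y = u \<or> norm (y - u) < \<rho> / 4" using U_max[OF y] by blast
      then have "norm (y - u) \<le> \<rho> / 4" using \<rho>_pos by auto
      then have "N * norm (y - u) \<le> N * (\<rho> / 4)" using N0 by (intro mult_left_mono)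
      moreover have "\<bar>F y - F u\<bar> \<le> N * norm (y - u)" using FN[of "y - u"] by (simp add: linear_diff[OF lF])
      ultimately have "\<bar>F y - F u\<bar> \<le> N * (\<rho> / 4)" by linarith
      then show ?thesis using u(1) by blast
    qed
    have unit: "F v \<le> 3 / 4 * N" if v: "norm v \<le> 1" for v
    proof -
      have rv: "norm (\<rho> *\<^sub>R v) \<le> \<rho>" using mult_left_le[OF v, of \<rho>] \<rho>_pos by simp
      obtain u where u: "u \<in> U" "\<bar>F (x0 + \<rho> *\<^sub>R v) - F u\<bar> \<le> N * (\<rho> / 4)"
        using near[of "x0 + \<rho> *\<^sub>R v"] rv by (auto simp: dist_norm)
      obtain u' where u': "u' \<in> U" "\<bar>F (x0 - \<rho> *\<^sub>R v) - F u'\<bar> \<le> N * (\<rho> / 4)"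
        using near[of "x0 - \<rho> *\<^sub>R v"] rv by (auto simp: dist_norm)
      have US: "u \<in> S" "u' \<in> S" using u(1) u'(1) ZU_sub_S by blast+
      then have "u \<in> K" "- u' \<in> K" using S_group[OF US(2) minus_G] subsetD[OF SK] by blast+
      then have "F u + d \<le> F x" "F (- u') + d \<le> F x" using Fc by blast+
      then have "F u \<le> F x" "F (- u') \<le> F x" using F(2) by linarith+
      moreover have "F (x0 + \<rho> *\<^sub>R v) = F x0 + \<rho> * F v" "F (x0 - \<rho> *\<^sub>R v) = F x0 - \<rho> * F v" "F (- u') = - F u'"
        by (simp_all add: linear_add[OF lF] linear_diff[OF lF] linear_scale[OF lF] linear_neg[OF lF])
      ultimately have "2 * (\<rho> * F v) \<le> 2 * F x + 2 * (N * (\<rho> / 4))" using u(2) u'(2) by linarith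
      then have "\<rho> * F v \<le> \<rho> * (3 / 4 * N)" using Fx by (simp add: algebra_simps)
      then show ?thesis using \<rho>_pos by simp
    qed
    have "norm (F v) \<le> 3 / 4 * N * norm v" for v
    proof (cases "v = 0")
      case False
      have "F (c *\<^sub>R v) \<le> 3 / 4 * N" if "\<bar>c\<bar> = 1 / norm v" for c
        using False that by (intro unit) simp
      from this[of "1 / norm v"] this[of "- 1 / norm v"] have "\<bar>F v / norm v\<bar> \<le> 3 / 4 * N"
        by (simp add: linear_scale[OF lF] linear_neg[OF lF])
      then show ?thesis using False by (simp add: field_simps)
    qed (simp add: linear_0[OF lF])
    then have "N \<le> 3 / 4 * N" unfolding N_def using N0 by (intro onorm_bound) (simp_all add: N_def)
    then have "N = 0" using N0 by simp
    then have "F v = 0" for v using FN[of v] by simp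
    moreover have "F base + d \<le> F x" using Fc SK \<open>base \<in> S\<close> by blast
    ultimately show False using F(2) by simp
  qed
qed

lemma K_group: assumes g: "g \<in> G" shows "g ` K \<subseteq> K"
proof -
  have "g ` (convex hull S) = convex hull (g ` S)" by (rule convex_hull_linear_image[OF lin[OF g]])
  also have "\<dots> \<subseteq> convex hull S" using S_group[OF _ g] by (intro hull_mono) blast
  finally have "closure (g ` (convex hull S)) \<subseteq> K" unfolding K_def by (rule closure_mono)
  then show ?thesis
    using closure_bounded_linear_image_subset[OF bl[OF g], of "convex hull S"] unfolding K_def by blast
qed

sublocale body: symmetric_convex_body K "\<rho> / 2" R
proof
  show "convex K" "closed K" by (simp_all add: K_def convex_closure)
  show "- x \<in> K" if "x \<in> K" for x using K_group[OF minus_G] that by blast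
  show "0 < \<rho> / 2" using \<rho>_pos by simp
  show "cball 0 (\<rho> / 2) \<subseteq> K" by (rule ball_sub_K)
  show "K \<subseteq> cball 0 R" unfolding K_def
    by (intro closure_minimal hull_minimal S_bounded) auto
qed

abbreviation Isom where "Isom \<equiv> isometry_group (minkowski_gauge K)"

lemma G_sub_Isom: "g \<in> G \<Longrightarrow> g \<in> Isom"
  unfolding isometry_group_def using lin bij
  by (auto simp: bij_is_surj inv_left intro!: body.gauge_invariant[where h = "inv g"] K_group inv_G)

text \<open>
  The projection onto the kernel of \<open>f\<close> along \<open>x0\<close>. It recovers \<open>w n\<close> from \<open>z n\<close>.
\<close>

definition \<pi> :: "'a \<Rightarrow> 'a" where "\<pi> v = v - f v *\<^sub>R x0"

lemma \<pi>_bl: "bounded_linear \<pi>"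
  unfolding \<pi>_def
  by (intro bounded_linear_sub bounded_linear_ident bounded_linear_compose[OF bounded_linear_scaleR_left f_bl])

lemma \<pi>_norm: "norm (\<pi> v) \<le> (1 + L * norm x0) * norm v"
proof -
  have "norm (\<pi> v) \<le> norm v + \<bar>f v\<bar> * norm x0" unfolding \<pi>_def using norm_triangle_ineq4[of v "f v *\<^sub>R x0"] by simp
  also have "\<bar>f v\<bar> * norm x0 \<le> L * norm v * norm x0" using f_le by (intro mult_right_mono) auto
  finally show ?thesis by (simp add: algebra_simps)
qed

lemma f_z: "f (z n) = 2 - B (w n) (w n)"
  by (simp add: z_def linear_add[OF f_lin] linear_diff[OF f_lin] linear_scale[OF f_lin] f_base f_w f_x0)

lemma \<pi>_base: "\<pi> base = 0"
  by (simp add: \<pi>_def f_base) (simp add: base_def)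

lemma \<pi>_z: "\<pi> (z n) = w n"
  by (simp add: \<pi>_def f_z) (simp add: z_def base_def algebra_simps)

lemma base_exposed: "strongly_exposed S f base"
proof (rule strongly_exposed_compact_part[OF compact_Z])
  show "Z \<subseteq> S" using ZU_sub_S by blast
  show "base \<in> Z" by (simp add: Z_def)
  show "continuous_on UNIV f" by (rule bounded_linear.continuous_on[OF f_bl continuous_on_id])
  show "0 < \<eta> / 2" using \<eta>_pos by simp
  show "f s \<le> f base - \<eta> / 2" if "s \<in> S" "s \<notin> Z" for s using S_far[OF that] by (simp add: f_base)
  fix p assume "p \<in> Z" "p \<noteq> base"
  then obtain n where "p = z n" by (auto simp: Z_def)
  then show "f p < f base" using B_pos[OF w_nonzero[of n]] by (simp add: f_z f_base)
qed

text \<open>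
  The functional \<open>\<phi>\<close> is the tangent of the paraboloid at \<open>z n\<close>: at another point of the paraboloid it is
  smaller by \<open>B (w n - w m) (w n - w m)\<close>.
\<close>

lemma z_exposed: "\<exists>\<phi>. bounded_linear \<phi> \<and> strongly_exposed S \<phi> (z n)"
proof -
  define \<phi> where "\<phi> v = f v + 2 * B (w n) (\<pi> v)" for v
  have \<phi>_bl: "bounded_linear \<phi>" unfolding \<phi>_def
    by (intro bounded_linear_add f_bl bounded_linear_const_mult bounded_linear_compose[OF B_bounded_linear \<pi>_bl])
  have \<phi>_z: "\<phi> (z m) = 2 + B (w n) (w n) - B (w n - w m) (w n - w m)" for m
    by (simp add: \<phi>_def f_z \<pi>_z B_diff)
  have \<phi>_base: "\<phi> base = 2" using linear_0[OF bounded_linear.linear[OF B_bounded_linear]]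
    by (simp add: \<phi>_def f_base \<pi>_base)
  have zn: "\<phi> (z n) = 2 + B (w n) (w n)"
    using \<phi>_z[of n] linear_0[OF bounded_linear.linear[OF B_bounded_linear]] by simp
  have "strongly_exposed S \<phi> (z n)"
  proof (rule strongly_exposed_compact_part[OF compact_Z])
    show "Z \<subseteq> S" using ZU_sub_S by blast
    show "z n \<in> Z" by (simp add: Z_def)
    show "continuous_on UNIV \<phi>" by (rule bounded_linear.continuous_on[OF \<phi>_bl continuous_on_id])
    show "0 < \<eta> / 4" using \<eta>_pos by simp
    show "\<phi> s \<le> \<phi> (z n) - \<eta> / 4" if s: "s \<in> S" "s \<notin> Z" for s
    proof -
      have "B (w n) (\<pi> s) \<le> norm (w n) * norm (\<pi> s)" using B_le[of "w n" "\<pi> s"] by simp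
      also have "\<dots> \<le> \<tau> * ((1 + L * norm x0) * R)"
      proof (intro mult_mono norm_w_le)
        have "norm s \<le> R" using s S_bounded by auto
        then have "(1 + L * norm x0) * norm s \<le> (1 + L * norm x0) * R"
          using L_ge by (intro mult_left_mono) auto
        then show "norm (\<pi> s) \<le> (1 + L * norm x0) * R" using \<pi>_norm[of s] by linarith
      qed (use \<tau>_pos in auto)
      finally have "B (w n) (\<pi> s) \<le> \<tau> * ((1 + L * norm x0) * R)" .
      moreover have "2 * (\<tau> * ((1 + L * norm x0) * R)) < \<eta> / 8" using \<tau>_tilt by (simp only: mult_ac)
      ultimately have "2 * B (w n) (\<pi> s) \<le> \<eta> / 8" by linarith
      then show ?thesis using S_far[OF s] B_pos[OF w_nonzero[of n]] \<eta>_pos zn unfolding \<phi>_def by linarith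
    qed
    fix p assume p: "p \<in> Z" "p \<noteq> z n"
    then consider "p = base" | m where "p = z m" by (auto simp: Z_def)
    then show "\<phi> p < \<phi> (z n)"
    proof cases
      case 1
      then show ?thesis using B_pos[OF w_nonzero[of n]] by (simp add: zn \<phi>_base)
    next
      case 2
      then have "w n - w m \<noteq> 0" using p(2) by (auto simp: z_def)
      from B_pos[OF this] show ?thesis unfolding 2 using zn \<phi>_z[of m] by linarith
    qed
  qed
  then show ?thesis using \<phi>_bl by blast
qed

lemma isometry_Z_in_S:
  assumes T: "T \<in> Isom" and p: "p \<in> Z"
  shows "T p \<in> S"
proof -
  obtain \<phi> where \<phi>: "bounded_linear \<phi>" "strongly_exposed S \<phi> p"
    using p base_exposed z_exposed f_bl by (auto simp: Z_def)
  have "strongly_exposed K \<phi> p" unfolding K_def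
    by (rule strongly_exposed_closed_convex_hull[OF \<phi>(1) S_bounded \<phi>(2)])
  then obtain \<psi> where "bounded_linear \<psi>" "strongly_exposed K \<psi> (T p)"
    using body.isometry_strongly_exposed[OF T \<phi>(1)] by blast
  then have "T p \<in> closure S" unfolding K_def by (rule strongly_exposed_in_closure)
  then show ?thesis using closed_S by simp
qed

text \<open>
  The images of the points of \<open>Z\<close> lie in \<open>S\<close>, closer than \<open>\<rho> / (4 M)\<close> to the image of \<open>base\<close>. As
  there is more than one of them, \<open>S_cluster\<close> leaves no possibility but a common translate of \<open>Z\<close>.
\<close>

lemma isometry_maps_cluster:
  assumes T: "T \<in> Isom"
  shows "\<exists>g\<in>G. \<forall>p\<in>Z. inv g (T p) \<in> Z"
proof -
  have baseZ: "base \<in> Z" by (simp add: Z_def)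
  obtain g s where g: "g \<in> G" "T base = g s" "s \<in> Z \<union> U"
    using isometry_Z_in_S[OF T baseZ] by (auto simp: S_def)
  have lT: "linear T" using T by (simp add: isometry_group_def)
  have key: "s \<in> Z \<and> inv g (T p) \<in> Z" if p: "p \<in> Z" "p \<noteq> base" for p
  proof -
    have "norm (T (base - p)) \<le> R / (\<rho> / 2) * norm (base - p)" by (rule body.isometry_bound(1)[OF T])
    also have "\<dots> \<le> R / (\<rho> / 2) * (2 * \<tau>)" using Z_near[OF p(1)] R_ge \<rho>_pos
      by (intro mult_left_mono) (auto simp: norm_minus_commute)
    also have "\<dots> < \<rho> / (4 * M)" using \<tau>_sep by (simp add: mult_ac)
    finally have d: "norm (T base - T p) < \<rho> / (4 * M)" by (simp add: linear_diff[OF lT])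
    have "norm (s - inv g (T p)) = norm (inv g (T base - T p))"
      by (simp add: linear_diff[OF lin[OF inv_G[OF g(1)]]] g(2) inv_left[OF g(1)])
    also have "\<dots> \<le> M * norm (T base - T p)" by (rule M_bound[OF inv_G[OF g(1)]])
    also have "\<dots> < M * (\<rho> / (4 * M))" using d M_pos by (intro mult_strict_left_mono)
    also have "\<dots> = \<rho> / 4" using M_pos by simp
    finally have near: "norm (s - inv g (T p)) < \<rho> / 4" .
    have "inv g (T p) \<noteq> s"
    proof
      assume "inv g (T p) = s"
      then have "T p = T base" using inv_right[OF g(1), of "T p"] g(2) by simp
      then show False using injD[OF body.isometry_inj[OF T]] p(2) by blast
    qed
    then show ?thesis
      using S_cluster[OF g(3) S_group[OF isometry_Z_in_S[OF T p(1)] inv_G[OF g(1)]] near] by blast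
  qed
  have "s \<in> Z" using key[of "z 0"] z_neq_base by (auto simp: Z_def)
  then have "inv g (T base) \<in> Z" by (simp add: g(2) inv_left[OF g(1)])
  then show ?thesis using key g(1) by blast
qed

text \<open>
  No \<open>z j\<close> is an accumulation point of the cluster. For two different \<open>z m\<close> this is the triangle inequality
  through \<open>base\<close>, the nearer of the two being at most \<open>3/4\<close> as far from \<open>base\<close> as the other.
\<close>

lemma z_isolated: assumes p: "p \<in> Z" "p \<noteq> z j" shows "\<tau> * \<theta> ^ j / 8 \<le> norm (p - z j)"
proof -
  consider "p = base" | m where "p = z m" using p by (auto simp: Z_def)
  then show ?thesis
  proof cases
    case 1
    have "0 \<le> \<tau> * \<theta> ^ j" using \<tau>_pos \<theta>_pos by simp
    then show ?thesis using z_dist(1)[of j] by (simp add: 1 norm_w norm_minus_commute)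
  next
    case 2
    have step: "\<tau> * \<theta> ^ b \<le> \<tau> * \<theta> ^ a / 4" if "a < b" for a b
    proof -
      have "\<theta> ^ b \<le> \<theta> ^ Suc a" using that \<theta>_pos \<theta>_le by (intro power_decreasing) auto
      also have "\<dots> \<le> 1 / 4 * \<theta> ^ a" using \<theta>_pos \<theta>_le by (simp add: mult_right_mono)
      finally show ?thesis using \<tau>_pos by (simp add: field_simps)
    qed
    have far: "\<tau> * \<theta> ^ a / 8 \<le> norm (z a - z b)" if "a < b" for a b
    proof -
      have "norm (z a - base) \<le> norm (z a - z b) + norm (z b - base)"
        using norm_triangle_ineq[of "z a - z b" "z b - base"] by simp
      then show ?thesis using z_dist(1)[of a] z_dist(2)[of b] step[OF that] unfolding norm_w by linarith
    qed
    have "m \<noteq> j" using 2 p(2) by auto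
    then consider "m < j" | "j < m" by linarith
    then show ?thesis
    proof cases
      assume m: "m < j"
      have "0 \<le> \<tau> * \<theta> ^ m" using \<tau>_pos \<theta>_pos by simp
      then show ?thesis using far[OF m] step[OF m] unfolding 2 by linarith
    next
      assume "j < m"
      then show ?thesis using far[of j m] by (simp add: 2 norm_minus_commute)
    qed
  qed
qed

lemma \<theta>_scale: "R / (\<rho> / 2) * \<theta> = 1 / 4"
  using R_ge \<rho>_pos by (simp add: \<theta>_def)

text \<open>
  The only accumulation point \<open>base\<close> of \<open>Z\<close> is fixed, as \<open>T\<close> is injective and continuous. Then \<open>z n\<close> can
  only go to a point at a distance from \<open>base\<close> of the same order of magnitude, that is, to itself. By linearity
  \<open>T\<close> fixes \<open>x0\<close>, the vectors \<open>w n\<close> and the directions \<open>k n\<close>.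
\<close>

lemma isometry_fixing_cluster:
  assumes T: "T \<in> Isom" and TZ: "\<And>p. p \<in> Z \<Longrightarrow> T p \<in> Z"
  shows "T = id"
proof -
  have lT: "linear T" using T by (simp add: isometry_group_def)
  note inj = injD[OF body.isometry_inj[OF T]]
  define c where "c = R / (\<rho> / 2)"
  have c: "0 < c" "c * \<theta> = 1 / 4" using R_ge \<rho>_pos \<theta>_scale by (auto simp: c_def)
  have bd: "norm (T v) \<le> c * norm v" "norm v \<le> c * norm (T v)" for v
    unfolding c_def using body.isometry_bound[OF T] by auto
  have Tbase: "T base = base"
  proof (rule ccontr)
    assume "T base \<noteq> base"
    moreover have "T base \<in> Z" by (rule TZ) (simp add: Z_def)
    ultimately obtain j where j: "T base = z j" by (auto simp: Z_def)
    \<comment> \<open>The image of this point would be a cluster point too close to \<open>z j\<close>; the factor \<open>\<theta>^2\<close> absorbs the distortion.\<close>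
    let ?n = "j + 2"
    have "T (z ?n) \<noteq> z j" using inj[of "z ?n" base] z_neq_base j by auto
    moreover have "T (z ?n) \<in> Z" by (rule TZ) (simp add: Z_def)
    ultimately have "\<tau> * \<theta> ^ j / 8 \<le> norm (T (z ?n) - z j)" by (intro z_isolated)
    also have "\<dots> = norm (T (z ?n - base))" by (simp add: linear_diff[OF lT] j)
    also have "\<dots> \<le> c * (3 / 2 * (\<tau> * \<theta> ^ ?n))"
      using bd(1)[of "z ?n - base"] z_dist(2)[of ?n] c(1) unfolding norm_w
      by (meson less_imp_le mult_left_mono order_trans)
    also have "\<dots> = 3 / 2 * (c * \<theta>) * \<theta> * (\<tau> * \<theta> ^ j)" by (simp add: power_add power2_eq_square)
    also have "\<dots> \<le> 3 / 2 * (1 / 4) * (1 / 4) * (\<tau> * \<theta> ^ j)"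
      unfolding c(2) using \<theta>_le \<theta>_pos \<tau>_pos by (intro mult_right_mono mult_left_mono) auto
    finally show False using \<tau>_pos \<theta>_pos by simp
  qed
  have Tz: "T (z n) = z n" for n
  proof -
    have "T (z n) \<in> Z" by (rule TZ) (simp add: Z_def)
    moreover have "T (z n) \<noteq> base" using inj[of "z n" base] z_neq_base Tbase by auto
    ultimately obtain m where m: "T (z n) = z m" by (auto simp: Z_def)
    have Td: "T (z n - base) = z m - base" by (simp add: linear_diff[OF lT] m Tbase)
    have scale: "a \<le> b" if le: "norm (z b - base) \<le> c * norm (z a - base)" for a b
    proof (rule ccontr)
      assume "\<not> a \<le> b"
      then have "\<theta> ^ a \<le> \<theta> ^ Suc b" using \<theta>_pos \<theta>_le by (intro power_decreasing) auto
      then have "c * \<theta> ^ a \<le> c * \<theta> * \<theta> ^ b" using c(1) by simp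
      then have *: "c * \<theta> ^ a \<le> 1 / 4 * \<theta> ^ b" unfolding c(2) .
      have "\<tau> * \<theta> ^ b / 2 \<le> c * (3 / 2 * (\<tau> * \<theta> ^ a))"
        using le z_dist(1)[of b] z_dist(2)[of a] c(1) unfolding norm_w
        by (meson less_imp_le mult_left_mono order_trans)
      also have "\<dots> = 3 / 2 * \<tau> * (c * \<theta> ^ a)" by simp
      also have "\<dots> \<le> 3 / 2 * \<tau> * (1 / 4 * \<theta> ^ b)" using * \<tau>_pos by (intro mult_left_mono) auto
      finally show False using \<tau>_pos \<theta>_pos by simp
    qed
    have "n \<le> m" using bd(1)[of "z n - base"] unfolding Td by (rule scale)
    moreover have "m \<le> n" using bd(2)[of "z n - base"] unfolding Td by (rule scale)
    ultimately show ?thesis using m by simp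
  qed
  have "T base = 2 *\<^sub>R T x0" by (simp add: base_def linear_scale[OF lT])
  then have "2 *\<^sub>R T x0 = 2 *\<^sub>R x0" using Tbase by (simp add: base_def)
  then have Tx0: "T x0 = x0" by simp
  have Tk: "T (k n) = k n" for n
  proof -
    have w: "w n = z n - base + B (w n) (w n) *\<^sub>R x0" by (simp add: z_def)
    have "T (w n) = w n"
      by (subst (1 2) w) (simp add: linear_add[OF lT] linear_diff[OF lT] linear_scale[OF lT] Tbase Tz Tx0)
    then have "(\<tau> * \<theta> ^ n) *\<^sub>R T (k n) = (\<tau> * \<theta> ^ n) *\<^sub>R k n" by (simp add: w_def linear_scale[OF lT])
    then show ?thesis using \<tau>_pos \<theta>_pos by simp
  qed
  have Tunit: "T v = v" if v: "norm v = 1" "f v = 0" for v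
  proof -
    have small: "norm (T v - v) \<le> e" if e: "0 < e" for e
    proof -
      have "0 < e / (c + 1)" using e c by simp
      then obtain n where n: "norm (v - k n) < e / (c + 1)" using k_dense[OF v] by blast
      have "T v - v = T (v - k n) - (v - k n)" by (simp add: linear_diff[OF lT] Tk)
      then have "norm (T v - v) \<le> norm (T (v - k n)) + norm (v - k n)" using norm_triangle_ineq4 by metis
      also have "\<dots> \<le> c * norm (v - k n) + norm (v - k n)" using bd(1) by simp
      also have "\<dots> = (c + 1) * norm (v - k n)" by (simp add: algebra_simps)
      also have "\<dots> \<le> (c + 1) * (e / (c + 1))" using n c(1) by (intro mult_left_mono) auto
      also have "\<dots> = e" using c(1) by simp
      finally show ?thesis .
    qed
    have "norm (T v - v) \<le> 0"
    proof (rule field_le_epsilon)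
      fix e :: real assume "0 < e"
      from small[OF this] show "norm (T v - v) \<le> 0 + e" by (simp only: add_0)
    qed
    then show ?thesis by simp
  qed
  have Tker: "T v = v" if v: "f v = 0" for v
  proof (cases "v = 0")
    case True then show ?thesis by (simp add: linear_0[OF lT])
  next
    case False
    have "T ((1 / norm v) *\<^sub>R v) = (1 / norm v) *\<^sub>R v"
      using False v by (intro Tunit) (simp_all add: linear_scale[OF f_lin])
    then show ?thesis using False by (simp add: linear_scale[OF lT])
  qed
  have "T v = v" for v
  proof -
    have "f (v - f v *\<^sub>R x0) = 0" by (simp add: linear_diff[OF f_lin] linear_scale[OF f_lin] f_x0)
    then have "T (v - f v *\<^sub>R x0) = v - f v *\<^sub>R x0" by (rule Tker)
    then show ?thesis by (simp add: linear_diff[OF lT] linear_scale[OF lT] Tx0)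
  qed
  then show ?thesis by auto
qed

lemma equivalent_norm_gauge_K: "equivalent_norm (minkowski_gauge K)"
  by (rule body.equivalent_norm_gauge)

theorem isometry_group_eq: "isometry_group (minkowski_gauge K) = G"
proof
  show "G \<subseteq> Isom" using G_sub_Isom by blast
  show "Isom \<subseteq> G"
  proof
    fix T assume T: "T \<in> Isom"
    obtain g where g: "g \<in> G" "\<And>p. p \<in> Z \<Longrightarrow> inv g (T p) \<in> Z" using isometry_maps_cluster[OF T] by blast
    have ig: "inv g \<in> Isom" by (rule G_sub_Isom[OF inv_G[OF g(1)]])
    have "inv g \<circ> T \<in> Isom"
      using T ig linear_compose[of T "inv g"] comp_surj[of T "inv g"] by (simp add: isometry_group_def)
    then have "inv g \<circ> T = id" using g(2) by (intro isometry_fixing_cluster) simp_all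
    then have "T x = g x" for x using inv_right[OF g(1), of "T x"] by (metis comp_apply id_apply)
    then have "T = g" by auto
    then show "T \<in> G" using g(1) by simp
  qed
qed

end

section \<open>The renorming\<close>

lemma equivalent_norm_norm: "equivalent_norm (norm :: 'a::real_normed_vector \<Rightarrow> real)"
proof -
  have "is_norm (norm :: 'a \<Rightarrow> real)" by (simp add: is_norm_def norm_triangle_ineq)
  moreover have "1 * norm x \<le> norm x \<and> norm x \<le> 1 * norm x" for x :: 'a by simp
  ultimately show ?thesis unfolding equivalent_norm_def by (meson zero_less_one)
qed

text \<open>
  In dimension one \<open>f\<close> identifies linear maps with scalars. A group element other than \<open>Id\<close> and \<open>-Id\<close> would
  have a scalar of absolute value less than \<open>1\<close>, and so would its inverse.
\<close>

lemma (in bounded_group) one_dimensional: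
  assumes minus: "uminus \<in> G" and f: "linear f" "f x0 = 1" and all: "\<forall>v. v = f v *\<^sub>R x0"
    and \<eta>: "0 < (\<eta>::real)" and orbit: "\<forall>g\<in>G. g \<noteq> id \<longrightarrow> f (g x0) \<le> 1 - \<eta>"
  shows "G = isometry_group norm"
proof -
  have span: "v = f v *\<^sub>R x0" for v using all by blast
  have x0: "x0 \<noteq> 0" using f linear_0[OF f(1)] by auto
  have ext: "T = id \<or> T = uminus" if T: "linear T" "\<bar>f (T x0)\<bar> = 1" for T :: "'a \<Rightarrow> 'a"
  proof -
    have Tv: "T v = f (T x0) *\<^sub>R v" for v
    proof -
      have "T v = f v *\<^sub>R T x0" by (subst span[of v]) (rule linear_scale[OF T(1)])
      also have "\<dots> = f v *\<^sub>R f (T x0) *\<^sub>R x0" by (subst span[of "T x0"]) (rule refl)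
      also have "\<dots> = f (T x0) *\<^sub>R f v *\<^sub>R x0" by (rule scaleR_left_commute)
      also have "\<dots> = f (T x0) *\<^sub>R v" by (simp only: span[of v, symmetric])
      finally show ?thesis .
    qed
    consider "f (T x0) = 1" | "f (T x0) = - 1" using T(2) by linarith
    then show ?thesis
    proof cases
      case 1
      then have "T v = id v" for v using Tv[of v] by simp
      then show ?thesis by blast
    next
      case 2
      then have "T v = - v" for v using Tv[of v] by simp
      then show ?thesis by blast
    qed
  qed
  have small: "\<bar>f (g x0)\<bar> < 1" if g: "g \<in> G" "g \<noteq> id" "g \<noteq> uminus" for g
  proof -
    have "uminus \<circ> g \<noteq> id"
    proof
      assume "uminus \<circ> g = id"
      then have "g x = - x" for x by (metis comp_apply id_apply minus_minus)
      then show False using g(3) by blast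
    qed
    then have "f ((uminus \<circ> g) x0) \<le> 1 - \<eta>" using orbit comp_G[OF minus g(1)] by blast
    then have "- f (g x0) \<le> 1 - \<eta>" by (simp add: linear_neg[OF f(1)])
    moreover have "f (g x0) \<le> 1 - \<eta>" using orbit g by blast
    ultimately show ?thesis using \<eta> by simp
  qed
  have two: "g = id \<or> g = uminus" if g: "g \<in> G" for g
  proof (rule ccontr)
    assume no: "\<not> (g = id \<or> g = uminus)"
    have "inv g \<noteq> id" using no inv_right[OF g] by fastforce
    moreover have "inv g \<noteq> uminus"
    proof
      assume "inv g = uminus"
      then have "g (- x) = x" for x using inv_right[OF g, of x] by simp
      then have "g x = - x" for x by (metis minus_minus)
      then show False using no by blast
    qed
    ultimately have "\<bar>f (inv g x0)\<bar> < 1" by (intro small inv_G g)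
    moreover have "\<bar>f (g x0)\<bar> < 1" using no by (intro small g) auto
    ultimately have less: "\<bar>f (inv g x0)\<bar> * \<bar>f (g x0)\<bar> < 1 * 1" by (intro mult_strict_mono) auto
    have "x0 = g (f (inv g x0) *\<^sub>R x0)" using inv_right[OF g, of x0] span[of "inv g x0"] by simp
    also have "\<dots> = f (inv g x0) *\<^sub>R g x0" by (rule linear_scale[OF lin[OF g]])
    finally have "f x0 = f (inv g x0) * f (g x0)" using linear_scale[OF f(1)] by (metis real_scaleR_def)
    then have "\<bar>f (inv g x0)\<bar> * \<bar>f (g x0)\<bar> = 1" using f(2) by (simp add: abs_mult[symmetric])
    then show False using less by simp
  qed
  have id_iso: "id \<in> isometry_group (norm :: 'a \<Rightarrow> real)" by (simp add: isometry_group_def linear_id)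
  have minus_iso: "uminus \<in> isometry_group (norm :: 'a \<Rightarrow> real)"
    using lin[OF minus] by (simp add: isometry_group_def)
  show ?thesis
  proof
    show "G \<subseteq> isometry_group norm" using two id_iso minus_iso by blast
    show "isometry_group norm \<subseteq> G"
    proof
      fix T assume "T \<in> isometry_group (norm :: 'a \<Rightarrow> real)"
      then have T: "linear T" "norm (T x0) = norm x0" by (auto simp: isometry_group_def)
      have "norm (T x0) = \<bar>f (T x0)\<bar> * norm x0" by (subst span[of "T x0"]) simp
      then have "\<bar>f (T x0)\<bar> = 1" using T(2) x0 by simp
      then show "T \<in> G" using ext[OF T(1)] id_G minus by blast
    qed
  qed
qed

text \<open>
  The parameters of the body are chosen in the order \<open>L\<close>, \<open>\<rho>\<close>, \<open>R\<close>, \<open>U\<close>, \<open>\<tau>\<close>. A nonzero vector in the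
  kernel of \<open>f\<close> is what allows a cluster with infinitely many points.
\<close>

theorem renorming_higher_dimensional:
  fixes G :: "('a::{real_normed_vector, second_countable_topology} \<Rightarrow> 'a) set" and f :: "'a \<Rightarrow> real"
  assumes bg: "bounded_group G M" and minus: "uminus \<in> G"
    and f: "bounded_linear f" "f x0 = 1" and \<eta>: "0 < \<eta>" "\<eta> \<le> 1"
    and orbit: "\<forall>g\<in>G. g \<noteq> id \<longrightarrow> f (g x0) \<le> 1 - \<eta>"
    and v: "f v = 0" "v \<noteq> 0"
  shows "\<exists>N. equivalent_norm N \<and> G = isometry_group N"
proof -
  have M_ge: "1 \<le> M" using bg by (rule bounded_group.M_ge)
  note lf = bounded_linear.linear[OF f(1)]
  obtain k :: "nat \<Rightarrow> 'a" where k: "\<And>n. norm (k n) = 1" "\<And>n. f (k n) = 0"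
    "\<And>v e. norm v = 1 \<Longrightarrow> f v = 0 \<Longrightarrow> 0 < e \<Longrightarrow> \<exists>n. norm (v - k n) < e"
    using dense_sequence_in_unit_sphere[OF lf v] by blast
  obtain h :: "nat \<Rightarrow> 'a \<Rightarrow> real" where h: "norming_sequence h" using exists_norming_sequence by blast
  define L where "L = max 1 (onorm f)"
  have L: "1 \<le> L" by (simp add: L_def)
  have fL: "\<bar>f v\<bar> \<le> L * norm v" for v
  proof -
    have "norm (f v) \<le> onorm f * norm v" by (rule onorm[OF f(1)])
    also have "\<dots> \<le> L * norm v" by (intro mult_right_mono) (auto simp: L_def)
    finally show ?thesis by simp
  qed
  define \<rho> where "\<rho> = \<eta> / (4 * L * M)"
  define R where "R = M * (2 * norm x0 + 2)"
  have pos: "0 < M" "0 < L" "0 < \<rho>" using M_ge L \<eta> by (auto simp: \<rho>_def)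
  have R: "0 < R" unfolding R_def using pos by (intro mult_pos_pos) (auto intro: add_nonneg_pos)
  obtain U where U: "U \<subseteq> cball x0 \<rho>" "\<And>u v. u \<in> U \<Longrightarrow> v \<in> U \<Longrightarrow> u \<noteq> v \<Longrightarrow> \<rho> / 4 \<le> norm (u - v)"
    "\<And>x. x \<in> cball x0 \<rho> \<Longrightarrow> \<exists>u\<in>U. x = u \<or> norm (x - u) < \<rho> / 4"
    using maximal_separated_subset[of "cball x0 \<rho>" "\<rho> / 4"] by metis
  let ?cs = "[(norm x0, 1 / 2), (1, 1 / 4), (2 * L * M, \<eta> / 8), (2 * R / (\<rho> / 2), \<rho> / (4 * M)),
    (2 * ((1 + L * norm x0) * R), \<eta> / 8)]"
  have "0 \<le> (1 + L * norm x0) * R" using L R by (intro mult_nonneg_nonneg) auto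
  then have "0 \<le> c \<and> 0 < d" if "(c, d) \<in> set ?cs" for c d using that \<eta> pos R by auto
  from small_positive_solution[OF this] obtain \<tau> where \<tau>: "0 < \<tau>" "\<forall>(c, d)\<in>set ?cs. c * \<tau> < d" by blast
  have "norm x0 * \<tau> < 1 / 2" "\<tau> < 1 / 4" "2 * L * M * \<tau> < \<eta> / 8"
    "2 * R / (\<rho> / 2) * \<tau> < \<rho> / (4 * M)" "2 * ((1 + L * norm x0) * R) * \<tau> < \<eta> / 8"
    using \<tau>(2) by auto
  moreover have "f (g x0) \<le> 1 - \<eta>" if "g \<in> G" "g \<noteq> id" for g using orbit that by blast
  moreover note bg h minus f fL L \<eta> k \<rho>_def R_def U \<tau>(1)
  ultimately have sb: "spiked_body G M h x0 f L \<eta> \<rho> \<tau> R U k"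
    by (intro spiked_body.intro spiked_body_axioms.intro)
  show ?thesis using spiked_body.equivalent_norm_gauge_K[OF sb] spiked_body.isometry_group_eq[OF sb] by blast
qed

theorem renorming_from_exposed_orbit:
  fixes G :: "('a::{real_normed_vector, second_countable_topology} \<Rightarrow> 'a) set" and f :: "'a \<Rightarrow> real"
  assumes bg: "bounded_group G M" and minus: "uminus \<in> G"
    and f: "bounded_linear f" "f x0 = 1" and \<eta>: "0 < \<eta>" "\<eta> \<le> 1"
    and orbit: "\<forall>g\<in>G. g \<noteq> id \<longrightarrow> f (g x0) \<le> 1 - \<eta>"
  shows "\<exists>N. equivalent_norm N \<and> G = isometry_group N"
proof (cases "\<exists>v. f v = 0 \<and> v \<noteq> 0")
  case True
  then obtain v where "f v = 0" "v \<noteq> 0" by blast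
  then show ?thesis by (rule renorming_higher_dimensional[OF bg minus f \<eta> orbit])
next
  case False
  note lf = bounded_linear.linear[OF f(1)]
  have "\<forall>v. v = f v *\<^sub>R x0"
  proof
    fix v
    have "f (v - f v *\<^sub>R x0) = 0" by (simp add: linear_diff[OF lf] linear_scale[OF lf] f(2))
    then have "v - f v *\<^sub>R x0 = 0" using False by blast
    then show "v = f v *\<^sub>R x0" by simp
  qed
  then have "G = isometry_group norm"
    by (rule bounded_group.one_dimensional[OF bg minus lf f(2) _ \<eta>(1) orbit])
  then show ?thesis using equivalent_norm_norm by blast
qed

text \<open>
  If \<open>x0 = 0\<close>, then \<open>x0\<close> can only separate the group \<open>{Id}\<close>; as this contains \<open>-Id\<close>, the space is
  zero. Otherwise the Radon-Nikodym property supplies the functional \<open>f\<close> that exposes \<open>x0\<close> in its orbit.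
\<close>

theorem theorem7:
  fixes G :: "('a::{banach, second_countable_topology} \<Rightarrow> 'a) set" and x0 :: 'a
  assumes "radon_nikodym_property TYPE('a)"
    and "countable G"
    and "bounded_isomorphism_group G"
    and "(\<lambda>x. - x) \<in> G"
    and "separates x0 G"
    and "discrete (orbit_of G x0)"
  shows "\<exists>N. equivalent_norm N \<and> G = isometry_group N"
proof -
  obtain M where bg: "bounded_group G M" using bounded_isomorphism_group_bound[OF assms(3)] by blast
  interpret bounded_group G M by (rule bg)
  have minus: "uminus \<in> G" using assms(4) by simp
  show ?thesis
  proof (cases "x0 = 0")
    case True
    have "uminus x0 = id x0" using True by simp
    then have "uminus = (id :: 'a \<Rightarrow> 'a)" using assms(5) minus id_G unfolding separates_def by blast
    then have "- x = x" for x :: 'a by (metis id_apply)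
    then have zero: "x = 0" for x :: 'a by (metis add.right_inverse scaleR_2 scaleR_eq_0_iff zero_neq_numeral)
    then have "T = id" for T :: "'a \<Rightarrow> 'a" by (metis ext)
    moreover have "id \<in> isometry_group (norm :: 'a \<Rightarrow> real)" by (simp add: isometry_group_def linear_id)
    ultimately have "G = isometry_group norm" using id_G by (metis subsetI subset_antisym)
    then show ?thesis using equivalent_norm_norm by blast
  next
    case False
    obtain f :: "'a \<Rightarrow> real" and \<eta> where f: "bounded_linear f" "f x0 = 1" and \<eta>: "0 < \<eta>" "\<eta> \<le> 1"
      and orbit: "\<forall>g\<in>G. g \<noteq> id \<longrightarrow> f (g x0) \<le> 1 - \<eta>"
      using RNP_orbit_exposing_functional[OF assms(1) bg assms(5,6) minus False] by blast
    show ?thesis by (rule renorming_from_exposed_orbit[OF bg minus f \<eta> orbit])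
  qed
qed

end
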